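(* Suppose that $S$ is countable and that the initial distribution, i.e. the distribution of $\eta_0$, of a symmetric exclusion process $\eta_t$ on $\{0,1\}^S$ is strongly Rayleigh. Then the distribution of $\eta_t$ is strongly Rayleigh, and hence CNA+, for all $t>0$.
   Context: Symmetric exclusion process: let $S$ be a countable (finite or countably infinite) set; a configuration is a point $\eta\in\{0,1\}^S$ (identified with a subset of $S$). One is given a non-negative symmetric kernel $Q=(q_{i,j})_{i,j\in S}$ with $\sup_i\sum_jq_{i,j}<\infty$. The process $\eta_t$ is the Markov process on $\{0,1\}^S$ in which $\eta\to\tau_{i,j}(\eta)$ at rate $q_{i,j}$, where $\tau_{i,j}$ interchanges the coordinates $\eta(i)$ and $\eta(j)$; that is, its semigroup $T(t)F(\eta)=E^\eta F(\eta_t)$ on $C(\{0,1\}^S)$ has generator $\mathcal{L}F(\eta)=\frac12\sum_{i,j}q_{i,j}[F(\tau_{i,j}(\eta))-F(\eta)]$ for functions $F$ depending on finitely many coordinates (the condition on $Q$ guarantees that the process is well defined and uniquely determined by $Q$). For a probability measure $\mu$ on $2^{E}$ with $E$ finite, the generating polynomial is $g_\mu(z)=\sum_{A\subseteq E}\mu(A)\prod_{i\in A}z_i$. A polynomial with complex coefficients is stable if it does not vanish when all variables have positive imaginary part; $\mu$ is strongly Rayleigh if $g_\mu$ is stable. NA, CNA, CNA+ for finite $E$: let $X_i$, $i\in E$, be the coordinate functions. $\mu$ is NA if $\int F\,d\mu\int G\,d\mu\ge\int FG\,d\mu$ for all increasing $F,G:2^E\to\mathbb{R}$ depending on disjoint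 sets of coordinates. $\mu$ is CNA if each measure obtained from $\mu$ by conditioning on some (or none) of the values of the variables $X_i$ (on events of positive probability) is NA. $\mu$ is CNA+ if each measure obtained from $\mu$ by imposing external fields and projections is CNA; here the external field $(a_i)_{i\in E}$, $a_i\ge0$, replaces $g_\mu(z)$ by $g_\mu((a_iz_i)_i)/g_\mu((a_i)_i)$ (when the denominator is nonzero), and projection onto $2^{E'}$, $E'\subseteq E$, sets $z_i=1$ for $i\in E\setminus E'$. For countably infinite $S$, a probability measure on $\{0,1\}^S$ is said to be strongly Rayleigh (respectively CNA+) if its projection (marginal) onto every finite subset of $S$ is strongly Rayleigh (respectively CNA+). *)

theory Defs
  imports "HOL-Probability.Probability"
begin

section \<open>Measures on the subsets of a finite set\<close>

text \<open>
  A probability measure on \<open>2\<^sup>E\<close>, with \<open>E\<close> finite, is a probability measure on the discrete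
  space of subsets of \<open>E\<close>; the coordinate function \<open>X\<^sub>i\<close> is the indicator of \<open>i \<in> A\<close>.
\<close>

definition prob_on :: "'s set \<Rightarrow> 's set measure \<Rightarrow> bool" where
  "prob_on E \<mu> \<longleftrightarrow> finite E \<and> prob_space \<mu> \<and> sets \<mu> = sets (count_space (Pow E))"

definition gen_poly :: "'s set \<Rightarrow> 's set measure \<Rightarrow> ('s \<Rightarrow> complex) \<Rightarrow> complex" where
  "gen_poly E \<mu> z = (\<Sum>A\<in>Pow E. complex_of_real (measure \<mu> {A}) * (\<Prod>i\<in>A. z i))"

definition stable_on :: "'s set \<Rightarrow> (('s \<Rightarrow> complex) \<Rightarrow> complex) \<Rightarrow> bool" where
  "stable_on E g \<longleftrightarrow> (\<forall>z. (\<forall>i\<in>E. Im (z i) > 0) \<longrightarrow> g z \<noteq> 0)"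

definition strongly_Rayleigh_on :: "'s set \<Rightarrow> 's set measure \<Rightarrow> bool" where
  "strongly_Rayleigh_on E \<mu> \<longleftrightarrow> stable_on E (gen_poly E \<mu>)"

definition depends_on :: "'s set \<Rightarrow> ('s set \<Rightarrow> real) \<Rightarrow> 's set \<Rightarrow> bool" where
  "depends_on E F I \<longleftrightarrow> (\<forall>A\<in>Pow E. \<forall>B\<in>Pow E. A \<inter> I = B \<inter> I \<longrightarrow> F A = F B)"

definition NA_on :: "'s set \<Rightarrow> 's set measure \<Rightarrow> bool" where
  "NA_on E \<mu> \<longleftrightarrow>
    (\<forall>F G I J. mono_on (Pow E) F \<and> mono_on (Pow E) G \<and>
       I \<subseteq> E \<and> J \<subseteq> E \<and> I \<inter> J = {} \<and> depends_on E F I \<and> depends_on E G J \<longrightarrow>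
       (\<integral>A. F A \<partial>\<mu>) * (\<integral>A. G A \<partial>\<mu>) \<ge> (\<integral>A. F A * G A \<partial>\<mu>))"

text \<open>
  Conditioning on the values of \<open>X\<^sub>i\<close> for \<open>i \<in> I\<close> means conditioning on an event
  \<open>A \<inter> I = B\<close> with \<open>B \<subseteq> I\<close>; the case \<open>I = {}\<close> is no conditioning.
\<close>

definition CNA_on :: "'s set \<Rightarrow> 's set measure \<Rightarrow> bool" where
  "CNA_on E \<mu> \<longleftrightarrow>
    (\<forall>I B. I \<subseteq> E \<and> B \<subseteq> I \<and> measure \<mu> {A\<in>Pow E. A \<inter> I = B} > 0 \<longrightarrow>
       NA_on E (uniform_measure \<mu> {A\<in>Pow E. A \<inter> I = B}))"

definition external_field_on ::
    "'s set \<Rightarrow> ('s \<Rightarrow> real) \<Rightarrow> 's set measure \<Rightarrow> 's set measure \<Rightarrow> bool" where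
  "external_field_on E a \<mu> \<nu> \<longleftrightarrow>
    (\<forall>i\<in>E. a i \<ge> 0) \<and> gen_poly E \<mu> (\<lambda>i. complex_of_real (a i)) \<noteq> 0 \<and> prob_on E \<nu> \<and>
    (\<forall>z. gen_poly E \<nu> z =
       gen_poly E \<mu> (\<lambda>i. complex_of_real (a i) * z i) / gen_poly E \<mu> (\<lambda>i. complex_of_real (a i)))"

definition subset_projection :: "'s set \<Rightarrow> 's set measure \<Rightarrow> 's set measure" where
  "subset_projection E' \<mu> = distr \<mu> (count_space (Pow E')) (\<lambda>A. A \<inter> E')"

text \<open>
  \<open>fields_projections E \<mu> E' \<nu>\<close>: the measure \<open>\<nu>\<close> on \<open>2\<^bsup>E'\<^esup>\<close> arises from \<open>\<mu>\<close> on \<open>2\<^sup>E\<close> by finitely many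
  external fields and projections, in any order and possibly none.
\<close>

inductive fields_projections ::
    "'s set \<Rightarrow> 's set measure \<Rightarrow> 's set \<Rightarrow> 's set measure \<Rightarrow> bool"
  for E :: "'s set" and \<mu> :: "'s set measure" where
  refl: "fields_projections E \<mu> E \<mu>"
| field: "fields_projections E \<mu> E' \<nu> \<Longrightarrow> external_field_on E' a \<nu> \<nu>' \<Longrightarrow>
    fields_projections E \<mu> E' \<nu>'"
| projection: "fields_projections E \<mu> E' \<nu> \<Longrightarrow> E'' \<subseteq> E' \<Longrightarrow>
    fields_projections E \<mu> E'' (subset_projection E'' \<nu>)"

definition CNA_plus_on :: "'s set \<Rightarrow> 's set measure \<Rightarrow> bool" where
  "CNA_plus_on E \<mu> \<longleftrightarrow> (\<forall>E' \<nu>. fields_projections E \<mu> E' \<nu> \<longrightarrow> CNA_on E' \<nu>)"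


section \<open>Measures on configurations\<close>

text \<open>
  The site set \<open>S\<close> is a countable type, and configurations carry the product topology and its
  Borel sets. A configuration is read as a subset when it is restricted to a finite set of sites.
\<close>

type_synonym 's config = "'s \<Rightarrow> bool"

definition config_marginal :: "'s set \<Rightarrow> 's config measure \<Rightarrow> 's set measure" where
  "config_marginal E \<mu> = distr \<mu> (count_space (Pow E)) (\<lambda>\<eta>. {i\<in>E. \<eta> i})"

definition strongly_Rayleigh :: "('s::countable) config measure \<Rightarrow> bool" where
  "strongly_Rayleigh \<mu> \<longleftrightarrow>
    (if finite (UNIV :: 's set) then strongly_Rayleigh_on UNIV (config_marginal UNIV \<mu>)
     else \<forall>E. finite E \<longrightarrow> strongly_Rayleigh_on E (config_marginal E \<mu>))"

definition CNA_plus :: "('s::countable) config measure \<Rightarrow> bool" where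
  "CNA_plus \<mu> \<longleftrightarrow>
    (if finite (UNIV :: 's set) then CNA_plus_on UNIV (config_marginal UNIV \<mu>)
     else \<forall>E. finite E \<longrightarrow> CNA_plus_on E (config_marginal E \<mu>))"


section \<open>The symmetric exclusion process\<close>

definition exclusion_kernel :: "('s \<Rightarrow> 's \<Rightarrow> real) \<Rightarrow> bool" where
  "exclusion_kernel Q \<longleftrightarrow>
    (\<forall>i j. Q i j \<ge> 0) \<and> (\<forall>i j. Q i j = Q j i) \<and>
    (\<forall>i. Q i summable_on UNIV) \<and> bdd_above (range (\<lambda>i. \<Sum>\<^sub>\<infinity>j. Q i j))"

definition interchange :: "'s \<Rightarrow> 's \<Rightarrow> 's config \<Rightarrow> 's config" where
  "interchange i j \<eta> = \<eta>(i := \<eta> j, j := \<eta> i)"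

text \<open>
  For a cylinder function \<open>F\<close> and a kernel with bounded row sums, the following sum over ordered
  pairs converges absolutely.
\<close>

definition exclusion_generator ::
    "('s \<Rightarrow> 's \<Rightarrow> real) \<Rightarrow> ('s config \<Rightarrow> real) \<Rightarrow> 's config \<Rightarrow> real" where
  "exclusion_generator Q F \<eta> =
    1/2 * (\<Sum>\<^sub>\<infinity>(i,j)\<in>UNIV. Q i j * (F (interchange i j \<eta>) - F \<eta>))"

definition cylinder_function :: "('s config \<Rightarrow> real) \<Rightarrow> bool" where
  "cylinder_function F \<longleftrightarrow>
    (\<exists>E. finite E \<and> (\<forall>\<eta> \<zeta>. (\<forall>i\<in>E. \<eta> i = \<zeta> i) \<longrightarrow> F \<eta> = F \<zeta>))"

text \<open>
  Configurations form a compact space, so the Banach space of bounded continuous functions below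
  is all of \<open>C({0,1}\<^sup>S)\<close> with the supremum norm.
\<close>

definition Markov_semigroup ::
    "(real \<Rightarrow> ('s config \<Rightarrow>\<^sub>C real) \<Rightarrow> ('s config \<Rightarrow>\<^sub>C real)) \<Rightarrow> bool" where
  "Markov_semigroup T \<longleftrightarrow>
    (\<forall>t\<ge>0. linear (T t)) \<and>
    (\<forall>f. T 0 f = f) \<and>
    (\<forall>s\<ge>0. \<forall>t\<ge>0. \<forall>f. T (s + t) f = T s (T t f)) \<and>
    (\<forall>t\<ge>0. T t (const_bcontfun 1) = const_bcontfun 1) \<and>
    (\<forall>t\<ge>0. \<forall>f. (\<forall>\<eta>. 0 \<le> apply_bcontfun f \<eta>) \<longrightarrow> (\<forall>\<eta>. 0 \<le> apply_bcontfun (T t f) \<eta>)) \<and>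
    (\<forall>f. ((\<lambda>t. T t f) \<longlongrightarrow> f) (at_right 0))"

definition in_generator ::
    "(real \<Rightarrow> ('s config \<Rightarrow>\<^sub>C real) \<Rightarrow> ('s config \<Rightarrow>\<^sub>C real)) \<Rightarrow>
     ('s config \<Rightarrow>\<^sub>C real) \<Rightarrow> ('s config \<Rightarrow>\<^sub>C real) \<Rightarrow> bool" where
  "in_generator T f g \<longleftrightarrow> ((\<lambda>t. (T t f - f) /\<^sub>R t) \<longlongrightarrow> g) (at_right 0)"

definition exclusion_semigroup ::
    "('s \<Rightarrow> 's \<Rightarrow> real) \<Rightarrow> (real \<Rightarrow> ('s config \<Rightarrow>\<^sub>C real) \<Rightarrow> ('s config \<Rightarrow>\<^sub>C real)) \<Rightarrow> bool" where
  "exclusion_semigroup Q T \<longleftrightarrow> Markov_semigroup T \<and>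
    (\<forall>f. cylinder_function (apply_bcontfun f) \<longrightarrow>
      (\<exists>g. in_generator T f g \<and>
        (\<forall>\<eta>. apply_bcontfun g \<eta> = exclusion_generator Q (apply_bcontfun f) \<eta>)))"

definition natural_filtration ::
    "'w measure \<Rightarrow> (real \<Rightarrow> 'w \<Rightarrow> 's config) \<Rightarrow> real \<Rightarrow> 'w measure" where
  "natural_filtration M \<eta> s =
    sigma (space M) {\<eta> u -` B \<inter> space M | u B. u \<in> {0..s} \<and> B \<in> sets borel}"

definition Markov_process ::
    "'w measure \<Rightarrow> (real \<Rightarrow> ('s config \<Rightarrow>\<^sub>C real) \<Rightarrow> ('s config \<Rightarrow>\<^sub>C real)) \<Rightarrow>
     (real \<Rightarrow> 'w \<Rightarrow> 's config) \<Rightarrow> bool" where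
  "Markov_process M T \<eta> \<longleftrightarrow> prob_space M \<and>
    (\<forall>t\<ge>0. \<eta> t \<in> M \<rightarrow>\<^sub>M borel) \<and>
    (\<forall>s\<ge>0. \<forall>t\<ge>0. \<forall>f. AE \<omega> in M.
      real_cond_exp M (natural_filtration M \<eta> s) (\<lambda>\<omega>. apply_bcontfun f (\<eta> (s + t) \<omega>)) \<omega> =
      apply_bcontfun (T t f) (\<eta> s \<omega>))"

definition symmetric_exclusion_process ::
    "'w measure \<Rightarrow> ('s::countable \<Rightarrow> 's \<Rightarrow> real) \<Rightarrow> (real \<Rightarrow> 'w \<Rightarrow> 's config) \<Rightarrow> bool" where
  "symmetric_exclusion_process M Q \<eta> \<longleftrightarrow>
    exclusion_kernel Q \<and> (\<exists>T. exclusion_semigroup Q T \<and> Markov_process M T \<eta>)"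

end

theory Submission
  imports Defs "HOL-Complex_Analysis.Complex_Analysis"
    "HOL-Computational_Algebra.Fundamental_Theorem_Algebra"
begin

text \<open>
  In the variables \<open>z\<^sub>i - 1\<close> the generating polynomial of a marginal of \<open>\<eta>\<^sub>t\<close> has the coefficients
  \<open>P(\<eta>\<^sub>t = 1 on A)\<close>, and by duality these solve a linear equation whose generator sums
  the operators \<open>u \<mapsto> u \<circ> \<tau>\<^sub>i\<^sub>j - u\<close>; it is bounded on functions of sets with at most \<open>k\<close> elements. Its solution
  is a limit of compositions of partial symmetrizations \<open>u \<mapsto> (1 - \<theta>) u + \<theta> (u \<circ> \<tau>\<^sub>i\<^sub>j)\<close>. These preserve
  stability of multi-affine polynomials, and so do limits, by Hurwitz's theorem.

  Conditioning, external fields and projections preserve stability as well, so for CNA+ it remains to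
  see that a strongly Rayleigh measure is NA. Its symmetric homogenization is stable; for
  homogeneous stable weights all conditioned measures have pairwise negative correlations, and
  the argument of Feder and Mihail, by induction on the number of sites, gives NA.
\<close>

section \<open>Stable multi-affine polynomials\<close>

text \<open>Occupation probabilities make an infinite \<open>S\<close> tractable. Point masses of a
  marginal satisfy no closed equation, since particles enter a finite set from outside, while
  \<open>P(\<eta>\<^sub>t = 1 on A)\<close> is coupled only to sets of the same cardinality, and
  there the generator is bounded by a multiple of \<open>card A\<close>. Moreover a projection
  merely forgets coefficients. The process enters only through the generator on cylinder functions.
  The flow is therefore tied to its stable approximations by error estimates for the dual equation,
  not by a convergence theorem for processes. Two obstacles shape the part on stability. Limits of
  stable polynomials may vanish identically, so zero is carried along as an alternative and excluded
  later by normalisation. And the Feder-Mihail argument needs a constant number of points, while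
  homogenizing with a single variable destroys multi-affinity; that variable is therefore polarized
  into a second copy of the sites by the Grace-Walsh-Szego theorem.\<close>

definition multiaffine :: "'a set \<Rightarrow> ('a set \<Rightarrow> complex) \<Rightarrow> ('a \<Rightarrow> complex) \<Rightarrow> complex" where
  "multiaffine E c z = (\<Sum>A\<in>Pow E. c A * (\<Prod>i\<in>A. z i))"

text \<open>A limit of stable polynomials can be identically zero, so stability alone is not closed
  under limits; the zero alternative restores closure.\<close>

definition stable_or_zero :: "'a set \<Rightarrow> ('a set \<Rightarrow> complex) \<Rightarrow> bool" where
  "stable_or_zero E c \<longleftrightarrow> stable_on E (multiaffine E c) \<or> (\<forall>A\<subseteq>E. c A = 0)"

lemma stable_onD: "stable_on E g \<Longrightarrow> (\<And>i. i \<in> E \<Longrightarrow> Im (z i) > 0) \<Longrightarrow> g z \<noteq> 0"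
  by (simp add: stable_on_def)

lemma multiaffine_cong:
  assumes "\<And>A. A \<subseteq> E \<Longrightarrow> c A = d A" "\<And>i. i \<in> E \<Longrightarrow> z i = w i"
  shows "multiaffine E c z = multiaffine E d w"
  unfolding multiaffine_def using assms by (intro sum.cong HOL.refl arg_cong2[where f=times] prod.cong) auto

lemma multiaffine_zero: "(\<And>A. A \<subseteq> E \<Longrightarrow> c A = 0) \<Longrightarrow> multiaffine E c z = 0"
  unfolding multiaffine_def by (intro sum.neutral) auto

lemma multiaffine_add:
  "multiaffine E (\<lambda>A. c A + d A) z = multiaffine E c z + multiaffine E d z"
  unfolding multiaffine_def by (simp add: sum.distrib algebra_simps)

lemma multiaffine_cmult: "multiaffine E (\<lambda>A. k * c A) z = k * multiaffine E c z"
  unfolding multiaffine_def by (simp add: sum_distrib_left algebra_simps)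

lemma stable_or_zero_cong:
  assumes "\<And>A. A \<subseteq> E \<Longrightarrow> c A = d A"
  shows "stable_or_zero E c \<longleftrightarrow> stable_or_zero E d"
proof -
  have "multiaffine E c z = multiaffine E d z" for z
    using assms by (intro multiaffine_cong) auto
  then show ?thesis
    using assms unfolding stable_or_zero_def stable_on_def by auto
qed

lemma stable_or_zero_nonzero:
  assumes "stable_or_zero E c" "A \<subseteq> E" "c A \<noteq> 0"
  shows "stable_on E (multiaffine E c)"
  using assms unfolding stable_or_zero_def by auto

lemma multiaffine_insert:
  assumes "finite E" "i \<notin> E"
  shows "multiaffine (insert i E) c z = multiaffine E c z + z i * multiaffine E (\<lambda>A. c (insert i A)) z"
proof -
  have inj: "inj_on (insert i) (Pow E)"
    using assms(2) by (auto simp: inj_on_def)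
  have "(\<Prod>k\<in>insert i A. z k) = z i * (\<Prod>k\<in>A. z k)" if "A \<in> Pow E" for A
    using that assms by (subst prod.insert) (auto intro: finite_subset)
  then have "(\<Sum>A\<in>insert i ` Pow E. c A * (\<Prod>k\<in>A. z k)) = z i * multiaffine E (\<lambda>A. c (insert i A)) z"
    unfolding multiaffine_def sum_distrib_left by (subst sum.reindex[OF inj]) (auto intro!: sum.cong simp: algebra_simps)
  then show ?thesis
    unfolding multiaffine_def Pow_insert using assms by (subst sum.union_disjoint) auto
qed

text \<open>Evaluate at the indicator of a smallest set \<open>B\<close> with
  \<open>c B \<noteq> 0\<close>: any other set in the support contains a site outside
  \<open>B\<close>, where the point is 0.\<close>

lemma multiaffine_nonzero_point:
  assumes "finite E" "A \<subseteq> E" "c A \<noteq> 0"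
  obtains w where "multiaffine E c w \<noteq> 0"
proof -
  obtain B where B: "B \<subseteq> E" "c B \<noteq> 0" and min: "\<And>C. C \<subseteq> E \<Longrightarrow> c C \<noteq> 0 \<Longrightarrow> card B \<le> card C"
    using ex_has_least_nat[of "\<lambda>A. A \<subseteq> E \<and> c A \<noteq> 0" A card] assms by auto
  define w :: "'a \<Rightarrow> complex" where "w = (\<lambda>i. if i \<in> B then 1 else 0)"
  have "c C * (\<Prod>i\<in>C. w i) = (if C = B then c B else 0)" if "C \<in> Pow E" for C
  proof -
    have "(\<Prod>i\<in>C. w i) = 0" if "\<not> C \<subseteq> B"
      using that \<open>C \<in> Pow E\<close> assms(1) by (auto simp: w_def prod_zero_iff finite_subset)
    moreover have "c C = 0" if "C \<subset> B"
      using min[of C] psubset_card_mono[OF finite_subset[OF B(1) assms(1)] that] \<open>C \<in> Pow E\<close> by force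
    moreover have "(\<Prod>i\<in>B. w i) = 1" by (simp add: w_def)
    ultimately show ?thesis by auto
  qed
  then have "multiaffine E c w = c B"
    unfolding multiaffine_def using B assms(1) by (simp add: sum.delta)
  then show ?thesis using that[of w] B by auto
qed

lemma uniform_limit_finite_sum:
  fixes f :: "'i \<Rightarrow> 'n \<Rightarrow> 'x \<Rightarrow> 'b::real_normed_vector"
  assumes "finite I" "\<And>i. i \<in> I \<Longrightarrow> uniform_limit K (f i) (g i) F"
  shows "uniform_limit K (\<lambda>n x. \<Sum>i\<in>I. f i n x) (\<lambda>x. \<Sum>i\<in>I. g i x) F"
  using assms by (induction I rule: finite_induct) (auto intro!: uniform_limit_intros)

text \<open>Hurwitz's theorem in one variable, along the complex line from a supposed zero
  \<open>z\<close> of the limit to a point \<open>w\<close> at which the limit does not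
  vanish.\<close>

lemma stable_or_zero_limit:
  assumes fin: "finite E"
    and st: "\<And>n::nat. stable_or_zero E (c n)"
    and lim: "\<And>A. A \<subseteq> E \<Longrightarrow> (\<lambda>n. c n A) \<longlonglongrightarrow> c' A"
  shows "stable_or_zero E c'"
proof (cases "\<forall>A\<subseteq>E. c' A = 0")
  case True
  then show ?thesis by (simp add: stable_or_zero_def)
next
  case False
  then obtain A where A: "A \<subseteq> E" "c' A \<noteq> 0" by auto
  have "eventually (\<lambda>n. c n A \<noteq> 0) sequentially"
    using lim[OF A(1)] A(2) by (rule tendsto_imp_eventually_ne)
  then obtain N where N: "\<And>n. n \<ge> N \<Longrightarrow> c n A \<noteq> 0"
    by (auto simp: eventually_sequentially)
  \<comment> \<open>From \<open>N\<close> on the zero alternative is excluded, so the shifted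
    sequence is stable.\<close>
  define d where "d = (\<lambda>n. c (n + N))"
  have d_st: "stable_on E (multiaffine E (d n))" for n
    using stable_or_zero_nonzero[OF st A(1)] N by (simp add: d_def)
  have d_lim: "(\<lambda>n. d n A) \<longlonglongrightarrow> c' A" if "A \<subseteq> E" for A
    using lim[OF that] unfolding d_def by (rule LIMSEQ_ignore_initial_segment)
  obtain w where w: "multiaffine E c' w \<noteq> 0"
    using multiaffine_nonzero_point[of E A c'] fin A by blast
  have "multiaffine E c' z \<noteq> 0" if z: "\<forall>i\<in>E. Im (z i) > 0" for z
  proof
    assume zero: "multiaffine E c' z = 0"
    define p where "p = (\<lambda>s i. z i + s * (w i - z i))"
    \<comment> \<open>Parameters for which the line stays in the upper half-space. The parameter
      \<open>1\<close> of the point \<open>w\<close> may lie outside, so non-constancy on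
      \<open>S\<close> is derived by analytic continuation.\<close>
    define S where "S = (\<Inter>i\<in>E. {s. Im (p s i) > 0})"
    have hol: "(\<lambda>s. multiaffine E e (p s)) holomorphic_on X" for e X
      unfolding multiaffine_def p_def by (intro holomorphic_intros)
    have openS: "open S"
      unfolding S_def p_def by (intro open_INT fin ballI open_Collect_less continuous_intros)
    have cvx: "convex {s. Im (p s i) > 0}" for i
    proof -
      have "{s. Im (p s i) > 0} = (\<lambda>s. s * (w i - z i)) -` {u. Im u > - Im (z i)}"
        by (auto simp: p_def)
      moreover have "linear (\<lambda>s::complex. s * (w i - z i))"
        by (simp add: bounded_linear.linear bounded_linear_mult_left)
      ultimately show ?thesis
        using convex_linear_vimage convex_halfspace_Im_gt by metis
    qed
    then have conS: "connected S"
      unfolding S_def by (intro convex_connected convex_INT)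
    have S0: "0 \<in> S" using z by (auto simp: S_def p_def)
    have "multiaffine E c' (p 0) \<noteq> 0"
    proof (rule Hurwitz_no_zeros[OF openS conS, of "\<lambda>n s. multiaffine E (d n) (p s)" "\<lambda>s. multiaffine E c' (p s)" 0])
      fix K :: "complex set" assume K: "compact K" "K \<subseteq> S"
      have "uniform_limit K (\<lambda>n s. d n A * (\<Prod>i\<in>A. p s i)) (\<lambda>s. c' A * (\<Prod>i\<in>A. p s i)) sequentially"
        if "A \<in> Pow E" for A
      proof (rule uniform_lim_mult)
        show "uniform_limit K (\<lambda>n s. d n A) (\<lambda>s. c' A) sequentially"
          using d_lim[of A] that by (auto simp: uniform_limit_iff tendsto_iff)
        show "uniform_limit K (\<lambda>n s. \<Prod>i\<in>A. p s i) (\<lambda>s. \<Prod>i\<in>A. p s i) sequentially"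
          by (auto simp: uniform_limit_iff)
        show "bounded ((\<lambda>s. c' A) ` K)" by (rule boundedI[of _ "norm (c' A)"]) auto
        have "continuous_on K (\<lambda>s. \<Prod>i\<in>A. p s i)"
          unfolding p_def by (intro continuous_intros)
        then show "bounded ((\<lambda>s. \<Prod>i\<in>A. p s i) ` K)"
          using K(1) compact_continuous_image compact_imp_bounded by blast
      qed
      then show "uniform_limit K (\<lambda>n s. multiaffine E (d n) (p s)) (\<lambda>s. multiaffine E c' (p s)) sequentially"
        unfolding multiaffine_def using fin by (intro uniform_limit_finite_sum) auto
    next
      show "\<not> (\<lambda>s. multiaffine E c' (p s)) constant_on S"
      proof
        assume "(\<lambda>s. multiaffine E c' (p s)) constant_on S"
        then obtain k where k: "\<And>s. s \<in> S \<Longrightarrow> multiaffine E c' (p s) = k"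
          unfolding constant_on_def by auto
        have "multiaffine E c' (p 0) = 0" using zero by (simp add: p_def)
        then have "multiaffine E c' (p s) = 0" if "s \<in> S" for s
          using k[OF S0] k[OF that] by simp
        then have "multiaffine E c' (p 1) = 0"
          using analytic_continuation_open[of S UNIV "\<lambda>s. multiaffine E c' (p s)" "\<lambda>_. 0" 1] openS S0 hol
          by auto
        then show False using w by (simp add: p_def)
      qed
    next
      fix n s assume "s \<in> S"
      then show "multiaffine E (d n) (p s) \<noteq> 0"
        using d_st[of n] unfolding stable_on_def S_def by auto
    qed (use hol S0 in auto)
    then show False using zero by (simp add: p_def)
  qed
  then show ?thesis by (auto simp: stable_or_zero_def stable_on_def)
qed

section \<open>Scaling, specialization and conditioning\<close>

lemma inverse_power_limit: "(\<lambda>n. (1 / real (Suc n)) ^ k) \<longlonglongrightarrow> (if k = 0 then 1 else 0)"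
proof (cases "k = 0")
  case False
  have "(\<lambda>n. 1 / real (Suc n)) \<longlonglongrightarrow> 0"
    by (rule LIMSEQ_Suc[OF lim_1_over_n])
  from tendsto_power[OF this, of k] show ?thesis using False by (simp add: power_0_left)
qed simp

lemma stable_or_zero_scale_pos:
  assumes "stable_or_zero E c" "\<And>i. i \<in> E \<Longrightarrow> a i > 0"
  shows "stable_or_zero E (\<lambda>A. c A * complex_of_real (\<Prod>i\<in>A. a i))"
proof -
  have "multiaffine E (\<lambda>A. c A * complex_of_real (\<Prod>i\<in>A. a i)) z = multiaffine E c (\<lambda>i. complex_of_real (a i) * z i)"
    for z :: "'a \<Rightarrow> complex"
    unfolding multiaffine_def by (simp add: prod.distrib algebra_simps)
  then show ?thesis using assms unfolding stable_or_zero_def stable_on_def by auto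
qed

text \<open>A zero factor sends a variable to the real axis, so it is approached through the
  positive factors \<open>a i + 1 / (n + 1)\<close>.\<close>

lemma stable_or_zero_scale:
  assumes "finite E" "stable_or_zero E c" "\<And>i. i \<in> E \<Longrightarrow> a i \<ge> 0"
  shows "stable_or_zero E (\<lambda>A. c A * complex_of_real (\<Prod>i\<in>A. a i))"
proof (rule stable_or_zero_limit[OF assms(1)])
  show "stable_or_zero E (\<lambda>A. c A * complex_of_real (\<Prod>i\<in>A. a i + 1 / real (Suc n)))" for n
    using assms(3) by (intro stable_or_zero_scale_pos[OF assms(2)] add_nonneg_pos) auto
  show "(\<lambda>n. c A * complex_of_real (\<Prod>i\<in>A. a i + 1 / real (Suc n))) \<longlonglongrightarrow> c A * complex_of_real (\<Prod>i\<in>A. a i)" for A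
    using tendsto_add[OF tendsto_const lim_1_over_n[THEN LIMSEQ_Suc]]
    by (intro tendsto_mult tendsto_of_real tendsto_prod tendsto_const) fastforce
qed

lemma stable_or_zero_cmult:
  assumes "stable_or_zero E c"
  shows "stable_or_zero E (\<lambda>A. k * c A)"
  using assms by (cases "k = 0") (auto simp: stable_or_zero_def stable_on_def multiaffine_cmult)

lemma multiaffine_union:
  assumes "finite D" "finite F" "D \<inter> F = {}"
  shows "multiaffine (D \<union> F) c z = multiaffine D (\<lambda>A. multiaffine F (\<lambda>B. c (A \<union> B)) z) z"
proof -
  have "(\<Sum>A\<in>Pow (D \<union> F). c A * (\<Prod>i\<in>A. z i)) =
     (\<Sum>(A,B)\<in>Pow D \<times> Pow F. c (A \<union> B) * (\<Prod>i\<in>A \<union> B. z i))"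
    by (rule sum.reindex_bij_witness[of _ "\<lambda>(A,B). A \<union> B" "\<lambda>A. (A \<inter> D, A \<inter> F)"])
      (use assms(3) in \<open>auto simp: Int_Un_distrib[symmetric] Int_absorb2\<close>)
  also have "\<dots> = (\<Sum>(A,B)\<in>Pow D \<times> Pow F. c (A \<union> B) * ((\<Prod>i\<in>A. z i) * (\<Prod>i\<in>B. z i)))"
  proof (rule sum.cong[OF HOL.refl])
    fix x assume "x \<in> Pow D \<times> Pow F"
    then obtain A B where x: "x = (A, B)" "A \<subseteq> D" "B \<subseteq> F" by auto
    then have "(\<Prod>i\<in>A \<union> B. z i) = (\<Prod>i\<in>A. z i) * (\<Prod>i\<in>B. z i)"
      using assms by (intro prod.union_disjoint) (auto intro: finite_subset)
    then show "(case x of (A, B) \<Rightarrow> c (A \<union> B) * (\<Prod>i\<in>A \<union> B. z i)) =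
        (case x of (A, B) \<Rightarrow> c (A \<union> B) * ((\<Prod>i\<in>A. z i) * (\<Prod>i\<in>B. z i)))"
      by (simp add: x(1))
  qed
  also have "\<dots> = (\<Sum>A\<in>Pow D. \<Sum>B\<in>Pow F. c (A \<union> B) * ((\<Prod>i\<in>A. z i) * (\<Prod>i\<in>B. z i)))"
    by (rule sum.cartesian_product[symmetric])
  finally show ?thesis
    unfolding multiaffine_def by (simp add: sum_distrib_left sum_distrib_right algebra_simps)
qed

text \<open>Real values lie on the boundary of the half-plane. The points
  \<open>x i + \<i> / (n + 1)\<close> lie inside and keep stability; the limit may vanish
  identically, which the zero alternative absorbs.\<close>

lemma stable_or_zero_specialize:
  assumes "finite D" "finite F" "D \<inter> F = {}" and st: "stable_or_zero (D \<union> F) c"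
  shows "stable_or_zero D (\<lambda>A. multiaffine F (\<lambda>B. c (A \<union> B)) (\<lambda>i. complex_of_real (x i)))"
proof (rule stable_or_zero_limit[OF assms(1)])
  fix n
  define w :: "'a \<Rightarrow> complex" where "w = (\<lambda>i. Complex (x i) (1 / Suc n))"
  show "stable_or_zero D (\<lambda>A. multiaffine F (\<lambda>B. c (A \<union> B)) (\<lambda>i. Complex (x i) (1 / Suc n)))"
  proof (cases "\<forall>A\<subseteq>D\<union>F. c A = 0")
    case True
    then show ?thesis unfolding stable_or_zero_def by (intro disjI2 allI impI multiaffine_zero) (auto intro!: True[rule_format])
  next
    case False
    then have st': "stable_on (D \<union> F) (multiaffine (D \<union> F) c)"
      using st by (auto simp: stable_or_zero_def)
    have "multiaffine D (\<lambda>A. multiaffine F (\<lambda>B. c (A \<union> B)) w) z \<noteq> 0" if "\<forall>i\<in>D. Im (z i) > 0" for z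
    proof -
      define y where "y = (\<lambda>i. if i \<in> D then z i else w i)"
      have "multiaffine (D \<union> F) c y \<noteq> 0"
        using st' that unfolding stable_on_def by (auto simp: y_def w_def)
      moreover have "multiaffine (D \<union> F) c y = multiaffine D (\<lambda>A. multiaffine F (\<lambda>B. c (A \<union> B)) w) z"
        unfolding multiaffine_union[OF assms(1-3)]
        using assms(3) by (intro multiaffine_cong) (auto simp: y_def)
      ultimately show ?thesis by simp
    qed
    then show ?thesis unfolding stable_or_zero_def stable_on_def w_def by auto
  qed
next
  fix A
  have "(\<lambda>n. Complex (x i) (1 / Suc n)) \<longlonglongrightarrow> complex_of_real (x i)" for i
    using tendsto_Complex[OF tendsto_const lim_1_over_n[THEN LIMSEQ_Suc]]
    by (simp add: complex_of_real_def)
  then show "(\<lambda>n. multiaffine F (\<lambda>B. c (A \<union> B)) (\<lambda>i. Complex (x i) (1 / Suc n)))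
    \<longlonglongrightarrow> multiaffine F (\<lambda>B. c (A \<union> B)) (\<lambda>i. complex_of_real (x i))"
    unfolding multiaffine_def by (intro tendsto_sum tendsto_mult tendsto_const tendsto_prod)
qed

text \<open>As the base tends to 0, only the coefficients with exponent 0 survive. Different choices
  of \<open>e\<close> yield conditioning and the extreme homogeneous parts.\<close>

lemma stable_or_zero_power_limit:
  assumes "finite E" "\<And>n. stable_or_zero E (\<lambda>A. c A * complex_of_real ((1 / real (Suc n)) ^ e A))"
  shows "stable_or_zero E (\<lambda>A. if e A = 0 then c A else 0)"
proof (rule stable_or_zero_limit[OF assms])
  fix A
  have "(\<lambda>n. c A * complex_of_real ((1 / real (Suc n)) ^ e A)) \<longlonglongrightarrow> c A * complex_of_real (if e A = 0 then 1 else 0)"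
    by (intro tendsto_mult tendsto_const tendsto_of_real inverse_power_limit)
  then show "(\<lambda>n. c A * complex_of_real ((1 / real (Suc n)) ^ e A)) \<longlonglongrightarrow> (if e A = 0 then c A else 0)"
    by (auto split: if_splits)
qed

text \<open>Conditioning is a limit of external fields: a field \<open>n\<close> on \<open>B\<close> and \<open>1/n\<close> on \<open>I - B\<close>,
  normalised by \<open>n\<^bsup>card B\<^esup>\<close>.\<close>

lemma stable_or_zero_condition:
  assumes fin: "finite E" and "I \<subseteq> E" "B \<subseteq> I" and st: "stable_or_zero E c"
  shows "stable_or_zero E (\<lambda>A. if A \<inter> I = B then c A else 0)"
proof -
  \<comment> \<open>\<open>e A\<close> counts the sites of \<open>I\<close> at which
    \<open>A\<close> deviates from \<open>B\<close>; the normalised field multiplies the coefficient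
    of \<open>A\<close> by \<open>(1 / (n + 1))^(e A)\<close>.\<close>
  define e where "e = (\<lambda>A. card (B - A) + card (A \<inter> (I - B)))"
  have "stable_or_zero E (\<lambda>A. c A * complex_of_real ((1 / real (Suc n)) ^ e A))" for n
  proof -
    define a where "a = (\<lambda>i. if i \<in> B then real (Suc n) else if i \<in> I then 1 / real (Suc n) else 1)"
    have scaled: "stable_or_zero E (\<lambda>A. complex_of_real (1 / real (Suc n) ^ card B) * (c A * complex_of_real (\<Prod>i\<in>A. a i)))"
      by (intro stable_or_zero_cmult stable_or_zero_scale_pos[OF st]) (auto simp: a_def)
    have eq: "complex_of_real (1 / real (Suc n) ^ card B) * (c A * complex_of_real (\<Prod>i\<in>A. a i))
       = c A * complex_of_real ((1 / real (Suc n)) ^ e A)" if "A \<subseteq> E" for A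
    proof -
      have finA: "finite A" using that fin finite_subset by blast
      have finB: "finite B" using assms finite_subset by metis
      have "(\<Prod>i\<in>A. a i) = (\<Prod>i\<in>A \<inter> B. a i) * (\<Prod>i\<in>A \<inter> (I - B). a i) * (\<Prod>i\<in>A - I. a i)"
        using finA assms(3)
        by (subst prod.union_disjoint[symmetric], auto, subst prod.union_disjoint[symmetric], auto intro!: prod.cong)
      also have "(\<Prod>i\<in>A \<inter> B. a i) = real (Suc n) ^ card (A \<inter> B)"
        by (simp add: a_def)
      also have "(\<Prod>i\<in>A \<inter> (I - B). a i) = (1 / real (Suc n)) ^ card (A \<inter> (I - B))"
        by (subst prod_constant[symmetric], rule prod.cong) (auto simp: a_def)
      also have "(\<Prod>i\<in>A - I. a i) = 1"
        using assms(3) by (intro prod.neutral) (auto simp: a_def)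
      finally have 1: "(\<Prod>i\<in>A. a i) = real (Suc n) ^ card (A \<inter> B) * (1 / real (Suc n)) ^ card (A \<inter> (I - B))"
        by simp
      have "card B = card (A \<inter> B) + card (B - A)"
        using card_Int_Diff[OF finB, of A] by (simp add: Int_commute)
      then show ?thesis unfolding 1 by (simp add: e_def power_add field_simps del: of_nat_Suc)
    qed
    show ?thesis
      by (rule iffD1[OF stable_or_zero_cong[OF eq] scaled])
  qed
  then have "stable_or_zero E (\<lambda>A. if e A = 0 then c A else 0)"
    by (rule stable_or_zero_power_limit[OF fin])
  moreover have "e A = 0 \<longleftrightarrow> A \<inter> I = B" if "A \<subseteq> E" for A
  proof -
    have "finite (B - A)" "finite (A \<inter> (I - B))"
      using that fin assms by (auto intro: finite_subset)
    then show ?thesis using assms(3) by (auto simp: e_def)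
  qed
  ultimately show ?thesis
    by (elim iffD1[OF stable_or_zero_cong, rotated]) simp
qed

lemma stable_or_zero_deletion:
  assumes "finite E" "e \<notin> E" "stable_or_zero (insert e E) c"
  shows "stable_or_zero E c"
proof -
  have "stable_or_zero E (\<lambda>A. multiaffine {e} (\<lambda>B. c (A \<union> B)) (\<lambda>i. complex_of_real 0))"
    using assms by (intro stable_or_zero_specialize) auto
  then show ?thesis by (simp add: multiaffine_def Pow_insert)
qed

text \<open>Conditioning on \<open>e\<close> leaves \<open>z e\<close> times the partial derivative
  in \<open>z e\<close>; setting \<open>z e = 1\<close> then yields that derivative.\<close>

lemma stable_or_zero_contraction:
  assumes "finite E" "e \<notin> E" "stable_or_zero (insert e E) c"
  shows "stable_or_zero E (\<lambda>A. c (insert e A))"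
proof -
  have "stable_or_zero (insert e E) (\<lambda>A. if A \<inter> {e} = {e} then c A else 0)"
    using assms by (intro stable_or_zero_condition) auto
  then have "stable_or_zero E (\<lambda>A. multiaffine {e} (\<lambda>B. if (A \<union> B) \<inter> {e} = {e} then c (A \<union> B) else 0)
      (\<lambda>i. complex_of_real 1))"
    using assms by (intro stable_or_zero_specialize) auto
  then show ?thesis
    by (rule iffD1[OF stable_or_zero_cong, rotated]) (use assms(2) in \<open>auto simp: multiaffine_def Pow_insert\<close>)
qed

section \<open>Partial symmetrization\<close>

text \<open>For \<open>Q \<noteq> 0\<close> the only zero is \<open>w = - P / Q\<close>, whose
  imaginary part has the sign opposite to \<open>Im (P * cnj Q)\<close>. Stability in one variable
  thus becomes an inequality in the remaining ones.\<close>

lemma sum_nonvanishing_iff: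
  "(\<forall>w. Im w > 0 \<longrightarrow> P + Q * w \<noteq> 0) \<longleftrightarrow> (P \<noteq> 0 \<or> Q \<noteq> 0) \<and> Im (P * cnj Q) \<ge> 0"
proof (cases "Q = 0")
  case True
  then show ?thesis by (auto intro: exI[of _ \<i>])
next
  case False
  have "P + Q * w = 0 \<longleftrightarrow> w = - (P * cnj Q) / of_real ((cmod Q)\<^sup>2)" for w
  proof -
    have "P + Q * w = 0 \<longleftrightarrow> w = - P / Q" using False by (auto simp: field_simps add_eq_0_iff)
    also have "- P / Q = - (P * cnj Q) / of_real ((cmod Q)\<^sup>2)"
      using complex_div_cnj[of "-P" Q] by simp
    finally show ?thesis .
  qed
  moreover have "Im (- (P * cnj Q) / of_real ((cmod Q)\<^sup>2)) > 0 \<longleftrightarrow> Im (P * cnj Q) < 0"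
    using False by (simp only: Im_divide_of_real) (simp add: zero_less_divide_iff)
  ultimately show ?thesis using False by (metis linorder_not_le)
qed

text \<open>With \<open>\<lambda> = 1 - 2\<theta>\<close> the symmetrised polynomial is \<open>P\<^sub>\<lambda> + z\<^sub>2 Q\<^sub>\<lambda>\<close>, where
  \<open>Im (P\<^sub>\<lambda> cnj Q\<^sub>\<lambda>)\<close> is quadratic in \<open>\<lambda>\<close> with leading coefficient \<open>- |b - c|\<^sup>2 / 4 * Im z\<^sub>1\<close>.
  It is therefore concave, and it is nonnegative at \<open>\<lambda> = \<plusminus>1\<close>.\<close>

lemma bivariate_symmetrization_nonvanishing:
  fixes a b c d :: complex
  assumes nz: "\<And>z w. Im z > 0 \<Longrightarrow> Im w > 0 \<Longrightarrow> a + b * z + c * w + d * z * w \<noteq> 0"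
    and \<theta>: "0 \<le> \<theta>" "\<theta> \<le> 1" and z: "Im z > 0" and w: "Im w > 0"
  shows "a + ((1 - of_real \<theta>) * b + of_real \<theta> * c) * z + ((1 - of_real \<theta>) * c + of_real \<theta> * b) * w + d * z * w \<noteq> 0"
proof (cases "\<theta> = 0 \<or> \<theta> = 1 \<or> b = c")
  case True
  then show ?thesis using nz[OF z w] nz[OF w z] by (auto simp: algebra_simps)
next
  case False
  define \<beta> \<gamma> where "\<beta> = (b + c) / 2" and "\<gamma> = (b - c) / 2"
  define l where "l = 1 - 2 * \<theta>"
  have bc: "b = \<beta> + \<gamma>" "c = \<beta> - \<gamma>" by (auto simp: \<beta>_def \<gamma>_def field_simps)
  have \<gamma>: "\<gamma> \<noteq> 0" using False by (simp add: \<gamma>_def)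
  define P Q where "P = (\<lambda>s::real. a + (\<beta> + of_real s * \<gamma>) * z)" and "Q = (\<lambda>s::real. \<beta> - of_real s * \<gamma> + d * z)"
  define R where "R = (\<lambda>s. Im (P s * cnj (Q s)))"
  have R1: "R 1 \<ge> 0"
  proof -
    have "P 1 + Q 1 * v \<noteq> 0" if "Im v > 0" for v
      using nz[OF z that] by (simp add: P_def Q_def bc algebra_simps)
    then show ?thesis using sum_nonvanishing_iff[of "P 1" "Q 1"] by (simp add: R_def)
  qed
  have R2: "R (-1) \<ge> 0"
  proof -
    have "P (-1) + Q (-1) * v \<noteq> 0" if "Im v > 0" for v
      using nz[OF that z] by (simp add: P_def Q_def bc algebra_simps)
    then show ?thesis using sum_nonvanishing_iff[of "P (-1)" "Q (-1)"] by (simp add: R_def)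
  qed
  \<comment> \<open>A quadratic equals the chord through its values at \<open>1\<close> and
    \<open>-1\<close> plus its leading coefficient times \<open>l^2 - 1\<close>. The strict
    positivity obtained from this also rules out \<open>P l = Q l = 0\<close>.\<close>
  have "R l = (1 + l) / 2 * R 1 + (1 - l) / 2 * R (-1) + (1 - l\<^sup>2) * ((cmod \<gamma>)\<^sup>2 * Im z)"
    unfolding R_def P_def Q_def cmod_power2 by (simp add: field_simps power2_eq_square)
  moreover have "1 + l > 0" "1 - l > 0" "1 - l\<^sup>2 > 0"
  proof -
    show "1 + l > 0" "1 - l > 0" using \<theta> False by (auto simp: l_def)
    then have "(1 + l) * (1 - l) > 0" by simp
    then show "1 - l\<^sup>2 > 0" by (simp add: algebra_simps power2_eq_square)
  qed
  ultimately have "R l > 0"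
    using R1 R2 z \<gamma> by (simp add: add_nonneg_pos)
  then have "(P l \<noteq> 0 \<or> Q l \<noteq> 0) \<and> Im (P l * cnj (Q l)) \<ge> 0"
    by (auto simp: R_def)
  then have "P l + Q l * w \<noteq> 0"
    using w sum_nonvanishing_iff[of "P l" "Q l"] by blast
  moreover have "P l + Q l * w = a + ((1 - of_real \<theta>) * b + of_real \<theta> * c) * z + ((1 - of_real \<theta>) * c + of_real \<theta> * b) * w + d * z * w"
    by (simp add: P_def Q_def l_def bc algebra_simps)
  ultimately show ?thesis by simp
qed

lemma multiaffine_insert2:
  assumes "finite E" "i \<notin> E" "j \<notin> E" "i \<noteq> j"
  shows "multiaffine (insert i (insert j E)) c z =
    multiaffine E c z + multiaffine E (\<lambda>A. c (insert i A)) z * z i + multiaffine E (\<lambda>A. c (insert j A)) z * z j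
    + multiaffine E (\<lambda>A. c (insert i (insert j A))) z * z i * z j"
proof -
  have "multiaffine (insert i (insert j E)) c z =
      multiaffine (insert j E) c z + z i * multiaffine (insert j E) (\<lambda>A. c (insert i A)) z"
    using assms by (intro multiaffine_insert) auto
  then show ?thesis
    by (simp only: multiaffine_insert[OF assms(1,3)]) (simp add: algebra_simps)
qed

text \<open>With the other variables fixed in the upper half-plane, a bivariate polynomial in
  \<open>z i\<close> and \<open>z j\<close> remains. The transposition exchanges its two linear
  coefficients and fixes the other two, so the bivariate case applies.\<close>

lemma stable_symmetrization:
  assumes "finite E" "i \<in> E" "j \<in> E" "0 \<le> \<theta>" "\<theta> \<le> 1" and st: "stable_on E (multiaffine E c)"
  shows "stable_on E (multiaffine E (\<lambda>A. (1 - of_real \<theta>) * c A + of_real \<theta> * c (Transposition.transpose i j ` A)))"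
proof (cases "i = j")
  case True
  then show ?thesis using st by (simp add: algebra_simps)
next
  case False
  define F where "F = E - {i, j}"
  have F: "finite F" "i \<notin> F" "j \<notin> F" and E: "E = insert i (insert j F)"
    using assms by (auto simp: F_def)
  show ?thesis
    unfolding stable_on_def
  proof (intro allI impI)
    fix z :: "'a \<Rightarrow> complex" assume z: "\<forall>k\<in>E. Im (z k) > 0"
    define a b d e where "a = multiaffine F c z" and "b = multiaffine F (\<lambda>A. c (insert i A)) z"
      and "d = multiaffine F (\<lambda>A. c (insert j A)) z" and "e = multiaffine F (\<lambda>A. c (insert i (insert j A))) z"
    have nz: "a + b * x + d * y + e * x * y \<noteq> 0" if "Im x > 0" "Im y > 0" for x y
    proof -
      define z' where "z' = z(i := x, j := y)"
      have "multiaffine F f z' = multiaffine F f z" for f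
        using F by (intro multiaffine_cong) (auto simp: z'_def)
      then have "multiaffine E c z' = a + b * x + d * y + e * x * y"
        unfolding E multiaffine_insert2[OF F False] a_def b_def d_def e_def using False by (simp add: z'_def)
      moreover have "multiaffine E c z' \<noteq> 0"
        using st z that unfolding stable_on_def by (auto simp: z'_def)
      ultimately show ?thesis by simp
    qed
    have tr: "Transposition.transpose i j ` A = A" "Transposition.transpose i j ` insert i A = insert j A"
      "Transposition.transpose i j ` insert j A = insert i A" "Transposition.transpose i j ` insert i (insert j A) = insert i (insert j A)"
      if "A \<subseteq> F" for A
    proof -
      have "Transposition.transpose i j ` A = id ` A"
        using that F by (intro image_cong HOL.refl) (auto simp: Transposition.transpose_def)
      then show "Transposition.transpose i j ` A = A" by simp
      then show "Transposition.transpose i j ` insert i A = insert j A"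
        "Transposition.transpose i j ` insert j A = insert i A" "Transposition.transpose i j ` insert i (insert j A) = insert i (insert j A)"
        using False by (simp_all add: insert_commute)
    qed
    have "multiaffine E (\<lambda>A. (1 - of_real \<theta>) * c A + of_real \<theta> * c (Transposition.transpose i j ` A)) z =
      ((1 - of_real \<theta>) * a + of_real \<theta> * a) + ((1 - of_real \<theta>) * b + of_real \<theta> * d) * z i
      + ((1 - of_real \<theta>) * d + of_real \<theta> * b) * z j + ((1 - of_real \<theta>) * e + of_real \<theta> * e) * z i * z j"
    proof -
      have "multiaffine F (\<lambda>A. (1 - of_real \<theta>) * c (G A) + of_real \<theta> * c (Transposition.transpose i j ` G A)) z =
        (1 - of_real \<theta>) * multiaffine F (\<lambda>A. c (G A)) z + of_real \<theta> * multiaffine F (\<lambda>A. c (H A)) z"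
        if "\<And>A. A \<subseteq> F \<Longrightarrow> Transposition.transpose i j ` G A = H A" for G H
        unfolding multiaffine_cmult[symmetric] multiaffine_add[symmetric]
        using that by (intro multiaffine_cong) auto
      note * = this[of "\<lambda>A. A" "\<lambda>A. A", OF tr(1)] this[of "insert i" "insert j", OF tr(2)]
        this[of "insert j" "insert i", OF tr(3)]
        this[of "\<lambda>A. insert i (insert j A)" "\<lambda>A. insert i (insert j A)", OF tr(4)]
      show ?thesis
        unfolding E multiaffine_insert2[OF F False] a_def b_def d_def e_def by (simp add: * del: image_insert, simp add: multiaffine_add multiaffine_cmult)
    qed
    also have "\<dots> = a + ((1 - of_real \<theta>) * b + of_real \<theta> * d) * z i
      + ((1 - of_real \<theta>) * d + of_real \<theta> * b) * z j + e * z i * z j"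
      by (simp add: algebra_simps)
    also have "\<dots> \<noteq> 0"
      using z assms by (intro bivariate_symmetrization_nonvanishing[OF nz]) auto
    finally show "multiaffine E (\<lambda>A. (1 - of_real \<theta>) * c A + of_real \<theta> * c (Transposition.transpose i j ` A)) z \<noteq> 0" .
  qed
qed

lemma stable_or_zero_symmetrization:
  assumes "finite E" "i \<in> E" "j \<in> E" "0 \<le> \<theta>" "\<theta> \<le> 1" and st: "stable_or_zero E c"
  shows "stable_or_zero E (\<lambda>A. (1 - of_real \<theta>) * c A + of_real \<theta> * c (Transposition.transpose i j ` A))"
proof (cases "\<forall>A\<subseteq>E. c A = 0")
  case True
  moreover have "Transposition.transpose i j ` A \<subseteq> E" if "A \<subseteq> E" for A
    using that assms(2,3) by (auto simp: Transposition.transpose_def)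
  ultimately show ?thesis by (simp add: stable_or_zero_def)
next
  case False
  then show ?thesis using stable_symmetrization[OF assms(1-5)] st unfolding stable_or_zero_def by blast
qed

text \<open>The Rayleigh inequality for the pair \<open>i, j\<close>: fixing the other variables at \<open>1\<close> leaves a real
  stable polynomial \<open>a + b z + c w + d z w\<close>, for which \<open>bc \<ge> ad\<close>.\<close>

lemma stable_or_zero_pairwise_negative:
  fixes c :: "'a set \<Rightarrow> real"
  assumes "finite E" "i \<notin> E" "j \<notin> E" "i \<noteq> j"
    and st: "stable_or_zero (insert i (insert j E)) (\<lambda>A. of_real (c A))"
  shows "(\<Sum>A\<in>Pow E. c (insert i (insert j A))) * (\<Sum>A\<in>Pow E. c A)
    \<le> (\<Sum>A\<in>Pow E. c (insert i A)) * (\<Sum>A\<in>Pow E. c (insert j A))"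
proof -
  define m where "m = (\<lambda>D. \<Sum>A\<in>Pow E. c (D \<union> A))"
  have m: "multiaffine E (\<lambda>A. of_real (c (D \<union> A))) (\<lambda>k. complex_of_real 1) = of_real (m D)" for D
    by (simp add: multiaffine_def m_def)
  have "stable_or_zero {i,j} (\<lambda>D. multiaffine E (\<lambda>A. of_real (c (D \<union> A))) (\<lambda>k. complex_of_real 1))"
    using assms by (intro stable_or_zero_specialize) auto
  then have *: "stable_or_zero {i,j} (\<lambda>D. of_real (m D))" unfolding m .
  have "m {i,j} * m {} \<le> m {i} * m {j}"
  proof (cases "\<forall>D\<subseteq>{i,j}. m D = 0")
    case False
    then have st': "stable_on {i,j} (multiaffine {i,j} (\<lambda>D. of_real (m D)))"
      using * unfolding stable_or_zero_def by auto
    \<comment> \<open>Setting \<open>z i = \<i>\<close> and \<open>z j = w\<close> gives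
      \<open>P + Q * w\<close>, and \<open>Im (P * cnj Q)\<close> is then the difference
      \<open>m {i} * m {j} - m {} * m {i,j}\<close>.\<close>
    define P Q where "P = of_real (m {}) + \<i> * of_real (m {i})" and "Q = of_real (m {j}) + \<i> * of_real (m {i,j})"
    have "P + Q * w \<noteq> 0" if "Im w > 0" for w
    proof -
      define z where "z = (\<lambda>k. if k = i then \<i> else w)"
      have "multiaffine {i,j} (\<lambda>D. of_real (m D)) z = P + Q * w"
        using multiaffine_insert2[of "{}" i j "\<lambda>D. of_real (m D)" z] assms(4)
        by (simp add: multiaffine_def z_def P_def Q_def algebra_simps)
      moreover have "multiaffine {i,j} (\<lambda>D. of_real (m D)) z \<noteq> 0"
        using st' that unfolding stable_on_def by (auto simp: z_def)
      ultimately show ?thesis by simp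
    qed
    then have "Im (P * cnj Q) \<ge> 0" using sum_nonvanishing_iff[of P Q] by blast
    then show ?thesis by (simp add: P_def Q_def algebra_simps)
  qed simp
  then show ?thesis by (simp add: m_def)
qed

section \<open>Polarization and homogenization\<close>

text \<open>If \<open>\<rho>\<close> lies in the closed lower half-plane and \<open>Im y = h > 0\<close>, then \<open>1 / (y - \<rho>)\<close> lies in the
  disc with centre \<open>- \<i> / (2 h)\<close> and radius \<open>1 / (2 h)\<close>; so the logarithmic derivative at \<open>y\<close> of a
  polynomial without roots in the upper half-plane lies in the corresponding sum of discs.\<close>

lemma log_derivative_disc:
  fixes p :: "complex poly"
  assumes nz: "\<And>y. Im y > 0 \<Longrightarrow> poly p y \<noteq> 0" and y: "Im y > 0" and m: "degree p \<le> m"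
  obtains u where "poly (pderiv p) y = u * poly p y"
    "norm (u + of_nat m * (\<i> / of_real (2 * Im y))) \<le> real m / (2 * Im y)"
proof -
  define h where "h = Im y"
  have h: "h > 0" using y by (simp add: h_def)
  obtain root where root: "smult (lead_coeff p) (\<Prod>i<degree p. [:-root i, 1:]) = p"
    using complex_poly_decompose'[of p] by blast
  have p0: "lead_coeff p \<noteq> 0" using nz[OF y] by auto
  have im: "Im (root i) \<le> 0" if "i < degree p" for i
  proof (rule ccontr)
    assume "\<not> Im (root i) \<le> 0"
    then have "poly p (root i) \<noteq> 0" using nz by simp
    moreover have "poly (\<Prod>i<degree p. [:-root i, 1:]) (root i) = 0"
      using that by (auto simp: poly_prod)
    ultimately show False using root by (metis mult_zero_right poly_smult)
  qed
  have "\<exists>u. poly (pderiv (\<Prod>i<d. [:-root i, 1:])) y = u * poly (\<Prod>i<d. [:-root i, 1:]) y \<and>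
     norm (u + of_nat d * (\<i> / of_real (2 * h))) \<le> real d / (2 * h)" if "d \<le> degree p" for d
    using that
  proof (induction d)
    case 0
    then show ?case by (intro exI[of _ 0]) simp
  next
    case (Suc d)
    then obtain u where u: "poly (pderiv (\<Prod>i<d. [:-root i, 1:])) y = u * poly (\<Prod>i<d. [:-root i, 1:]) y"
      "norm (u + of_nat d * (\<i> / of_real (2 * h))) \<le> real d / (2 * h)" by auto
    define q where "q = y - root d"
    have q: "Im q \<ge> h" using im[of d] Suc.prems by (simp add: q_def h_def)
    then have q0: "q \<noteq> 0" using h by auto
    have "norm (1 / q + \<i> / of_real (2 * h)) \<le> 1 / (2 * h)"
    proof -
      have "1 / q + \<i> / of_real (2 * h) = (of_real (2 * h) + \<i> * q) / (of_real (2 * h) * q)"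
        using q0 h by (simp add: field_simps)
      then have "norm (1 / q + \<i> / of_real (2 * h)) = norm (of_real (2 * h) + \<i> * q) / (2 * h * norm q)"
        using h by (simp add: norm_divide norm_mult)
      moreover have "norm (of_real (2 * h) + \<i> * q) \<le> norm q"
      proof -
        have "h * Im q \<ge> h * h" using q h by simp
        then have "(2 * h - Im q)\<^sup>2 + (Re q)\<^sup>2 \<le> (Re q)\<^sup>2 + (Im q)\<^sup>2"
          by (simp add: power2_eq_square algebra_simps)
        then show ?thesis unfolding cmod_def by simp
      qed
      moreover have "norm q / (2 * h * norm q) = 1 / (2 * h)" using q0 by simp
      ultimately show ?thesis using h by (metis divide_right_mono mult_nonneg_nonneg norm_ge_zero less_imp_le zero_le_numeral)
    qed
    then have A: "norm ((u + of_nat d * (\<i> / of_real (2 * h))) + (1 / q + \<i> / of_real (2 * h))) \<le> real d / (2 * h) + 1 / (2 * h)"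
      using u(2) norm_triangle_mono by blast
    have B: "(u + of_nat d * (\<i> / of_real (2 * h))) + (1 / q + \<i> / of_real (2 * h))
      = (u + 1 / q) + of_nat (Suc d) * (\<i> / of_real (2 * h))"
      by (simp add: algebra_simps add_divide_distrib)
    have C: "real d / (2 * h) + 1 / (2 * h) = real (Suc d) / (2 * h)"
      by (simp add: add_divide_distrib)
    note 1 = A[unfolded B C]
    have "poly (pderiv (P * [:-root d, 1:])) y = poly P y + q * poly (pderiv P) y" for P
      unfolding pderiv_mult by (simp add: pderiv_pCons q_def algebra_simps)
    moreover have "(\<Prod>i<Suc d. [:-root i, 1:]) = (\<Prod>i<d. [:-root i, 1:]) * [:-root d, 1:]"
      by (simp only: prod.lessThan_Suc)
    moreover have "poly (P * [:-root d, 1:]) y = poly P y * q" for P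
      by (simp add: q_def algebra_simps)
    ultimately have "poly (pderiv (\<Prod>i<Suc d. [:-root i, 1:])) y = (u + 1 / q) * poly (\<Prod>i<Suc d. [:-root i, 1:]) y"
      using q0 u(1) by (simp only:) (simp add: algebra_simps)
    then show ?case using 1 by blast
  qed
  from this[OF order.refl] obtain u where
    u: "poly (pderiv (\<Prod>i<degree p. [:-root i, 1:])) y = u * poly (\<Prod>i<degree p. [:-root i, 1:]) y"
    "norm (u + of_nat (degree p) * (\<i> / of_real (2 * h))) \<le> real (degree p) / (2 * h)" by blast
  have "poly (pderiv p) y = u * poly p y"
    by (subst (1 2) root[symmetric]) (simp add: pderiv_smult u(1))
  \<comment> \<open>The value 0 lies on the boundary of each disc, so the
    \<open>m - degree p\<close> missing roots count as roots at infinity.\<close>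
  moreover have "norm (u + of_nat m * (\<i> / of_real (2 * h))) \<le> real m / (2 * h)"
  proof -
    have "u + of_nat m * (\<i> / of_real (2 * h)) =
      (u + of_nat (degree p) * (\<i> / of_real (2 * h))) + of_nat (m - degree p) * (\<i> / of_real (2 * h))"
      using m by (simp add: of_nat_diff algebra_simps diff_divide_distrib)
    moreover have "norm (of_nat (m - degree p) * (\<i> / of_real (2 * h))) = real (m - degree p) / (2 * h)"
      using h by (simp add: norm_mult norm_divide)
    moreover have "real (degree p) / (2 * h) + real (m - degree p) / (2 * h) = real m / (2 * h)"
      using m by (simp add: add_divide_distrib[symmetric] of_nat_diff)
    ultimately show ?thesis using norm_triangle_mono[OF u(2) order.refl] by metis
  qed
  ultimately show ?thesis using that unfolding h_def by blast
qed

text \<open>Laguerre's theorem for the half-plane. If the expression vanished, then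
  \<open>\<zeta> = y - m / u\<close> for the logarithmic derivative \<open>u\<close> at
  \<open>y\<close>; this Moebius map sends the disc that contains \<open>u\<close> to the closed
  lower half-plane.\<close>

lemma polar_derivative_nonvanishing:
  fixes p :: "complex poly"
  assumes nz: "\<And>y. Im y > 0 \<Longrightarrow> poly p y \<noteq> 0" and y: "Im y > 0" and \<zeta>: "Im \<zeta> > 0"
    and m: "degree p \<le> m" "m > 0"
  shows "of_nat m * poly p y + (\<zeta> - y) * poly (pderiv p) y \<noteq> 0"
proof
  assume 0: "of_nat m * poly p y + (\<zeta> - y) * poly (pderiv p) y = 0"
  obtain u where u: "poly (pderiv p) y = u * poly p y"
    "norm (u + of_nat m * (\<i> / of_real (2 * Im y))) \<le> real m / (2 * Im y)"
    using log_derivative_disc[OF nz y m(1)] by blast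
  have "(of_nat m + (\<zeta> - y) * u) * poly p y = 0"
    using 0 u(1) by (simp add: algebra_simps)
  then have eq: "of_nat m + (\<zeta> - y) * u = 0" using nz[OF y] by simp
  then have u0: "u \<noteq> 0" using m(2) by auto
  have \<zeta>_eq: "\<zeta> = y - of_nat m / u"
    using eq u0 by (simp add: field_simps add_eq_0_iff)
  have u2: "(cmod u)\<^sup>2 > 0" using u0 by simp
  define h where "h = Im y"
  have h: "h > 0" using y by (simp add: h_def)
  have "(norm (u + of_nat m * (\<i> / of_real (2 * h))))\<^sup>2 \<le> (real m / (2 * h))\<^sup>2"
    using u(2) unfolding h_def[symmetric] by (rule power_mono) simp
  then have "(Re u)\<^sup>2 + (Im u + real m / (2 * h))\<^sup>2 \<le> (real m / (2 * h))\<^sup>2"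
    unfolding cmod_power2 by (simp add: Im_divide_of_real Re_divide_of_real del: of_real_mult)
  then have *: "(cmod u)\<^sup>2 + real m * Im u / h \<le> 0"
    using h unfolding cmod_power2 by (simp add: power2_sum mult.commute)
  have "Im \<zeta> = h + real m * Im u / (cmod u)\<^sup>2"
    unfolding \<zeta>_eq by (simp add: h_def Im_divide cmod_power2)
  also have "\<dots> = h / (cmod u)\<^sup>2 * ((cmod u)\<^sup>2 + real m * Im u / h)"
    using h u2 by (simp add: field_simps)
  also have "\<dots> \<le> 0"
    using * h u2 by (intro mult_nonneg_nonpos) auto
  finally show False using \<zeta> by simp
qed

text \<open>The sum is the symmetric multi-affine form with coefficients \<open>b\<close> in
  \<open>n + 1\<close> variables, one of them set to \<open>\<zeta>\<close> and the others to
  \<open>y\<close>. Up to the factor \<open>n + 1\<close> it is the polar derivative of the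
  polynomial on the diagonal.\<close>

lemma grace_walsh_szego_step:
  fixes b :: "nat \<Rightarrow> complex"
  assumes nz: "\<And>y. Im y > 0 \<Longrightarrow> (\<Sum>j\<le>Suc n. of_nat (Suc n choose j) * b j * y ^ j) \<noteq> 0"
    and \<zeta>: "Im \<zeta> > 0" and y: "Im y > 0"
  shows "(\<Sum>j\<le>n. of_nat (n choose j) * (b j + \<zeta> * b (Suc j)) * y ^ j) \<noteq> 0"
proof -
  define p where "p = (\<Sum>j\<le>Suc n. monom (of_nat (Suc n choose j) * b j) j)"
  have p: "poly p x = (\<Sum>j\<le>Suc n. of_nat (Suc n choose j) * b j * x ^ j)" for x
    unfolding p_def by (simp add: poly_sum poly_monom del: binomial_Suc_Suc sum.atMost_Suc)
  have deg: "degree p \<le> Suc n"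
    unfolding p_def by (intro degree_sum_le) (auto intro: order.trans[OF degree_monom_le])
  define S0 S1 where "S0 = (\<Sum>j\<le>n. of_nat (n choose j) * b j * y ^ j)"
    and "S1 = (\<Sum>j\<le>n. of_nat (n choose j) * b (Suc j) * y ^ j)"
  have "poly p y = S0 + y * S1"
  proof -
    have "poly p y = b 0 + (\<Sum>j\<le>n. of_nat (Suc n choose Suc j) * b (Suc j) * y ^ Suc j)"
      unfolding p by (subst sum.atMost_Suc_shift) simp
    also have "\<dots> = (b 0 + (\<Sum>j\<le>n. of_nat (n choose Suc j) * b (Suc j) * y ^ Suc j)) + y * S1"
      by (simp add: S1_def sum_distrib_left sum.distrib algebra_simps)
    also have "b 0 + (\<Sum>j\<le>n. of_nat (n choose Suc j) * b (Suc j) * y ^ Suc j) =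
      (\<Sum>j\<le>Suc n. of_nat (n choose j) * b j * y ^ j)"
      by (subst sum.atMost_Suc_shift) simp
    also have "\<dots> = S0" by (simp add: S0_def binomial_eq_0)
    finally show ?thesis .
  qed
  moreover have "poly (pderiv p) y = of_nat (Suc n) * S1"
  proof -
    have "poly (pderiv p) y = (\<Sum>j\<le>Suc n. of_nat j * (of_nat (Suc n choose j) * b j) * y ^ (j - 1))"
      unfolding p_def
      by (subst higher_pderiv_sum[of 1, simplified]) (simp add: poly_sum pderiv_monom poly_monom del: binomial_Suc_Suc sum.atMost_Suc)
    also have "\<dots> = (\<Sum>j\<le>n. of_nat (Suc j * (Suc n choose Suc j)) * b (Suc j) * y ^ j)"
      by (subst sum.atMost_Suc_shift) (simp add: algebra_simps del: binomial_Suc_Suc)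
    also have "\<dots> = (\<Sum>j\<le>n. of_nat (Suc n * (n choose j)) * b (Suc j) * y ^ j)"
      by (simp only: Suc_times_binomial_eq mult.commute[of "Suc _ choose Suc _"])
    also have "\<dots> = of_nat (Suc n) * S1"
      by (simp add: S1_def sum_distrib_left algebra_simps)
    finally show ?thesis .
  qed
  ultimately have "of_nat (Suc n) * poly p y + (\<zeta> - y) * poly (pderiv p) y = of_nat (Suc n) * (S0 + \<zeta> * S1)"
    by (simp add: algebra_simps)
  moreover have "of_nat (Suc n) * poly p y + (\<zeta> - y) * poly (pderiv p) y \<noteq> 0"
    using nz by (intro polar_derivative_nonvanishing deg y \<zeta>) (auto simp: p simp del: binomial_Suc_Suc sum.atMost_Suc)
  moreover have "S0 + \<zeta> * S1 = (\<Sum>j\<le>n. of_nat (n choose j) * (b j + \<zeta> * b (Suc j)) * y ^ j)"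
    by (simp add: S0_def S1_def sum_distrib_left sum.distrib algebra_simps)
  ultimately show ?thesis by auto
qed

text \<open>Grace-Walsh-Szego for the upper half-plane: variables are released from the diagonal one
  at a time. Once \<open>w k\<close> is fixed, the form is again symmetric in the other variables,
  with coefficients \<open>b'\<close>.\<close>

lemma grace_walsh_szego:
  fixes b :: "nat \<Rightarrow> complex"
  assumes "finite Y"
    and "\<And>y. Im y > 0 \<Longrightarrow> (\<Sum>j\<le>card Y. of_nat (card Y choose j) * b j * y ^ j) \<noteq> 0"
    and "\<And>k. k \<in> Y \<Longrightarrow> Im (w k) > 0"
  shows "multiaffine Y (\<lambda>B. b (card B)) w \<noteq> 0"
  using assms
proof (induction Y arbitrary: b rule: finite_induct)
  case empty
  then show ?case using empty(1)[of \<i>] by (simp add: multiaffine_def)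
next
  case (insert k Y)
  define b' where "b' = (\<lambda>j. b j + w k * b (Suc j))"
  have "multiaffine Y (\<lambda>B. b (card (insert k B))) w = multiaffine Y (\<lambda>B. b (Suc (card B))) w"
    using insert.hyps by (intro multiaffine_cong) (auto simp: card_insert_if finite_subset)
  then have "multiaffine (insert k Y) (\<lambda>B. b (card B)) w = multiaffine Y (\<lambda>B. b' (card B)) w"
    using insert.hyps by (simp add: multiaffine_insert b'_def multiaffine_add multiaffine_cmult)
  moreover have "multiaffine Y (\<lambda>B. b' (card B)) w \<noteq> 0"
  proof (rule insert.IH)
    fix y :: complex assume "Im y > 0"
    then show "(\<Sum>j\<le>card Y. of_nat (card Y choose j) * b' j * y ^ j) \<noteq> 0"
      unfolding b'_def using insert.hyps insert.prems
      by (intro grace_walsh_szego_step) (auto simp del: binomial_Suc_Suc sum.atMost_Suc)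
  qed (use insert.prems in auto)
  ultimately show ?case by simp
qed

section \<open>Extreme homogeneous parts and homogenization\<close>

lemma stable_top_part:
  assumes "finite E" "stable_or_zero E c" "\<And>A. A \<subseteq> E \<Longrightarrow> c A \<noteq> 0 \<Longrightarrow> card A \<le> d"
  shows "stable_or_zero E (\<lambda>A. if card A = d then c A else 0)"
proof -
  have "stable_or_zero E (\<lambda>A. c A * of_real ((1 / real (Suc n)) ^ (d - card A)))" for n
  proof -
    \<comment> \<open>Scaling every variable by \<open>n + 1\<close> and dividing by
      \<open>(n + 1)^d\<close> damps all parts of degree below \<open>d\<close>.\<close>
    have "stable_or_zero E (\<lambda>A. of_real ((1 / real (Suc n)) ^ d) * (c A * of_real (\<Prod>i\<in>A. real (Suc n))))"
      by (intro stable_or_zero_cmult stable_or_zero_scale_pos[OF assms(2)]) auto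
    moreover have "of_real ((1 / real (Suc n)) ^ d) * (c A * of_real (\<Prod>i\<in>A. real (Suc n))) =
        c A * of_real ((1 / real (Suc n)) ^ (d - card A))" if "A \<subseteq> E" for A
      using assms(3)[OF that] by (cases "c A = 0") (auto simp: power_diff field_simps simp del: of_nat_Suc)
    ultimately show ?thesis by (rule iffD1[OF stable_or_zero_cong, rotated])
  qed
  then have "stable_or_zero E (\<lambda>A. if d - card A = 0 then c A else 0)"
    by (rule stable_or_zero_power_limit[OF assms(1)])
  moreover have "(if d - card A = 0 then c A else 0) = (if card A = d then c A else 0)" if "A \<subseteq> E" for A
    using assms(3)[OF that] by (cases "c A = 0") auto
  ultimately show ?thesis by (rule iffD1[OF stable_or_zero_cong, rotated])
qed

lemma stable_bottom_part:
  assumes "finite E" "stable_or_zero E c" "\<And>A. A \<subseteq> E \<Longrightarrow> c A \<noteq> 0 \<Longrightarrow> d \<le> card A"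
  shows "stable_or_zero E (\<lambda>A. if card A = d then c A else 0)"
proof -
  have "stable_or_zero E (\<lambda>A. c A * of_real ((1 / real (Suc n)) ^ (card A - d)))" for n
  proof -
    have "stable_or_zero E (\<lambda>A. of_real (real (Suc n) ^ d) * (c A * of_real (\<Prod>i\<in>A. 1 / real (Suc n))))"
      by (intro stable_or_zero_cmult stable_or_zero_scale_pos[OF assms(2)]) auto
    moreover have "of_real (real (Suc n) ^ d) * (c A * of_real (\<Prod>i\<in>A. 1 / real (Suc n))) =
        c A * of_real ((1 / real (Suc n)) ^ (card A - d))" if "A \<subseteq> E" for A
      using assms(3)[OF that] by (cases "c A = 0") (auto simp: power_diff field_simps simp del: of_nat_Suc)
    ultimately show ?thesis by (rule iffD1[OF stable_or_zero_cong, rotated])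
  qed
  then have "stable_or_zero E (\<lambda>A. if card A - d = 0 then c A else 0)"
    by (rule stable_or_zero_power_limit[OF assms(1)])
  moreover have "(if card A - d = 0 then c A else 0) = (if card A = d then c A else 0)" if "A \<subseteq> E" for A
    using assms(3)[OF that] by (cases "c A = 0") auto
  ultimately show ?thesis by (rule iffD1[OF stable_or_zero_cong, rotated])
qed

lemma multiaffine_cnj:
  "multiaffine E (\<lambda>A. of_real (c A)) (\<lambda>i. cnj (z i)) = cnj (multiaffine E (\<lambda>A. of_real (c A)) z)"
  by (simp add: multiaffine_def)

lemma stable_lower_half_plane:
  assumes "stable_on E (multiaffine E (\<lambda>A. of_real (c A)))" "\<And>i. i \<in> E \<Longrightarrow> Im (z i) < 0"
  shows "multiaffine E (\<lambda>A. of_real (c A)) z \<noteq> 0"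
proof -
  have "multiaffine E (\<lambda>A. of_real (c A)) (\<lambda>i. cnj (z i)) \<noteq> 0"
    using assms unfolding stable_on_def by auto
  then show ?thesis unfolding multiaffine_cnj by simp
qed

text \<open>The three cases are the upper half-space, the lower one by conjugation, and positive
  real \<open>t\<close>, where nonnegative weights give a positive sum. This serves the start
  \<open>r = 0\<close> of the deformation below with \<open>t = \<i> / y\<close>, whose real part is
  positive when \<open>Im y > 0\<close>.\<close>

lemma stable_nonneg_ray_nonvanishing:
  fixes c :: "'a set \<Rightarrow> real"
  assumes fin: "finite E" and st: "stable_on E (multiaffine E (\<lambda>A. of_real (c A)))"
    and nonneg: "\<And>A. A \<subseteq> E \<Longrightarrow> c A \<ge> 0" and v: "\<And>i. i \<in> E \<Longrightarrow> v i > 0" and t: "Re t > 0"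
  shows "multiaffine E (\<lambda>A. of_real (c A)) (\<lambda>i. t * of_real (v i)) \<noteq> 0"
proof -
  consider "Im t > 0" | "Im t < 0" | "Im t = 0" by linarith
  then show ?thesis
  proof cases
    case 1
    then show ?thesis using st v unfolding stable_on_def by auto
  next
    case 2
    then show ?thesis using v by (intro stable_lower_half_plane[OF st]) (auto simp: mult_neg_pos)
  next
    case 3
    obtain A where A: "A \<subseteq> E" "c A \<noteq> 0"
      using st multiaffine_zero[of E "\<lambda>A. of_real (c A)" "\<lambda>_. \<i>"] unfolding stable_on_def
      by (metis complex_i_not_zero imaginary_unit.sel(2) of_real_0 zero_less_one)
    have t': "t = of_real (Re t)" using 3 by (simp add: complex_eq_iff)
    have "multiaffine E (\<lambda>A. of_real (c A)) (\<lambda>i. t * of_real (v i)) = of_real (\<Sum>A\<in>Pow E. c A * (\<Prod>i\<in>A. Re t * v i))"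
      unfolding multiaffine_def by (subst t') simp
    moreover have "(\<Sum>A\<in>Pow E. c A * (\<Prod>i\<in>A. Re t * v i)) > 0"
    proof (rule sum_pos2[of _ A])
      show "0 < c A * (\<Prod>i\<in>A. Re t * v i)"
        using A nonneg[of A] v t by (intro mult_pos_pos prod_pos) (auto simp: less_le)
      show "0 \<le> c B * (\<Prod>i\<in>B. Re t * v i)" if "B \<in> Pow E" for B
        using that nonneg v t by (intro mult_nonneg_nonneg prod_nonneg) (auto simp: less_imp_le subset_iff)
    qed (use A fin in auto)
    ultimately show ?thesis by (metis less_irrefl of_real_eq_0_iff)
  qed
qed

text \<open>For \<open>z = x + \<i> v\<close> consider the roots in \<open>y\<close> of \<open>Q r y = \<Sum>\<^sub>A c A (r x + \<i> v)\<^sup>A y\<^bsup>D - |A|\<^esup>\<close>, with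
  \<open>0 \<le> r \<le> 1\<close> and \<open>D\<close> the top degree. There are no real roots, because the rescaled point lies in the
  upper or lower half-space, or, for \<open>y = 0\<close>, because the top part is stable. The leading
  coefficient does not vanish because the bottom part is stable. At \<open>r = 0\<close> there is no root in the upper half-plane,
  and by Hurwitz's theorem none can appear as \<open>r\<close> grows to \<open>1\<close>.\<close>

lemma stable_homogenization_nonvanishing:
  fixes c :: "'a set \<Rightarrow> real" and z :: "'a \<Rightarrow> complex"
  assumes fin: "finite E" and st: "stable_on E (multiaffine E (\<lambda>A. of_real (c A)))"
    and nonneg: "\<And>A. A \<subseteq> E \<Longrightarrow> c A \<ge> 0"
    and z: "\<And>i. i \<in> E \<Longrightarrow> Im (z i) > 0" and y: "Im y > 0"
  shows "(\<Sum>A\<in>Pow E. of_real (c A) * (\<Prod>i\<in>A. z i) * y ^ (card E - card A)) \<noteq> 0"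
proof -
  let ?c = "\<lambda>A. complex_of_real (c A)"
  obtain A0 where A0: "A0 \<subseteq> E" "c A0 \<noteq> 0"
    using st multiaffine_zero[of E ?c "\<lambda>_. \<i>"] unfolding stable_on_def
    by (metis complex_i_not_zero imaginary_unit.sel(2) of_real_0 zero_less_one)
  define N where "N = card ` {A \<in> Pow E. c A \<noteq> 0}"
  have N: "finite N" "N \<noteq> {}" using fin A0 by (auto simp: N_def)
  define D m where "D = Max N" and "m = Min N"
  have Dmax: "card A \<le> D" and mmin: "m \<le> card A" if "A \<subseteq> E" "c A \<noteq> 0" for A
    using that N by (auto simp: D_def m_def N_def)
  obtain AD where AD: "AD \<subseteq> E" "c AD \<noteq> 0" "card AD = D"
    using Max_in[OF N] by (auto simp: D_def N_def)
  obtain Am where Am: "Am \<subseteq> E" "c Am \<noteq> 0" "card Am = m"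
    using Min_in[OF N] by (auto simp: m_def N_def)
  have mD: "m \<le> D" using mmin AD by auto
  have stz: "stable_or_zero E ?c" using st by (simp add: stable_or_zero_def)
  have top: "stable_on E (multiaffine E (\<lambda>A. if card A = D then ?c A else 0))"
    by (rule stable_or_zero_nonzero[OF stable_top_part[OF fin stz, of D] AD(1)]) (use AD Dmax in auto)
  have bot: "stable_on E (multiaffine E (\<lambda>A. if card A = m then ?c A else 0))"
    by (rule stable_or_zero_nonzero[OF stable_bottom_part[OF fin stz, of m] Am(1)]) (use Am mmin in auto)
  define zr :: "real \<Rightarrow> 'a \<Rightarrow> complex" where "zr = (\<lambda>r i. Complex (r * Re (z i)) (Im (z i)))"
  have zr: "Im (zr r i) > 0" if "i \<in> E" for r i using z[OF that] by (simp add: zr_def)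
  have zr_cont: "continuous_on S (\<lambda>x. zr (f x) i)" if "continuous_on S f" for S :: "'t::topological_space set" and f i
    unfolding zr_def Complex_eq using that by (intro continuous_intros)
  define Q where "Q = (\<lambda>r y. \<Sum>A\<in>Pow E. ?c A * (\<Prod>i\<in>A. zr r i) * y ^ (D - card A))"
  have Q_scale: "Q r w = w ^ D * multiaffine E ?c (\<lambda>i. zr r i / w)" if "w \<noteq> 0" for r w
    unfolding Q_def multiaffine_def sum_distrib_left
  proof (intro sum.cong HOL.refl)
    fix A assume "A \<in> Pow E"
    then have "?c A = 0 \<or> card A \<le> D" using Dmax by auto
    then show "?c A * (\<Prod>i\<in>A. zr r i) * w ^ (D - card A) = w ^ D * (?c A * (\<Prod>i\<in>A. zr r i / w))"
      using that by (auto simp: prod_dividef power_diff field_simps)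
  qed
  have Q_real: "Q r w \<noteq> 0" if "Im w = 0" for r w
  proof -
    have w: "w = of_real (Re w)" using that by (simp add: complex_eq_iff)
    consider "Re w > 0" | "Re w < 0" | "w = 0" using w by fastforce
    then show ?thesis
    proof cases
      case 1
      then have "Im (zr r i / w) > 0" if "i \<in> E" for i
        using zr[OF that] by (subst w) (simp only: Im_divide_of_real, simp)
      then have "multiaffine E ?c (\<lambda>i. zr r i / w) \<noteq> 0"
        by (rule stable_onD[OF st])
      moreover have "w \<noteq> 0" using 1 by auto
      ultimately show ?thesis using Q_scale by simp
    next
      case 2
      then have "Im (zr r i / w) < 0" if "i \<in> E" for i
        using zr[OF that] by (subst w) (simp only: Im_divide_of_real, simp add: divide_pos_neg)
      then have "multiaffine E ?c (\<lambda>i. zr r i / w) \<noteq> 0"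
        by (rule stable_lower_half_plane[OF st])
      moreover have "w \<noteq> 0" using 2 by auto
      ultimately show ?thesis using Q_scale by simp
    next
      case 3
      have "Q r w = multiaffine E (\<lambda>A. if card A = D then ?c A else 0) (zr r)"
        unfolding Q_def multiaffine_def 3
      proof (intro sum.cong HOL.refl)
        fix A assume "A \<in> Pow E"
        then have "c A = 0 \<or> card A \<le> D" using Dmax by auto
        then show "?c A * (\<Prod>i\<in>A. zr r i) * 0 ^ (D - card A) = (if card A = D then ?c A else 0) * (\<Prod>i\<in>A. zr r i)"
          by (auto simp: power_0_left)
      qed
      then show ?thesis using top zr unfolding stable_on_def by auto
    qed
  qed
  have Q0: "Q 0 w \<noteq> 0" if "Im w > 0" for w
  proof -
    have w: "w \<noteq> 0" using that by auto
    have "Re (\<i> / w) > 0" using that w by (simp add: Re_divide cmod_power2[symmetric] divide_pos_pos)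
    then have "multiaffine E ?c (\<lambda>i. \<i> / w * of_real (Im (z i))) \<noteq> 0"
      using z by (intro stable_nonneg_ray_nonvanishing[OF fin st nonneg]) auto
    moreover have "\<i> / w * of_real (Im (z i)) = zr 0 i / w" for i
      by (simp add: zr_def Complex_eq)
    ultimately show ?thesis using Q_scale[OF w] w by simp
  qed
  have Q_cont: "continuous_on S (\<lambda>x. Q (f x) (g x))" if "continuous_on S f" "continuous_on S g"
    for S :: "'t::topological_space set" and f g
    unfolding Q_def by (intro continuous_intros zr_cont that)
  \<comment> \<open>The leading coefficient in \<open>y\<close> is the bottom part. It stays away
    from 0 for \<open>r\<close> in the compact interval, so beyond a fixed radius its term dominates
    all others.\<close>
  have bounded_roots: "\<exists>R. \<forall>r\<in>{0..1}. \<forall>w. Q r w = 0 \<longrightarrow> norm w \<le> R"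
  proof -
    define f g where "f = (\<lambda>r. multiaffine E (\<lambda>A. if card A = m then ?c A else 0) (zr r))"
      and "g = (\<lambda>r. \<Sum>A\<in>Pow E. norm (?c A * (\<Prod>i\<in>A. zr r i)))"
    have "continuous_on {0..1::real} (\<lambda>r. norm (f r))"
      unfolding f_def multiaffine_def by (intro continuous_intros zr_cont)
    then obtain r0 where r0: "r0 \<in> {0..1}" "\<And>r. r \<in> {0..1} \<Longrightarrow> norm (f r0) \<le> norm (f r)"
      using continuous_attains_inf[of "{0..1::real}" "\<lambda>r. norm (f r)"] by auto
    define \<delta> where "\<delta> = norm (f r0)"
    have \<delta>: "\<delta> > 0" using bot zr unfolding stable_on_def \<delta>_def f_def by auto
    have "continuous_on {0..1::real} g"
      unfolding g_def by (intro continuous_intros zr_cont)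
    then have "\<exists>r\<in>{0..1}. \<forall>s\<in>{0..1}. g s \<le> g r"
      by (intro continuous_attains_sup) auto
    then obtain r1 where r1: "\<And>r. r \<in> {0..1} \<Longrightarrow> g r \<le> g r1" by blast
    have "norm w \<le> max 1 (g r1 / \<delta>)" if r: "r \<in> {0..1}" and Q: "Q r w = 0" for r w
    proof (rule ccontr)
      assume "\<not> norm w \<le> max 1 (g r1 / \<delta>)"
      then have w: "norm w > 1" "norm w > g r1 / \<delta>" by auto
      define T where "T = {A \<in> Pow E. card A = m}"
      have fT: "(\<Sum>A\<in>T. ?c A * (\<Prod>i\<in>A. zr r i) * w ^ (D - card A)) = f r * w ^ (D - m)"
      proof -
        have "(\<Sum>A\<in>T. ?c A * (\<Prod>i\<in>A. zr r i) * w ^ (D - card A)) =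
            (\<Sum>A\<in>Pow E. if card A = m then ?c A * (\<Prod>i\<in>A. zr r i) * w ^ (D - card A) else 0)"
          unfolding T_def using fin by (intro sum.inter_filter) auto
        also have "\<dots> = f r * w ^ (D - m)"
          unfolding f_def multiaffine_def sum_distrib_right by (intro sum.cong HOL.refl) auto
        finally show ?thesis .
      qed
      have "Q r w = (\<Sum>A\<in>T. ?c A * (\<Prod>i\<in>A. zr r i) * w ^ (D - card A)) +
         (\<Sum>A\<in>Pow E - T. ?c A * (\<Prod>i\<in>A. zr r i) * w ^ (D - card A))"
        unfolding Q_def using fin by (subst sum.subset_diff[of T]) (auto simp: T_def)
      then have "norm (f r * w ^ (D - m)) = norm (\<Sum>A\<in>Pow E - T. ?c A * (\<Prod>i\<in>A. zr r i) * w ^ (D - card A))"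
        using Q fT by (metis add_eq_0_iff norm_minus_cancel)
      also have "\<dots> \<le> (\<Sum>A\<in>Pow E - T. norm (?c A * (\<Prod>i\<in>A. zr r i)) * norm w ^ (D - m - 1))"
      proof (rule sum_norm_le)
        fix A assume A: "A \<in> Pow E - T"
        show "norm (?c A * (\<Prod>i\<in>A. zr r i) * w ^ (D - card A)) \<le> norm (?c A * (\<Prod>i\<in>A. zr r i)) * norm w ^ (D - m - 1)"
        proof (cases "c A = 0")
          case False
          then have "m \<le> card A" "card A \<noteq> m" using A mmin[of A] by (auto simp: T_def)
          then have "norm w ^ (D - card A) \<le> norm w ^ (D - m - 1)"
            using w by (intro power_increasing) auto
          then show ?thesis unfolding norm_mult norm_power by (intro mult_left_mono) auto
        qed simp
      qed
      also have "\<dots> \<le> (\<Sum>A\<in>Pow E. norm (?c A * (\<Prod>i\<in>A. zr r i)) * norm w ^ (D - m - 1))"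
        using fin by (intro sum_mono2) auto
      also have "\<dots> = g r * norm w ^ (D - m - 1)" by (simp add: g_def sum_distrib_right)
      also have "\<dots> \<le> g r1 * norm w ^ (D - m - 1)" using r1[OF r] by (intro mult_right_mono) auto
      finally have 1: "norm (f r) * norm w ^ (D - m) \<le> g r1 * norm w ^ (D - m - 1)" by (simp add: norm_mult norm_power)
      show False
      proof (cases "D = m")
        case True
        then have "c A = 0" if "A \<in> Pow E - T" for A
          using that Dmax[of A] mmin[of A] True by (cases "c A = 0") (auto simp: T_def)
        then have "Q r w = f r * w ^ (D - m)"
          using fT \<open>Q r w = _ + _\<close> by (simp add: sum.neutral)
        then show False using Q r0(2)[OF r] \<delta> True by (auto simp: \<delta>_def)
      next
        case False
        then have "norm w ^ (D - m) = norm w * norm w ^ (D - m - 1)"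
          using mD by (metis Suc_diff_1 diff_is_0_eq' le_antisym not_gr_zero power_Suc zero_less_diff less_le)
        with 1 have "(norm (f r) * norm w) * norm w ^ (D - m - 1) \<le> g r1 * norm w ^ (D - m - 1)"
          by (simp add: mult.assoc)
        moreover have "norm w ^ (D - m - 1) > 0" using w by (intro zero_less_power) auto
        ultimately have "norm (f r) * norm w \<le> g r1" by (rule mult_right_le_imp_le)
        moreover have "\<delta> * norm w \<le> norm (f r) * norm w"
          using r0(2)[OF r] by (intro mult_right_mono) (auto simp: \<delta>_def)
        ultimately show False using w(2) \<delta> by (simp add: field_simps)
      qed
    qed
    then show ?thesis by blast
  qed
  then obtain R where R: "\<And>r w. r \<in> {0..1} \<Longrightarrow> Q r w = 0 \<Longrightarrow> norm w \<le> R" by blast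
  \<comment> \<open>As there are no real roots, the closed condition \<open>Im \<ge> 0\<close> still
    describes exactly the roots in the open half-plane. This makes \<open>K\<close> compact and
    yields a least \<open>r\<close> with such a root.\<close>
  define K where "K = {p \<in> {0..1} \<times> cball 0 R. Im (snd p) \<ge> 0 \<and> Q (fst p) (snd p) = 0}"
  have "compact K"
  proof -
    have "K = ({0..1} \<times> cball 0 R) \<inter> ({p. 0 \<le> Im (snd p)} \<inter> {p. Q (fst p) (snd p) = 0})"
      by (auto simp: K_def)
    moreover have "closed {p :: real \<times> complex. 0 \<le> Im (snd p)}"
      by (intro closed_Collect_le continuous_intros)
    moreover have "closed {p :: real \<times> complex. Q (fst p) (snd p) = 0}"
      by (intro closed_Collect_eq Q_cont continuous_intros)
    ultimately show ?thesis by (auto intro!: compact_Int_closed compact_Times)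
  qed
  then have comp: "compact (fst ` K)" by (intro compact_continuous_image continuous_intros)
  have inK: "(r, w) \<in> K \<longleftrightarrow> r \<in> {0..1} \<and> Im w > 0 \<and> Q r w = 0" for r w
    using R[of r w] Q_real[of w r] by (auto simp: K_def less_le)
  have "K = {}"
  proof (rule ccontr)
    assume "K \<noteq> {}"
    then obtain r where r: "r \<in> fst ` K" and rmin: "\<And>s. s \<in> fst ` K \<Longrightarrow> r \<le> s"
      using compact_attains_inf[OF comp] by auto
    then obtain w where w: "(r, w) \<in> K" by auto
    then have r01: "r \<in> {0..1}" and rw: "Im w > 0" "Q r w = 0" by (auto simp: inK)
    then have "r > 0" using Q0 by (metis atLeastAtMost_iff less_le)
    \<comment> \<open>Approaches the least \<open>r\<close> strictly from below. At these parameters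
      there is no root in the upper half-plane, so Hurwitz's theorem excludes one at
      \<open>r\<close>.\<close>
    define s where "s = (\<lambda>n. r - r / real (Suc (Suc n)))"
    have s: "s n \<in> {0..1}" "s n < r" for n
    proof -
      have "r / real (Suc (Suc n)) > 0" using \<open>r > 0\<close> by simp
      moreover have "r / real (Suc (Suc n)) \<le> r / 1"
        using \<open>r > 0\<close> by (intro divide_left_mono) auto
      ultimately show "s n \<in> {0..1}" "s n < r" using r01 by (auto simp: s_def)
    qed
    have s_lim: "s \<longlonglongrightarrow> r"
    proof -
      have "(\<lambda>n. r - r * (1 / real (Suc (Suc n)))) \<longlonglongrightarrow> r - r * 0"
        by (intro tendsto_intros LIMSEQ_Suc[OF LIMSEQ_Suc[OF lim_1_over_n]])
      then show ?thesis by (simp add: s_def)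
    qed
    define U where "U = {w. Im w > 0}"
    have hol: "Q t holomorphic_on U" for t
      unfolding Q_def by (intro holomorphic_intros)
    have "Q r w \<noteq> 0"
    proof (rule Hurwitz_no_zeros[of U "\<lambda>n. Q (s n)" "Q r"])
      show "open U" "connected U"
        by (auto simp: U_def open_halfspace_Im_gt convex_connected convex_halfspace_Im_gt)
      show "\<not> Q r constant_on U"
      proof
        assume "Q r constant_on U"
        then have *: "Q r v = 0" if "v \<in> U" for v
          using that rw unfolding constant_on_def U_def by (metis mem_Collect_eq)
        have "Q r (\<i> * of_real (\<bar>R\<bar> + 1)) = 0" by (rule *) (auto simp: U_def)
        then show False using R[OF r01] by (fastforce simp: norm_mult)
      qed
      show "uniform_limit C (\<lambda>n. Q (s n)) (Q r) sequentially" if "compact C" "C \<subseteq> U" for C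
        unfolding Q_def
      proof (rule uniform_limit_finite_sum)
        fix A
        show "uniform_limit C (\<lambda>n v. ?c A * (\<Prod>i\<in>A. zr (s n) i) * v ^ (D - card A))
          (\<lambda>v. ?c A * (\<Prod>i\<in>A. zr r i) * v ^ (D - card A)) sequentially"
        proof (rule uniform_lim_mult)
          have "(\<lambda>n. ?c A * (\<Prod>i\<in>A. zr (s n) i)) \<longlonglongrightarrow> ?c A * (\<Prod>i\<in>A. zr r i)"
            unfolding zr_def by (intro tendsto_mult tendsto_const tendsto_prod tendsto_Complex s_lim)
          then show "uniform_limit C (\<lambda>n v. ?c A * (\<Prod>i\<in>A. zr (s n) i)) (\<lambda>v. ?c A * (\<Prod>i\<in>A. zr r i)) sequentially"
            by (auto simp: uniform_limit_iff tendsto_iff)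
          show "uniform_limit C (\<lambda>n v. v ^ (D - card A)) (\<lambda>v. v ^ (D - card A)) sequentially"
            by (auto simp: uniform_limit_iff)
          show "bounded ((\<lambda>v. ?c A * (\<Prod>i\<in>A. zr r i)) ` C)"
            by (rule boundedI[of _ "norm (?c A * (\<Prod>i\<in>A. zr r i))"]) auto
          show "bounded ((\<lambda>v. v ^ (D - card A)) ` C)"
            using that by (intro compact_imp_bounded compact_continuous_image continuous_intros)
        qed
      qed (use fin in auto)
      show "Q (s n) v \<noteq> 0" if "v \<in> U" for n v
      proof
        assume "Q (s n) v = 0"
        then have "(s n, v) \<in> K" using that s[of n] by (simp add: inK U_def)
        then show False using rmin[of "s n"] s[of n] by force
      qed
    qed (use hol rw in \<open>auto simp: U_def\<close>)
    then show False using rw by simp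
  qed
  then have "Q 1 y \<noteq> 0" using inK[of 1 y] y by auto
  \<comment> \<open>On the support, the exponents \<open>card E - card A\<close> and
    \<open>D - card A\<close> differ by the constant \<open>card E - D\<close>.\<close>
  have "(\<Sum>A\<in>Pow E. ?c A * (\<Prod>i\<in>A. z i) * y ^ (card E - card A)) = y ^ (card E - D) * Q 1 y"
    unfolding Q_def sum_distrib_left
  proof (intro sum.cong HOL.refl)
    fix A assume A: "A \<in> Pow E"
    have "card AD \<le> card E" using AD fin by (intro card_mono) auto
    then have "c A = 0 \<or> card E - card A = (card E - D) + (D - card A)"
      using Dmax[of A] AD A by (cases "c A = 0") auto
    then show "?c A * (\<Prod>i\<in>A. z i) * y ^ (card E - card A) = y ^ (card E - D) * (?c A * (\<Prod>i\<in>A. zr 1 i) * y ^ (D - card A))"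
      by (auto simp: power_add zr_def)
  qed
  then show ?thesis using \<open>Q 1 y \<noteq> 0\<close> y by auto
qed

section \<open>Negative association of homogeneous stable weights\<close>

text \<open>The symmetric homogenization lives on two copies of \<open>E\<close>: the first carries the original variables,
  the second the homogenizing ones.\<close>

definition sym_hom :: "'a set \<Rightarrow> ('a set \<Rightarrow> real) \<Rightarrow> ('a + 'a) set \<Rightarrow> real" where
  "sym_hom E c C = (let A = Inl -` C in
     if card A + card (Inr -` C) = card E then c A / real (card E choose card A) else 0)"

lemma Plus_vimage: "Inl -` C <+> Inr -` C = C"
proof (rule set_eqI)
  fix x show "x \<in> Inl -` C <+> Inr -` C \<longleftrightarrow> x \<in> C" by (cases x) auto
qed

lemma sum_Pow_Plus:
  fixes E :: "'a set" and F :: "'b set"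
  shows "(\<Sum>C\<in>Pow (E <+> F). f C) = (\<Sum>A\<in>Pow E. \<Sum>B\<in>Pow F. f (A <+> B))"
proof -
  have "(\<Sum>C\<in>Pow (E <+> F). f C) = (\<Sum>(A,B)\<in>Pow E \<times> Pow F. f (A <+> B))"
    by (rule sum.reindex_bij_witness[of _ "\<lambda>(A,B). A <+> B" "\<lambda>C. (Inl -` C, Inr -` C)"])
      (auto simp: Plus_vimage)
  then show ?thesis by (simp add: sum.cartesian_product)
qed

lemma Inl_vimage_Plus [simp]: "Inl -` (A <+> B) = A" and Inr_vimage_Plus [simp]: "Inr -` (A <+> B) = B"
  by auto

lemma prod_Plus:
  assumes "finite A" "finite B"
  shows "(\<Prod>x\<in>A <+> B. f x) = (\<Prod>i\<in>A. f (Inl i)) * (\<Prod>i\<in>B. f (Inr i))"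
  unfolding Plus_def using assms
  by (subst prod.union_disjoint) (auto simp: prod.reindex)

text \<open>The homogenization in one variable \<open>y\<close> has no zeros in the upper
  half-planes. Polarization replaces \<open>y^j\<close> by the elementary symmetric polynomial of
  degree \<open>j\<close> in the second copy, divided by \<open>n choose j\<close>, and
  \<open>grace_walsh_szego\<close> carries the nonvanishing over.\<close>

lemma stable_sym_hom:
  fixes c :: "'a set \<Rightarrow> real"
  assumes fin: "finite E" and st: "stable_on E (multiaffine E (\<lambda>A. of_real (c A)))"
    and nonneg: "\<And>A. A \<subseteq> E \<Longrightarrow> c A \<ge> 0"
  shows "stable_on (E <+> E) (multiaffine (E <+> E) (\<lambda>C. of_real (sym_hom E c C)))"
  unfolding stable_on_def
proof (intro allI impI)
  fix z :: "'a + 'a \<Rightarrow> complex" assume z: "\<forall>i\<in>E <+> E. 0 < Im (z i)"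
  define n where "n = card E"
  define g where "g = (\<lambda>A. complex_of_real (c A) * (\<Prod>i\<in>A. z (Inl i)))"
  define b where "b = (\<lambda>j. (\<Sum>A\<in>Pow E. if card A + j = n then g A else 0) / of_nat (n choose j))"
  have cardE: "card A \<le> n" if "A \<in> Pow E" for A
    using that fin by (auto simp: n_def intro: card_mono)
  have "multiaffine (E <+> E) (\<lambda>C. of_real (sym_hom E c C)) z =
    (\<Sum>A\<in>Pow E. \<Sum>B\<in>Pow E. of_real (sym_hom E c (A <+> B)) * (\<Prod>i\<in>A <+> B. z i))"
    unfolding multiaffine_def by (rule sum_Pow_Plus)
  also have "\<dots> = (\<Sum>A\<in>Pow E. \<Sum>B\<in>Pow E. (if card A + card B = n then g A else 0) /
      of_nat (n choose card B) * (\<Prod>i\<in>B. z (Inr i)))"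
  proof (intro sum.cong HOL.refl)
    fix A B assume AB: "A \<in> Pow E" "B \<in> Pow E"
    then have f: "finite A" "finite B" using fin by (auto intro: finite_subset)
    have "n choose card A = n choose card B" if "card A + card B = n"
      using that binomial_symmetric[of "card A" n] by auto
    then show "of_real (sym_hom E c (A <+> B)) * (\<Prod>i\<in>A <+> B. z i) =
       (if card A + card B = n then g A else 0) / of_nat (n choose card B) * (\<Prod>i\<in>B. z (Inr i))"
      by (auto simp: sym_hom_def Let_def n_def[symmetric] g_def prod_Plus[OF f])
  qed
  also have "\<dots> = (\<Sum>B\<in>Pow E. \<Sum>A\<in>Pow E. (if card A + card B = n then g A else 0) /
      of_nat (n choose card B) * (\<Prod>i\<in>B. z (Inr i)))"
    by (rule sum.swap)
  also have "\<dots> = multiaffine E (\<lambda>B. b (card B)) (\<lambda>i. z (Inr i))"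
    by (simp add: multiaffine_def b_def sum_distrib_right sum_divide_distrib)
  also have "\<dots> \<noteq> 0"
  proof (rule grace_walsh_szego[OF fin])
    fix y :: complex assume y: "Im y > 0"
    have "(\<Sum>j\<le>n. of_nat (n choose j) * b j * y ^ j) = (\<Sum>j\<le>n. \<Sum>A\<in>Pow E. (if card A + j = n then g A * y ^ j else 0))"
      by (intro sum.cong HOL.refl) (auto simp: b_def sum_distrib_right intro!: sum.cong)
    also have "\<dots> = (\<Sum>A\<in>Pow E. \<Sum>j\<le>n. (if card A + j = n then g A * y ^ j else 0))"
      by (rule sum.swap)
    also have "\<dots> = (\<Sum>A\<in>Pow E. g A * y ^ (n - card A))"
    proof (intro sum.cong HOL.refl)
      fix A assume "A \<in> Pow E"
      then have "(card A + j = n) = (n - card A = j)" for j using cardE[of A] by auto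
      then show "(\<Sum>j\<le>n. (if card A + j = n then g A * y ^ j else 0)) = g A * y ^ (n - card A)"
        by simp
    qed
    also have "\<dots> \<noteq> 0"
      unfolding g_def n_def using z by (intro stable_homogenization_nonvanishing[OF fin st nonneg _ y]) auto
    finally show "(\<Sum>j\<le>card E. of_nat (card E choose j) * b j * y ^ j) \<noteq> 0" by (simp add: n_def)
  qed (use z in auto)
  finally show "multiaffine (E <+> E) (\<lambda>C. of_real (sym_hom E c C)) z \<noteq> 0" .
qed

text \<open>Exactly \<open>card E choose card A\<close> sets \<open>B\<close> have the complementary
  size; this is the divisor in \<open>sym_hom\<close>.\<close>

lemma sym_hom_marginal:
  assumes fin: "finite E" and A: "A \<subseteq> E"
  shows "(\<Sum>B\<in>Pow E. sym_hom E c (A <+> B)) = c A"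
proof -
  have le: "card A \<le> card E" using assms by (intro card_mono)
  have "(\<Sum>B\<in>Pow E. sym_hom E c (A <+> B)) =
    (\<Sum>B\<in>Pow E. if card B = card E - card A then c A / real (card E choose card A) else 0)"
    using le by (intro sum.cong) (auto simp: sym_hom_def)
  also have "\<dots> = (\<Sum>B\<in>{B\<in>Pow E. card B = card E - card A}. c A / real (card E choose card A))"
    using fin by (intro sum.inter_filter[symmetric]) auto
  also have "\<dots> = real (card {B. B \<subseteq> E \<and> card B = card E - card A}) * (c A / real (card E choose card A))"
    by simp
  also have "card {B. B \<subseteq> E \<and> card B = card E - card A} = card E choose card A"
    using n_subsets[OF fin] binomial_symmetric[OF le] by simp
  finally show ?thesis using le by simp
qed

definition homogeneous_stable :: "'a set \<Rightarrow> ('a set \<Rightarrow> real) \<Rightarrow> nat \<Rightarrow> bool" where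
  "homogeneous_stable E c d \<longleftrightarrow> finite E \<and> stable_or_zero E (\<lambda>A. of_real (c A)) \<and>
     (\<forall>A\<subseteq>E. c A \<ge> 0) \<and> (\<forall>A\<subseteq>E. c A \<noteq> 0 \<longrightarrow> card A = d)"

lemma homogeneous_stable_deletion:
  assumes "homogeneous_stable (insert e E) c d" "e \<notin> E"
  shows "homogeneous_stable E c d"
  using assms stable_or_zero_deletion[of E e "\<lambda>A. of_real (c A)"]
  unfolding homogeneous_stable_def by (auto simp: subset_insertI2)

lemma homogeneous_stable_contraction:
  assumes "homogeneous_stable (insert e E) c d" "e \<notin> E"
  shows "homogeneous_stable E (\<lambda>A. c (insert e A)) (d - 1)"
proof -
  have fin: "finite E" using assms by (simp add: homogeneous_stable_def)
  have H: "c A \<ge> 0" "c A \<noteq> 0 \<Longrightarrow> card A = d" if "A \<subseteq> insert e E" for A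
    using assms that unfolding homogeneous_stable_def by auto
  have "card A = d - 1" if "A \<subseteq> E" "c (insert e A) \<noteq> 0" for A
  proof -
    have "card (insert e A) = d"
      using H(2)[of "insert e A"] that by auto
    moreover have "finite A" "e \<notin> A" using that fin assms(2) by (auto intro: finite_subset)
    ultimately show ?thesis by simp
  qed
  moreover have "c (insert e A) \<ge> 0" if "A \<subseteq> E" for A
    using H(1)[of "insert e A"] that by auto
  ultimately show ?thesis
    using assms stable_or_zero_contraction[of E e "\<lambda>A. of_real (c A)"]
    unfolding homogeneous_stable_def by auto
qed

section \<open>The Feder-Mihail induction\<close>

lemma sum_Pow_insert:
  assumes "finite E" "e \<notin> E"
  shows "(\<Sum>A\<in>Pow (insert e E). f A) = (\<Sum>A\<in>Pow E. f (insert e A)) + (\<Sum>A\<in>Pow E. f A)"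
proof -
  have "inj_on (insert e) (Pow E)" using assms(2) by (auto simp: inj_on_def)
  then show ?thesis
    unfolding Pow_insert using assms by (subst sum.union_disjoint) (auto simp: sum.reindex add.commute)
qed

text \<open>The total number of points is constant, so its covariance with any \<open>F\<close> vanishes.\<close>

lemma homogeneous_covariance_sum:
  fixes c F :: "'a set \<Rightarrow> real"
  assumes fin: "finite E" and hom: "\<And>A. A \<subseteq> E \<Longrightarrow> c A \<noteq> 0 \<Longrightarrow> card A = d"
  shows "(\<Sum>i\<in>E. (\<Sum>A\<in>{A\<in>Pow E. i \<in> A}. c A * F A) * (\<Sum>A\<in>Pow E. c A)
     - (\<Sum>A\<in>Pow E. c A * F A) * (\<Sum>A\<in>{A\<in>Pow E. i \<in> A}. c A)) = 0"
proof -
  have *: "(\<Sum>i\<in>E. \<Sum>A\<in>{A\<in>Pow E. i \<in> A}. c A * G A) = real d * (\<Sum>A\<in>Pow E. c A * G A)" for G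
  proof -
    have "(\<Sum>i\<in>E. \<Sum>A\<in>{A\<in>Pow E. i \<in> A}. c A * G A) = (\<Sum>i\<in>E. \<Sum>A\<in>Pow E. if i \<in> A then c A * G A else 0)"
      using fin by (intro sum.cong HOL.refl sum.inter_filter) auto
    also have "\<dots> = (\<Sum>A\<in>Pow E. \<Sum>i\<in>E. if i \<in> A then c A * G A else 0)"
      by (rule sum.swap)
    also have "\<dots> = (\<Sum>A\<in>Pow E. real d * (c A * G A))"
    proof (intro sum.cong HOL.refl)
      fix A assume A: "A \<in> Pow E"
      have "(\<Sum>i\<in>E. if i \<in> A then c A * G A else 0) = (\<Sum>i\<in>{i\<in>E. i \<in> A}. c A * G A)"
        using fin by (intro sum.inter_filter[symmetric])
      also have "{i\<in>E. i \<in> A} = A" using A by auto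
      finally show "(\<Sum>i\<in>E. if i \<in> A then c A * G A else 0) = real d * (c A * G A)"
        using hom[of A] A by (cases "c A = 0") auto
    qed
    finally show ?thesis by (simp add: sum_distrib_left)
  qed
  show ?thesis
    unfolding sum_subtractf sum_distrib_right[symmetric] sum_distrib_left[symmetric] *[of F]
    using *[of "\<lambda>_. 1"] by simp
qed

text \<open>In the application \<open>a, b\<close> weigh presence and absence of a site given
  \<open>e\<close>, \<open>\<alpha>, \<beta>\<close> are the corresponding sums of \<open>F\<close>,
  and primes refer to the absence of \<open>e\<close>. Removing \<open>e\<close> raises both
  conditional means of \<open>F\<close> and shifts weight to the branch whose mean given
  \<open>e\<close> is the larger one.\<close>

lemma feder_mihail_combination:
  fixes a b a' b' \<alpha> \<beta> \<alpha>' \<beta>' :: real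
  assumes pos: "a > 0" "b > 0" and "\<alpha> * a' \<le> a * \<alpha>'" "\<beta> * b' \<le> b * \<beta>'"
    and "a * b' \<le> a' * b" "\<beta> * a \<le> \<alpha> * b"
  shows "(\<alpha> + \<beta>) * (a' + b') \<le> (a + b) * (\<alpha>' + \<beta>')"
proof -
  have 1: "\<alpha> / a * a' \<le> \<alpha>'" "\<beta> / b * b' \<le> \<beta>'"
    using assms by (simp_all add: field_simps)
  have 2: "\<beta> / b \<le> \<alpha> / a" using assms by (simp add: field_simps)
  have "(a + b) * (\<alpha>' + \<beta>') \<ge> (a + b) * (\<alpha> / a * a' + \<beta> / b * b')"
    using 1 pos by (intro mult_left_mono add_mono) auto
  moreover have "(a + b) * (\<alpha> / a * a' + \<beta> / b * b') - (\<alpha> + \<beta>) * (a' + b') = (\<alpha> / a - \<beta> / b) * (a' * b - a * b')"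
    using pos by (simp add: field_simps)
  moreover have "(\<alpha> / a - \<beta> / b) * (a' * b - a * b') \<ge> 0"
    using 2 assms by (intro mult_nonneg_nonneg) auto
  ultimately show ?thesis by linarith
qed

lemma sum_Pow_containing:
  assumes "finite E" "i \<in> E"
  shows "(\<Sum>A\<in>{A\<in>Pow E. i \<in> A}. f A) = (\<Sum>A\<in>Pow (E - {i}). f (insert i A))"
  by (rule sum.reindex_bij_witness[of _ "insert i" "\<lambda>A. A - {i}"]) (use assms in \<open>auto simp: insert_absorb\<close>)

lemma sum_Pow_remove:
  assumes "finite E" "i \<in> E"
  shows "(\<Sum>A\<in>Pow E. f A) = (\<Sum>A\<in>Pow (E - {i}). f (insert i A)) + (\<Sum>A\<in>Pow (E - {i}). f A)"
  using sum_Pow_insert[of "E - {i}" i f] assms by (simp add: insert_absorb)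

text \<open>Since the number of points is constant, some \<open>i\<close> is nonnegatively correlated with \<open>F\<close>
  given \<open>e\<close>, and the induction conditions on the presence of this \<open>i\<close>; if all points
  are deterministic given \<open>e\<close>, the inequality is checked directly.\<close>

lemma feder_mihail_pair:
  fixes c F :: "'a set \<Rightarrow> real"
  assumes "homogeneous_stable (insert e E) c d" "e \<notin> E" "mono_on (Pow E) F"
  shows "(\<Sum>A\<in>Pow E. c (insert e A) * F A) * (\<Sum>A\<in>Pow E. c A)
    \<le> (\<Sum>A\<in>Pow E. c (insert e A)) * (\<Sum>A\<in>Pow E. c A * F A)"
  using assms
proof (induction "card E" arbitrary: E c d F rule: less_induct)
  case less
  define c1 where "c1 = (\<lambda>A. c (insert e A))"
  have fin: "finite E" using less.prems by (simp add: homogeneous_stable_def)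
  have h0: "homogeneous_stable E c d"
    by (rule homogeneous_stable_deletion[OF less.prems(1,2)])
  have h1: "homogeneous_stable E c1 (d - 1)"
    unfolding c1_def by (rule homogeneous_stable_contraction[OF less.prems(1,2)])
  have nn0: "c A \<ge> 0" and nn1: "c1 A \<ge> 0" if "A \<subseteq> E" for A
    using h0 h1 that by (auto simp: homogeneous_stable_def)
  have hom1: "card A = d - 1" if "A \<subseteq> E" "c1 A \<noteq> 0" for A
    using h1 that by (auto simp: homogeneous_stable_def)
  define a b a' b' where
    "a = (\<lambda>i. \<Sum>A\<in>Pow (E - {i}). c1 (insert i A))" and "b = (\<lambda>i. \<Sum>A\<in>Pow (E - {i}). c1 A)" and
    "a' = (\<lambda>i. \<Sum>A\<in>Pow (E - {i}). c (insert i A))" and "b' = (\<lambda>i. \<Sum>A\<in>Pow (E - {i}). c A)"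
  define \<alpha> \<beta> \<alpha>' \<beta>' where
    "\<alpha> = (\<lambda>i. \<Sum>A\<in>Pow (E - {i}). c1 (insert i A) * F (insert i A))" and
    "\<beta> = (\<lambda>i. \<Sum>A\<in>Pow (E - {i}). c1 A * F A)" and
    "\<alpha>' = (\<lambda>i. \<Sum>A\<in>Pow (E - {i}). c (insert i A) * F (insert i A))" and
    "\<beta>' = (\<lambda>i. \<Sum>A\<in>Pow (E - {i}). c A * F A)"
  have split: "(\<Sum>A\<in>Pow E. c1 A * F A) = \<alpha> i + \<beta> i" "(\<Sum>A\<in>Pow E. c1 A) = a i + b i"
    "(\<Sum>A\<in>Pow E. c A * F A) = \<alpha>' i + \<beta>' i" "(\<Sum>A\<in>Pow E. c A) = a' i + b' i" if "i \<in> E" for i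
    unfolding \<alpha>_def \<beta>_def \<alpha>'_def \<beta>'_def a_def b_def a'_def b'_def
    by (rule sum_Pow_remove[OF fin that])+
  have nonneg: "a i \<ge> 0" "b i \<ge> 0" "a' i \<ge> 0" "b' i \<ge> 0" if "i \<in> E" for i
    unfolding a_def b_def a'_def b'_def using that by (auto intro!: sum_nonneg nn0 nn1)
  have a_zero: "c1 A = 0" if "a i = 0" "i \<in> A" "A \<subseteq> E" for i A
  proof -
    have "\<forall>B\<in>Pow (E - {i}). c1 (insert i B) = 0"
      using that fin unfolding a_def by (subst (asm) sum_nonneg_eq_0_iff) (auto intro: nn1)
    moreover have "A - {i} \<in> Pow (E - {i})" using that by auto
    ultimately have "c1 (insert i (A - {i})) = 0" by (rule bspec)
    moreover have "insert i (A - {i}) = A" using that by auto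
    ultimately show ?thesis by simp
  qed
  have b_zero: "c1 A = 0" if "b i = 0" "i \<notin> A" "A \<subseteq> E" for i A
  proof -
    have "\<forall>B\<in>Pow (E - {i}). c1 B = 0"
      using that fin unfolding b_def by (subst (asm) sum_nonneg_eq_0_iff) (auto intro: nn1)
    then show ?thesis using that by auto
  qed
  have b'_zero: "c A = 0" if "b' i = 0" "i \<notin> A" "A \<subseteq> E" for i A
  proof -
    have "\<forall>B\<in>Pow (E - {i}). c B = 0"
      using that fin unfolding b'_def by (subst (asm) sum_nonneg_eq_0_iff) (auto intro: nn0)
    then show ?thesis using that by auto
  qed
  have pair: "a i * b' i \<le> a' i * b i" if i: "i \<in> E" for i
  proof -
    have "e \<noteq> i" "insert e (insert i (E - {i})) = insert e E" using less.prems(2) i by auto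
    then show ?thesis
      using stable_or_zero_pairwise_negative[of "E - {i}" e i c] less.prems fin
      unfolding a_def b_def a'_def b'_def c1_def homogeneous_stable_def
      by (simp add: mult.commute)
  qed
  \<comment> \<open>The unnormalised covariance of \<open>F\<close> with the presence of
    \<open>i\<close>, given \<open>e\<close>.\<close>
  define D where "D = (\<lambda>i. \<alpha> i * (a i + b i) - (\<alpha> i + \<beta> i) * a i)"
  have "(\<Sum>i\<in>E. D i) = 0"
  proof -
    have "(\<Sum>i\<in>E. D i) = (\<Sum>i\<in>E. (\<Sum>A\<in>{A\<in>Pow E. i \<in> A}. c1 A * F A) * (\<Sum>A\<in>Pow E. c1 A)
     - (\<Sum>A\<in>Pow E. c1 A * F A) * (\<Sum>A\<in>{A\<in>Pow E. i \<in> A}. c1 A))"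
    proof (intro sum.cong HOL.refl)
      fix i assume i: "i \<in> E"
      show "D i = (\<Sum>A\<in>{A\<in>Pow E. i \<in> A}. c1 A * F A) * (\<Sum>A\<in>Pow E. c1 A)
     - (\<Sum>A\<in>Pow E. c1 A * F A) * (\<Sum>A\<in>{A\<in>Pow E. i \<in> A}. c1 A)"
        unfolding split[OF i] sum_Pow_containing[OF fin i] D_def \<alpha>_def a_def ..
    qed
    also have "\<dots> = 0" by (rule homogeneous_covariance_sum[OF fin hom1])
    finally show ?thesis .
  qed
  have "(\<Sum>A\<in>Pow E. c1 A * F A) * (\<Sum>A\<in>Pow E. c A) \<le> (\<Sum>A\<in>Pow E. c1 A) * (\<Sum>A\<in>Pow E. c A * F A)"
  proof (cases "\<exists>i\<in>E. a i > 0 \<and> b i > 0 \<and> D i \<ge> 0")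
    case True
    then obtain i where i: "i \<in> E" "a i > 0" "b i > 0" "D i \<ge> 0" by auto
    define E' where "E' = E - {i}"
    have E': "E = insert i E'" "i \<notin> E'" "e \<notin> E'" "e \<noteq> i" and less': "card E' < card E"
      using i less.prems(2) card_Diff1_less[OF fin i(1)] by (auto simp: E'_def)
    have h: "homogeneous_stable (insert i (insert e E')) c d"
      using less.prems(1) E' by (simp add: insert_commute)
    have "\<alpha> i * a' i \<le> a i * \<alpha>' i"
    proof -
      have "homogeneous_stable (insert e E') (\<lambda>A. c (insert i A)) (d - 1)"
        using homogeneous_stable_contraction[OF h] E' by simp
      moreover have "mono_on (Pow E') (\<lambda>A. F (insert i A))"
        using E'(1) by (auto intro!: mono_onI mono_onD[OF less.prems(3)])
      ultimately show ?thesis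
        using less.hyps[OF less', of "\<lambda>A. c (insert i A)" "d - 1" "\<lambda>A. F (insert i A)"] E'
        unfolding \<alpha>_def \<alpha>'_def a_def a'_def E'_def[symmetric] c1_def by (simp add: insert_commute)
    qed
    moreover have "\<beta> i * b' i \<le> b i * \<beta>' i"
    proof -
      have "homogeneous_stable (insert e E') c d"
        using homogeneous_stable_deletion[OF h] E' by simp
      moreover have "mono_on (Pow E') F"
        using E'(1) by (auto intro!: mono_onI mono_onD[OF less.prems(3)])
      ultimately show ?thesis
        using less.hyps[OF less', of c d F] E'
        unfolding \<beta>_def \<beta>'_def b_def b'_def E'_def[symmetric] c1_def by simp
    qed
    moreover have "\<beta> i * a i \<le> \<alpha> i * b i" using i(4) by (simp add: D_def algebra_simps)
    ultimately show ?thesis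
      unfolding split[OF i(1)] using pair[OF i(1)] i by (intro feder_mihail_combination) auto
  next
    case False
    \<comment> \<open>No site is suitable for the induction: sites that are deterministic given
      \<open>e\<close> have \<open>D i = 0\<close>, all others \<open>D i < 0\<close>. As the sum
      vanishes, every site is deterministic given \<open>e\<close>.\<close>
    have "D i \<le> 0" if iE: "i \<in> E" for i
    proof -
      consider "a i = 0" | "b i = 0" | "a i > 0" "b i > 0"
        using nonneg(1,2)[OF iE] by fastforce
      then show ?thesis
      proof cases
        case 1
        then have "\<alpha> i = 0"
          unfolding \<alpha>_def using that by (intro sum.neutral) (auto intro!: a_zero[of i])
        then show ?thesis using 1 by (simp add: D_def)
      next
        case 2
        then have "\<beta> i = 0"
          unfolding \<beta>_def using that by (intro sum.neutral) (auto intro!: b_zero[of i])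
        then show ?thesis using 2 by (simp add: D_def)
      qed (use False that in \<open>auto simp: not_le less_imp_le\<close>)
    qed
    then have "D i = 0" if "i \<in> E" for i
      using \<open>(\<Sum>i\<in>E. D i) = 0\<close> fin that sum_nonneg_eq_0_iff[of E "\<lambda>i. - D i"]
      by (auto simp: sum_negf)
    then have deg: "a i = 0 \<or> b i = 0" if "i \<in> E" for i
      using False that nonneg(1,2)[OF that] by fastforce
    show ?thesis
    proof (cases "\<forall>A\<subseteq>E. c1 A = 0")
      case True
      then show ?thesis by (simp add: sum.neutral)
    next
      case False
      then obtain A1 where A1: "A1 \<subseteq> E" "c1 A1 \<noteq> 0" by auto
      have b0: "b i = 0" if "i \<in> A1" for i
        using deg[of i] a_zero[of i A1] A1 that by auto
      have a0: "a i = 0" if "i \<in> E - A1" for i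
        using deg[of i] b_zero[of i A1] A1 that by auto
      have supp1: "c1 A = 0" if "A \<subseteq> E" "A \<noteq> A1" for A
        using that a0 b0 a_zero[of _ A] b_zero[of _ A] A1 by blast
      \<comment> \<open>Given \<open>e\<close>, each \<open>i\<close> in \<open>A1\<close> is surely
        present; the negative correlation of \<open>i\<close> and \<open>e\<close> forces it to be
        present without \<open>e\<close> as well. So every set in the support contains
        \<open>A1\<close>, and monotonicity of \<open>F\<close> applies.\<close>
      have supp0: "c A = 0" if A: "A \<subseteq> E" "\<not> A1 \<subseteq> A" for A
      proof -
        obtain i where i: "i \<in> A1" "i \<notin> A" using A by auto
        then have iE: "i \<in> E" using A1 by auto
        have "a i \<noteq> 0" using a_zero[of i A1] A1 i by auto
        then have "a i > 0" using nonneg(1)[OF iE] by simp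
        moreover have "a i * b' i \<le> 0" using pair[OF iE] b0[OF i(1)] by simp
        ultimately have "b' i = 0" using nonneg(4)[OF iE] by (simp add: mult_le_0_iff)
        then show ?thesis using b'_zero[OF _ i(2) A(1)] by simp
      qed
      have s1: "(\<Sum>A\<in>Pow E. c1 A * f A) = c1 A1 * f A1" for f
      proof -
        have "(\<Sum>A\<in>Pow E. c1 A * f A) = (\<Sum>A\<in>{A1}. c1 A * f A)"
          using fin A1 supp1 by (intro sum.mono_neutral_right) auto
        then show ?thesis by simp
      qed
      have "(\<Sum>A\<in>Pow E. c A * F A1) \<le> (\<Sum>A\<in>Pow E. c A * F A)"
      proof (rule sum_mono)
        fix A assume A: "A \<in> Pow E"
        show "c A * F A1 \<le> c A * F A"
        proof (cases "A1 \<subseteq> A")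
          case True
          then have "F A1 \<le> F A" using less.prems(3) A A1 by (auto simp: mono_on_def)
          then show ?thesis using nn0[of A] A by (intro mult_left_mono) auto
        qed (use supp0 A in auto)
      qed
      then have "c1 A1 * (F A1 * (\<Sum>A\<in>Pow E. c A)) \<le> c1 A1 * (\<Sum>A\<in>Pow E. c A * F A)"
        using nn1[OF A1(1)] by (intro mult_left_mono) (simp_all add: sum_distrib_left mult.commute)
      then show ?thesis using s1[of F] s1[of "\<lambda>_. 1"] by (simp add: mult.assoc)
    qed
  qed
  then show ?case by (simp add: c1_def)
qed

text \<open>The law of total covariance for two branches of weights \<open>a\<close> and
  \<open>b\<close>, with \<open>\<phi>\<close>, \<open>\<gamma>\<close>, \<open>\<psi>\<close> the
  sums of \<open>F\<close>, \<open>G\<close> and \<open>F * G\<close>: the covariance within each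
  branch and the covariance of the branch means are all nonpositive.\<close>

lemma conditional_covariance_combination:
  fixes a b \<phi> \<phi>' \<gamma> \<gamma>' \<psi> \<psi>' :: real
  assumes pos: "a > 0" "b > 0" and "a * \<psi> \<le> \<phi> * \<gamma>" "b * \<psi>' \<le> \<phi>' * \<gamma>'"
    and "(\<phi> * b - \<phi>' * a) * (\<gamma> * b - \<gamma>' * a) \<le> 0"
  shows "(a + b) * (\<psi> + \<psi>') \<le> (\<phi> + \<phi>') * (\<gamma> + \<gamma>')"
proof -
  have 1: "\<psi> \<le> \<phi> * \<gamma> / a" "\<psi>' \<le> \<phi>' * \<gamma>' / b"
    using assms by (simp_all add: field_simps)
  have "(a + b) * (\<psi> + \<psi>') \<le> (a + b) * (\<phi> * \<gamma> / a + \<phi>' * \<gamma>' / b)"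
    using 1 pos by (intro mult_left_mono add_mono) auto
  moreover have "(a + b) * (\<phi> * \<gamma> / a + \<phi>' * \<gamma>' / b) - (\<phi> + \<phi>') * (\<gamma> + \<gamma>')
    = ((\<phi> * b - \<phi>' * a) * (\<gamma> * b - \<gamma>' * a)) / (a * b)"
    using pos by (simp add: field_simps)
  moreover have "((\<phi> * b - \<phi>' * a) * (\<gamma> * b - \<gamma>' * a)) / (a * b) \<le> 0"
    using assms by (intro divide_nonpos_pos) auto
  ultimately show ?thesis by linarith
qed

lemma depends_onD:
  "depends_on E F I \<Longrightarrow> A \<subseteq> E \<Longrightarrow> B \<subseteq> E \<Longrightarrow> A \<inter> I = B \<inter> I \<Longrightarrow> F A = F B"
  unfolding depends_on_def by blast

lemma depends_on_insert:
  assumes "depends_on E F I" "i \<in> E" "i \<notin> I" "A \<subseteq> E"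
  shows "F (insert i A) = F A"
  by (intro depends_onD[OF assms(1)]) (use assms in auto)

text \<open>Condition on a site \<open>i\<close> nonnegatively correlated with \<open>G\<close>; it
  exists because these covariances sum to 0. If \<open>i \<in> J\<close>, then \<open>F\<close> does
  not depend on \<open>i\<close>, and \<open>feder_mihail_pair\<close> makes its covariance with
  \<open>i\<close> nonpositive; otherwise the same lemma for \<open>G\<close> makes the covariance
  with \<open>G\<close> vanish. Either way the branch means have nonpositive covariance, and the
  induction treats the branches. The sets \<open>I\<close> and \<open>J\<close> stay fixed while
  \<open>E\<close> shrinks.\<close>

lemma homogeneous_stable_NA:
  fixes c F G :: "'a set \<Rightarrow> real"
  assumes "homogeneous_stable E c d" "mono_on (Pow E) F" "mono_on (Pow E) G"
    "depends_on E F I" "depends_on E G J" "I \<inter> J = {}"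
  shows "(\<Sum>A\<in>Pow E. c A) * (\<Sum>A\<in>Pow E. c A * (F A * G A))
    \<le> (\<Sum>A\<in>Pow E. c A * F A) * (\<Sum>A\<in>Pow E. c A * G A)"
  using assms
proof (induction "card E" arbitrary: E c d F G rule: less_induct)
  case less
  have fin: "finite E" using less.prems by (simp add: homogeneous_stable_def)
  have nn: "c A \<ge> 0" if "A \<subseteq> E" for A
    using less.prems that by (auto simp: homogeneous_stable_def)
  have hom: "card A = d" if "A \<subseteq> E" "c A \<noteq> 0" for A
    using less.prems that by (auto simp: homogeneous_stable_def)
  define S1 S0 where "S1 = (\<lambda>i f. \<Sum>A\<in>Pow (E - {i}). c (insert i A) * f (insert i A))"
    and "S0 = (\<lambda>i f. \<Sum>A\<in>Pow (E - {i}). c A * f A)"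
  have split: "(\<Sum>A\<in>Pow E. c A * f A) = S1 i f + S0 i f" if "i \<in> E" for i and f :: "'a set \<Rightarrow> real"
    unfolding S1_def S0_def by (rule sum_Pow_remove[OF fin that])
  have split1: "(\<Sum>A\<in>Pow E. c A) = S1 i (\<lambda>_. 1) + S0 i (\<lambda>_. 1)" if "i \<in> E" for i
    using split[OF that, of "\<lambda>_. 1"] by simp
  have ih1: "S1 i (\<lambda>_. 1) * S1 i (\<lambda>A. F A * G A) \<le> S1 i F * S1 i G"
    and ih0: "S0 i (\<lambda>_. 1) * S0 i (\<lambda>A. F A * G A) \<le> S0 i F * S0 i G" if i: "i \<in> E" for i
  proof -
    define E' where "E' = E - {i}"
    have E': "E = insert i E'" "i \<notin> E'" and less': "card E' < card E"
      using i card_Diff1_less[OF fin i] by (auto simp: E'_def)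
    have mono: "mono_on (Pow E') F" "mono_on (Pow E') G"
      "mono_on (Pow E') (\<lambda>A. F (insert i A))" "mono_on (Pow E') (\<lambda>A. G (insert i A))"
      using E'(1) by (auto intro!: mono_onI mono_onD[OF less.prems(2)] mono_onD[OF less.prems(3)])
    have sub: "A \<in> Pow E" "insert i A \<in> Pow E" if "A \<in> Pow E'" for A using that E' by auto
    have int: "insert i A \<inter> K = insert i B \<inter> K" if "A \<inter> K = B \<inter> K" for A B K using that by auto
    have dep: "depends_on E' H K" "depends_on E' (\<lambda>A. H (insert i A)) K" if "depends_on E H K" for H K
      by (auto simp: depends_on_def E'(1) intro!: depends_onD[OF that] int)
    show "S0 i (\<lambda>_. 1) * S0 i (\<lambda>A. F A * G A) \<le> S0 i F * S0 i G"
      using less.hyps[OF less' homogeneous_stable_deletion[of i E' c d] mono(1,2) dep(1)[OF less.prems(4)]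
        dep(1)[OF less.prems(5)] less.prems(6)] less.prems(1) E'
      unfolding S0_def E'_def[symmetric] by simp
    show "S1 i (\<lambda>_. 1) * S1 i (\<lambda>A. F A * G A) \<le> S1 i F * S1 i G"
      using less.hyps[OF less' homogeneous_stable_contraction[of i E' c d] mono(3,4) dep(2)[OF less.prems(4)]
        dep(2)[OF less.prems(5)] less.prems(6)] less.prems(1) E'
      unfolding S1_def E'_def[symmetric] by simp
  qed
  have S1_nn: "S1 i (\<lambda>_. 1) \<ge> 0" and S0_nn: "S0 i (\<lambda>_. 1) \<ge> 0" if "i \<in> E" for i
    unfolding S1_def S0_def using that by (auto intro!: sum_nonneg nn)
  have S1_zero: "S1 i f = 0" if i: "i \<in> E" and "S1 i (\<lambda>_. 1) = 0" for i f
  proof -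
    have "\<forall>A\<in>Pow (E - {i}). c (insert i A) * 1 = 0"
      using that fin unfolding S1_def by (subst (asm) sum_nonneg_eq_0_iff) (auto intro!: nn)
    then show ?thesis unfolding S1_def by (intro sum.neutral) auto
  qed
  have S0_zero: "S0 i f = 0" if i: "i \<in> E" and "S0 i (\<lambda>_. 1) = 0" for i f
  proof -
    have "\<forall>A\<in>Pow (E - {i}). c A * 1 = 0"
      using that fin unfolding S0_def by (subst (asm) sum_nonneg_eq_0_iff) (auto intro!: nn)
    then show ?thesis unfolding S0_def by (intro sum.neutral) auto
  qed
  show ?case
  \<comment> \<open>A deterministic site leaves only one branch, and there the induction hypothesis
    is already the claim.\<close>
  proof (cases "\<exists>i\<in>E. S1 i (\<lambda>_. 1) = 0 \<or> S0 i (\<lambda>_. 1) = 0")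
    case True
    then obtain i where i: "i \<in> E" "S1 i (\<lambda>_. 1) = 0 \<or> S0 i (\<lambda>_. 1) = 0" by auto
    then show ?thesis
      unfolding split[OF i(1)] split1[OF i(1)] using S1_zero[OF i(1)] S0_zero[OF i(1)] ih1[OF i(1)] ih0[OF i(1)]
      by auto
  next
    case False
    show ?thesis
    proof (cases "E = {}")
      case True
      then show ?thesis by simp
    next
      case E: False
      have "\<exists>i\<in>E. S1 i G * (S1 i (\<lambda>_. 1) + S0 i (\<lambda>_. 1)) - (S1 i G + S0 i G) * S1 i (\<lambda>_. 1) \<ge> 0"
      proof (rule ccontr)
        assume "\<not> ?thesis"
        then have "(\<Sum>i\<in>E. S1 i G * (S1 i (\<lambda>_. 1) + S0 i (\<lambda>_. 1)) - (S1 i G + S0 i G) * S1 i (\<lambda>_. 1)) < (\<Sum>i\<in>E. 0)"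
          using fin E by (intro sum_strict_mono) (auto simp: not_le)
        moreover have "(\<Sum>i\<in>E. S1 i G * (S1 i (\<lambda>_. 1) + S0 i (\<lambda>_. 1)) - (S1 i G + S0 i G) * S1 i (\<lambda>_. 1)) =
          (\<Sum>i\<in>E. (\<Sum>A\<in>{A\<in>Pow E. i \<in> A}. c A * G A) * (\<Sum>A\<in>Pow E. c A)
            - (\<Sum>A\<in>Pow E. c A * G A) * (\<Sum>A\<in>{A\<in>Pow E. i \<in> A}. c A))"
        proof (intro sum.cong HOL.refl)
          fix i assume i: "i \<in> E"
          show "S1 i G * (S1 i (\<lambda>_. 1) + S0 i (\<lambda>_. 1)) - (S1 i G + S0 i G) * S1 i (\<lambda>_. 1) =
            (\<Sum>A\<in>{A\<in>Pow E. i \<in> A}. c A * G A) * (\<Sum>A\<in>Pow E. c A)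
            - (\<Sum>A\<in>Pow E. c A * G A) * (\<Sum>A\<in>{A\<in>Pow E. i \<in> A}. c A)"
            unfolding split[OF i] split1[OF i] sum_Pow_containing[OF fin i] by (simp add: S1_def)
        qed
        ultimately show False using homogeneous_covariance_sum[of E c d G, OF fin hom] by simp
      qed
      then obtain i where i: "i \<in> E" and cov: "S0 i G * S1 i (\<lambda>_. 1) \<le> S1 i G * S0 i (\<lambda>_. 1)"
        by (auto simp: algebra_simps)
      define E' where "E' = E - {i}"
      have E': "E = insert i E'" "i \<notin> E'" using i by (auto simp: E'_def)
      have fm: "S1 i H * S0 i (\<lambda>_. 1) \<le> S1 i (\<lambda>_. 1) * S0 i H"
        if "mono_on (Pow E) H" "depends_on E H K" "i \<notin> K" for H K
      proof -
        have "mono_on (Pow E') H" using E'(1) by (auto intro!: mono_onI mono_onD[OF that(1)])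
        moreover have "H (insert i A) = H A" if "A \<in> Pow E'" for A
          using depends_on_insert[OF \<open>depends_on E H K\<close> i \<open>i \<notin> K\<close>] that E'(1) by auto
        ultimately show ?thesis
          using feder_mihail_pair[of i E' c d H] less.prems(1) E'
          unfolding S1_def S0_def E'_def[symmetric] by simp
      qed
      have "(S1 i F * S0 i (\<lambda>_. 1) - S0 i F * S1 i (\<lambda>_. 1)) * (S1 i G * S0 i (\<lambda>_. 1) - S0 i G * S1 i (\<lambda>_. 1)) \<le> 0"
      proof (cases "i \<in> J")
        case True
        then have "S1 i F * S0 i (\<lambda>_. 1) - S0 i F * S1 i (\<lambda>_. 1) \<le> 0"
          using fm[OF less.prems(2,4)] less.prems(6) by (auto simp: mult.commute)
        then show ?thesis using cov by (intro mult_nonpos_nonneg) auto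
      next
        case False
        then have "S1 i G * S0 i (\<lambda>_. 1) = S0 i G * S1 i (\<lambda>_. 1)"
          using fm[OF less.prems(3,5)] cov by (simp add: mult.commute)
        then show ?thesis by simp
      qed
      moreover have "S1 i (\<lambda>_. 1) > 0" "S0 i (\<lambda>_. 1) > 0"
        using False S1_nn[OF i] S0_nn[OF i] i by (auto simp: less_le)
      ultimately show ?thesis
        unfolding split[OF i] split1[OF i] using ih1[OF i] ih0[OF i]
        by (intro conditional_covariance_combination) auto
    qed
  qed
qed

text \<open>Functions on \<open>2^E\<close> are lifted to the homogenization as functions of the
  first copy, and \<open>sym_hom_marginal\<close> turns the lifted sums back into sums over
  \<open>c\<close>.\<close>

lemma stable_NA:
  fixes c F G :: "'a set \<Rightarrow> real"
  assumes fin: "finite E" and st: "stable_on E (multiaffine E (\<lambda>A. of_real (c A)))"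
    and nonneg: "\<And>A. A \<subseteq> E \<Longrightarrow> c A \<ge> 0"
    and mono: "mono_on (Pow E) F" "mono_on (Pow E) G"
    and dep: "depends_on E F I" "depends_on E G J" "I \<inter> J = {}"
  shows "(\<Sum>A\<in>Pow E. c A) * (\<Sum>A\<in>Pow E. c A * (F A * G A))
    \<le> (\<Sum>A\<in>Pow E. c A * F A) * (\<Sum>A\<in>Pow E. c A * G A)"
proof -
  let ?h = "sym_hom E c"
  have sub: "Inl -` C \<in> Pow E" "finite (Inl -` C)" "finite (Inr -` C)" if "C \<subseteq> E <+> E" for C
  proof -
    show "Inl -` C \<in> Pow E" using that by auto
    have "finite C" using that fin by (meson finite_Plus finite_subset)
    then show "finite (Inl -` C)" "finite (Inr -` C)" by (auto intro: finite_vimageI)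
  qed
  have "homogeneous_stable (E <+> E) ?h (card E)"
    unfolding homogeneous_stable_def
  proof (intro conjI allI impI)
    show "stable_or_zero (E <+> E) (\<lambda>C. of_real (?h C))"
      using stable_sym_hom[OF fin st nonneg] by (simp add: stable_or_zero_def)
    fix C assume C: "C \<subseteq> E <+> E"
    show "0 \<le> ?h C" using sub[OF C] nonneg by (auto simp: sym_hom_def Let_def)
    assume "?h C \<noteq> 0"
    then have "card (Inl -` C) + card (Inr -` C) = card E" by (auto simp: sym_hom_def Let_def split: if_splits)
    then show "card C = card E" using card_Plus[OF sub(2,3)[OF C]] by (simp add: Plus_vimage)
  qed (use fin in auto)
  moreover have "mono_on (Pow (E <+> E)) (\<lambda>C. H (Inl -` C))" if "mono_on (Pow E) H" for H :: "'a set \<Rightarrow> real"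
    using sub(1) by (auto intro!: mono_onI mono_onD[OF that])
  moreover have "depends_on (E <+> E) (\<lambda>C. H (Inl -` C)) (Inl ` K)" if "depends_on E H K" for H K
    unfolding depends_on_def
  proof (intro ballI impI)
    fix A B :: "('a + 'a) set" assume AB: "A \<in> Pow (E <+> E)" "B \<in> Pow (E <+> E)" "A \<inter> Inl ` K = B \<inter> Inl ` K"
    then have "Inl -` A \<inter> K = Inl -` B \<inter> K" by blast
    then show "H (Inl -` A) = H (Inl -` B)" using sub(1) AB by (intro depends_onD[OF that]) auto
  qed
  moreover have "Inl ` I \<inter> Inl ` J = {}" using dep(3) by auto
  ultimately have "(\<Sum>C\<in>Pow (E <+> E). ?h C) * (\<Sum>C\<in>Pow (E <+> E). ?h C * (F (Inl -` C) * G (Inl -` C)))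
    \<le> (\<Sum>C\<in>Pow (E <+> E). ?h C * F (Inl -` C)) * (\<Sum>C\<in>Pow (E <+> E). ?h C * G (Inl -` C))"
    using mono dep by (intro homogeneous_stable_NA[of _ _ _ _ _ "Inl ` I" "Inl ` J"]) auto
  moreover have "(\<Sum>C\<in>Pow (E <+> E). ?h C * H (Inl -` C)) = (\<Sum>A\<in>Pow E. c A * H A)" for H
    unfolding sum_Pow_Plus using sym_hom_marginal[OF fin] by (simp add: sum_distrib_right[symmetric])
  note this[of F] this[of G] this[of "\<lambda>A. F A * G A"] this[of "\<lambda>_. 1"]
  ultimately show ?thesis by simp
qed

section \<open>Strongly Rayleigh measures\<close>

abbreviation mass :: "'s set measure \<Rightarrow> 's set \<Rightarrow> complex" where
  "mass \<mu> \<equiv> \<lambda>A. complex_of_real (measure \<mu> {A})"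

lemma gen_poly_eq_multiaffine: "gen_poly E \<mu> = multiaffine E (mass \<mu>)"
  by (simp add: fun_eq_iff gen_poly_def multiaffine_def)

lemma prob_onD:
  assumes "prob_on E \<mu>"
  shows "finite E" "prob_space \<mu>" "sets \<mu> = Pow (Pow E)" "space \<mu> = Pow E"
  using assms sets_eq_imp_space_eq[of \<mu> "count_space (Pow E)"] by (auto simp: prob_on_def)

lemma prob_on_measure_eq_sum:
  assumes "prob_on E \<mu>" "T \<subseteq> Pow E"
  shows "measure \<mu> T = (\<Sum>A\<in>T. measure \<mu> {A})"
proof -
  interpret prob_space \<mu> by (rule prob_onD(2)[OF assms(1)])
  show ?thesis
    using assms(2) prob_onD[OF assms(1)] by (intro finite_measure_eq_sum_singleton) (auto intro: finite_subset)
qed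

lemma prob_on_sum_mass: "prob_on E \<mu> \<Longrightarrow> (\<Sum>A\<in>Pow E. measure \<mu> {A}) = 1"
  using prob_on_measure_eq_sum[of E \<mu> "Pow E"] prob_space.prob_space[of \<mu>] prob_onD[of E \<mu>] by simp

lemma prob_on_integral:
  fixes F :: "'s set \<Rightarrow> real"
  assumes "prob_on E \<mu>"
  shows "(\<integral>A. F A \<partial>\<mu>) = (\<Sum>A\<in>Pow E. measure \<mu> {A} * F A)"
proof -
  interpret prob_space \<mu> by (rule prob_onD(2)[OF assms])
  note D = prob_onD[OF assms]
  have "(\<integral>A. F A \<partial>\<mu>) = (\<integral>A. (\<Sum>B\<in>Pow E. indicator {B} A * F B) \<partial>\<mu>)"
  proof (rule Bochner_Integration.integral_cong[OF HOL.refl])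
    fix A assume "A \<in> space \<mu>"
    then have "(\<Sum>B\<in>Pow E. indicator {B} A * F B) = (\<Sum>B\<in>Pow E. if B = A then F A else 0)"
      by (intro sum.cong) (auto simp: indicator_def)
    also have "\<dots> = F A" using D \<open>A \<in> space \<mu>\<close> by (simp add: sum.delta)
    finally show "F A = (\<Sum>B\<in>Pow E. indicator {B} A * F B)" by simp
  qed
  also have "\<dots> = (\<Sum>B\<in>Pow E. (\<integral>A. indicator {B} A * F B \<partial>\<mu>))"
    using D by (intro Bochner_Integration.integral_sum) (auto intro!: integrable_mult_left simp: integrable_indicator_iff emeasure_eq_measure)
  also have "\<dots> = (\<Sum>B\<in>Pow E. measure \<mu> {B} * F B)"
    using D by (intro sum.cong) auto
  finally show ?thesis .
qed

lemma strongly_Rayleigh_onI: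
  assumes "prob_on E \<mu>" "stable_or_zero E (mass \<mu>)"
  shows "strongly_Rayleigh_on E \<mu>"
proof -
  have "\<not> (\<forall>A\<subseteq>E. mass \<mu> A = 0)"
  proof
    assume "\<forall>A\<subseteq>E. mass \<mu> A = 0"
    then have "(\<Sum>A\<in>Pow E. measure \<mu> {A}) = 0" by (intro sum.neutral) auto
    then show False using prob_on_sum_mass[OF assms(1)] by simp
  qed
  then show ?thesis
    using assms(2) unfolding strongly_Rayleigh_on_def gen_poly_eq_multiaffine stable_or_zero_def by argo
qed

lemma strongly_Rayleigh_on_stable:
  "strongly_Rayleigh_on E \<mu> \<Longrightarrow> stable_or_zero E (mass \<mu>)"
  unfolding strongly_Rayleigh_on_def gen_poly_eq_multiaffine stable_or_zero_def by (rule disjI1)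

lemma strongly_Rayleigh_on_NA:
  assumes "prob_on E \<mu>" "strongly_Rayleigh_on E \<mu>"
  shows "NA_on E \<mu>"
  unfolding NA_on_def
proof (intro allI impI, elim conjE)
  fix F G :: "'a set \<Rightarrow> real" and I J
  assume *: "mono_on (Pow E) F" "mono_on (Pow E) G" "I \<inter> J = {}" "depends_on E F I" "depends_on E G J"
  have "(\<Sum>A\<in>Pow E. measure \<mu> {A}) * (\<Sum>A\<in>Pow E. measure \<mu> {A} * (F A * G A))
    \<le> (\<Sum>A\<in>Pow E. measure \<mu> {A} * F A) * (\<Sum>A\<in>Pow E. measure \<mu> {A} * G A)"
    using assms(2) by (intro stable_NA[OF prob_onD(1)[OF assms(1)] _ _ *(1,2,4,5,3)])
      (auto simp: strongly_Rayleigh_on_def gen_poly_eq_multiaffine)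
  then show "(\<integral>A. F A * G A \<partial>\<mu>) \<le> (\<integral>A. F A \<partial>\<mu>) * (\<integral>A. G A \<partial>\<mu>)"
    unfolding prob_on_integral[OF assms(1)] prob_on_sum_mass[OF assms(1)] by simp
qed

lemma strongly_Rayleigh_on_CNA:
  assumes "prob_on E \<mu>" "strongly_Rayleigh_on E \<mu>"
  shows "CNA_on E \<mu>"
  unfolding CNA_on_def
proof (intro allI impI, elim conjE)
  fix I B assume IB: "I \<subseteq> E" "B \<subseteq> I" and pos: "0 < measure \<mu> {A \<in> Pow E. A \<inter> I = B}"
  define T where "T = {A \<in> Pow E. A \<inter> I = B}"
  define \<nu> where "\<nu> = uniform_measure \<mu> T"
  interpret prob_space \<mu> by (rule prob_onD(2)[OF assms(1)])
  note D = prob_onD[OF assms(1)]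
  have T: "T \<in> sets \<mu>" "T \<subseteq> Pow E" using D by (auto simp: T_def)
  have "prob_space \<nu>"
    unfolding \<nu>_def using pos by (intro prob_space_uniform_measure) (auto simp: emeasure_eq_measure T_def)
  then have p\<nu>: "prob_on E \<nu>" using assms(1) by (simp add: prob_on_def \<nu>_def)
  have "measure \<nu> {A} = (1 / measure \<mu> T) * (if A \<inter> I = B then measure \<mu> {A} else 0)" if "A \<subseteq> E" for A
  proof -
    have "measure \<nu> {A} = measure \<mu> (T \<inter> {A}) / measure \<mu> T"
      unfolding \<nu>_def using that D pos T by (intro measure_uniform_measure) (auto simp: emeasure_eq_measure T_def)
    moreover have "T \<inter> {A} = (if A \<inter> I = B then {A} else {})" using that by (auto simp: T_def)
    ultimately show ?thesis by simp
  qed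
  then have "stable_or_zero E (mass \<nu>) \<longleftrightarrow>
     stable_or_zero E (\<lambda>A. of_real (1 / measure \<mu> T) * (if A \<inter> I = B then mass \<mu> A else 0))"
    by (intro stable_or_zero_cong) auto
  moreover have "stable_or_zero E (\<lambda>A. of_real (1 / measure \<mu> T) * (if A \<inter> I = B then mass \<mu> A else 0))"
    using IB assms(2) by (intro stable_or_zero_cmult stable_or_zero_condition D strongly_Rayleigh_on_stable)
  ultimately have "strongly_Rayleigh_on E \<nu>" using strongly_Rayleigh_onI[OF p\<nu>] by simp
  then show "NA_on E (uniform_measure \<mu> {A \<in> Pow E. A \<inter> I = B})"
    using strongly_Rayleigh_on_NA[OF p\<nu>] by (simp add: \<nu>_def T_def)
qed

lemma strongly_Rayleigh_on_external_field:
  assumes "prob_on E \<mu>" "strongly_Rayleigh_on E \<mu>" "external_field_on E a \<mu> \<nu>"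
  shows "prob_on E \<nu>" "strongly_Rayleigh_on E \<nu>"
proof -
  show "prob_on E \<nu>" using assms(3) by (simp add: external_field_on_def)
  have a: "\<And>i. i \<in> E \<Longrightarrow> a i \<ge> 0" and nz: "gen_poly E \<mu> (\<lambda>i. of_real (a i)) \<noteq> 0"
    and eq: "\<And>z. gen_poly E \<nu> z = gen_poly E \<mu> (\<lambda>i. of_real (a i) * z i) / gen_poly E \<mu> (\<lambda>i. of_real (a i))"
    using assms(3) by (auto simp: external_field_on_def)
  define c where "c = (\<lambda>A. mass \<mu> A * complex_of_real (\<Prod>i\<in>A. a i))"
  have c: "gen_poly E \<mu> (\<lambda>i. of_real (a i) * z i) = multiaffine E c z" for z
    unfolding gen_poly_eq_multiaffine multiaffine_def c_def by (simp add: prod.distrib algebra_simps)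
  have "stable_or_zero E c"
    unfolding c_def using a by (intro stable_or_zero_scale prob_onD[OF assms(1)] strongly_Rayleigh_on_stable assms(2))
  \<comment> \<open>The denominator of the external field is \<open>multiaffine E c\<close> at 1, so
    the zero alternative is excluded.\<close>
  moreover have "\<not> (\<forall>A\<subseteq>E. c A = 0)"
    using nz c[of "\<lambda>_. 1"] multiaffine_zero[of E c "\<lambda>_. 1"] by auto
  ultimately have "stable_on E (multiaffine E c)" by (auto simp: stable_or_zero_def)
  then show "strongly_Rayleigh_on E \<nu>"
    unfolding strongly_Rayleigh_on_def stable_on_def eq c using nz by simp
qed

lemma strongly_Rayleigh_on_projection:
  assumes "prob_on E \<mu>" "strongly_Rayleigh_on E \<mu>" "D \<subseteq> E"
  shows "prob_on D (subset_projection D \<mu>)" "strongly_Rayleigh_on D (subset_projection D \<mu>)"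
proof -
  interpret prob_space \<mu> by (rule prob_onD(2)[OF assms(1)])
  note P = prob_onD[OF assms(1)]
  have meas: "(\<lambda>A. A \<inter> D) \<in> \<mu> \<rightarrow>\<^sub>M count_space (Pow D)"
    using P by (auto simp: measurable_def)
  have finD: "finite D" "finite (E - D)" using P assms(3) finite_subset by auto
  show pD: "prob_on D (subset_projection D \<mu>)"
    using finD prob_space_distr[OF meas] by (simp add: prob_on_def subset_projection_def)
  have "measure (subset_projection D \<mu>) {A} = (\<Sum>B\<in>Pow (E - D). measure \<mu> {A \<union> B})" if A: "A \<subseteq> D" for A
  proof -
    have "measure (subset_projection D \<mu>) {A} = measure \<mu> ((\<lambda>A. A \<inter> D) -` {A} \<inter> space \<mu>)"
      unfolding subset_projection_def using A by (intro measure_distr[OF meas]) auto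
    also have "\<dots> = (\<Sum>C\<in>(\<lambda>A. A \<inter> D) -` {A} \<inter> space \<mu>. measure \<mu> {C})"
      using P by (intro prob_on_measure_eq_sum[OF assms(1)]) auto
    also have "\<dots> = (\<Sum>B\<in>Pow (E - D). measure \<mu> {A \<union> B})"
      by (rule sum.reindex_bij_witness[of _ "\<lambda>B. A \<union> B" "\<lambda>C. C - D"]) (use A P assms(3) in \<open>auto simp: Int_Diff_Un\<close>)
    finally show ?thesis .
  qed
  \<comment> \<open>Summing over the discarded sites is evaluating their variables at 1.\<close>
  then have "stable_or_zero D (mass (subset_projection D \<mu>)) \<longleftrightarrow>
     stable_or_zero D (\<lambda>A. multiaffine (E - D) (\<lambda>B. mass \<mu> (A \<union> B)) (\<lambda>i. complex_of_real 1))"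
    by (intro stable_or_zero_cong) (simp add: multiaffine_def)
  moreover have "D \<union> (E - D) = E" using assms(3) by auto
  then have "stable_or_zero D (\<lambda>A. multiaffine (E - D) (\<lambda>B. mass \<mu> (A \<union> B)) (\<lambda>i. complex_of_real 1))"
    using strongly_Rayleigh_on_stable[OF assms(2)] finD by (intro stable_or_zero_specialize) auto
  ultimately show "strongly_Rayleigh_on D (subset_projection D \<mu>)"
    using strongly_Rayleigh_onI[OF pD] by simp
qed

theorem strongly_Rayleigh_on_CNA_plus:
  assumes "prob_on E \<mu>" "strongly_Rayleigh_on E \<mu>"
  shows "CNA_plus_on E \<mu>"
proof -
  have "prob_on E' \<nu> \<and> strongly_Rayleigh_on E' \<nu>" if "fields_projections E \<mu> E' \<nu>" for E' \<nu>
    using that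
  proof induction
    case (field E' \<nu> a \<nu>')
    then show ?case using strongly_Rayleigh_on_external_field[of E' \<nu> a \<nu>'] by simp
  next
    case (projection E' \<nu> E'')
    then show ?case using strongly_Rayleigh_on_projection[of E' \<nu> E''] by simp
  qed (simp add: assms)
  then show ?thesis
    unfolding CNA_plus_on_def using strongly_Rayleigh_on_CNA by blast
qed

section \<open>Occupation probabilities\<close>

lemma sets_coordinate: "{\<eta> :: 's::countable \<Rightarrow> bool. \<eta> i} \<in> sets borel"
proof -
  have "open ((\<lambda>\<eta> :: 's \<Rightarrow> bool. \<eta> i) -` {True})"
    using open_vimage[OF discrete_topology_class.open_discrete[of "{True}"], of "\<lambda>\<eta> :: 's \<Rightarrow> bool. \<eta> i"] by simp
  moreover have "(\<lambda>\<eta> :: 's \<Rightarrow> bool. \<eta> i) -` {True} = {\<eta>. \<eta> i}" by auto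
  ultimately show ?thesis by simp
qed

lemma sets_occupied:
  assumes "finite A"
  shows "{\<eta> :: 's::countable \<Rightarrow> bool. \<forall>i\<in>A. \<eta> i} \<in> sets borel"
proof -
  have "{\<eta> :: 's \<Rightarrow> bool. \<forall>i\<in>A. \<eta> i} = space borel \<inter> (\<Inter>i\<in>A. {\<eta>. \<eta> i})" by auto
  also have "\<dots> \<in> sets borel" using assms
    by (induction A rule: finite_induct) (auto intro: sets_coordinate)
  finally show ?thesis .
qed

lemma sets_restriction:
  assumes "finite E"
  shows "{\<eta> :: 's::countable \<Rightarrow> bool. {i\<in>E. \<eta> i} = A} \<in> sets borel"
proof (cases "A \<subseteq> E")
  case True
  then have finA: "finite A" using assms finite_subset by blast
  have "{\<eta> :: 's \<Rightarrow> bool. {i\<in>E. \<eta> i} = A} = {\<eta>. \<forall>i\<in>A. \<eta> i} - (\<Union>i\<in>E - A. {\<eta>. \<eta> i})"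
    using True by auto
  also have "\<dots> \<in> sets borel"
    using assms by (intro sets.Diff sets_occupied finA sets.finite_UN sets_coordinate) auto
  finally show ?thesis .
next
  case False
  then have "{\<eta> :: 's \<Rightarrow> bool. {i\<in>E. \<eta> i} = A} = {}" by auto
  then show ?thesis by (metis sets.empty_sets)
qed

lemma measurable_restriction:
  assumes "finite E" "sets \<mu> = sets (borel :: ('s::countable \<Rightarrow> bool) measure)"
  shows "(\<lambda>\<eta>. {i\<in>E. \<eta> i}) \<in> \<mu> \<rightarrow>\<^sub>M count_space (Pow E)"
proof -
  have "space \<mu> = UNIV" using sets_eq_imp_space_eq[OF assms(2)] by simp
  then have "(\<lambda>\<eta>. {i\<in>E. \<eta> i}) -` {A} \<inter> space \<mu> = {\<eta>. {i\<in>E. \<eta> i} = A}" for A by auto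
  then show ?thesis
    using assms sets_restriction[OF assms(1)] by (subst measurable_count_space_eq2) auto
qed

definition occupation :: "('s \<Rightarrow> bool) measure \<Rightarrow> 's set \<Rightarrow> real" where
  "occupation \<mu> A = measure \<mu> {\<eta>. \<forall>i\<in>A. \<eta> i}"

context
  fixes \<mu> :: "('s::countable \<Rightarrow> bool) measure"
  assumes prob: "prob_space \<mu>" and sets_eq: "sets \<mu> = sets borel"
begin

lemma prob_on_config_marginal: "finite E \<Longrightarrow> prob_on E (config_marginal E \<mu>)"
  using prob_space.prob_space_distr[OF prob measurable_restriction[OF _ sets_eq]]
  by (simp add: prob_on_def config_marginal_def)

lemma occupation_eq_sum:
  assumes "finite E" "A \<subseteq> E"
  shows "occupation \<mu> A = (\<Sum>B\<in>{B\<in>Pow E. A \<subseteq> B}. measure (config_marginal E \<mu>) {B})"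
proof -
  have "space \<mu> = UNIV" using sets_eq_imp_space_eq[OF sets_eq] by simp
  then have "{\<eta>. \<forall>i\<in>A. \<eta> i} = (\<lambda>\<eta>. {i\<in>E. \<eta> i}) -` {B\<in>Pow E. A \<subseteq> B} \<inter> space \<mu>"
    using assms by auto
  moreover have "measure (config_marginal E \<mu>) {B\<in>Pow E. A \<subseteq> B} =
      measure \<mu> ((\<lambda>\<eta>. {i\<in>E. \<eta> i}) -` {B\<in>Pow E. A \<subseteq> B} \<inter> space \<mu>)"
    unfolding config_marginal_def by (rule measure_distr[OF measurable_restriction[OF assms(1) sets_eq]]) auto
  ultimately have "occupation \<mu> A = measure (config_marginal E \<mu>) {B\<in>Pow E. A \<subseteq> B}"
    by (simp only: occupation_def)
  also have "\<dots> = (\<Sum>B\<in>{B\<in>Pow E. A \<subseteq> B}. measure (config_marginal E \<mu>) {B})"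
    by (intro prob_on_measure_eq_sum[OF prob_on_config_marginal[OF assms(1)]]) auto
  finally show ?thesis .
qed

text \<open>Expanding \<open>\<Prod>\<^sub>i (1 + (z\<^sub>i - 1) X\<^sub>i)\<close> shows that the occupation probabilities are the coefficients of the
  generating polynomial in the variables \<open>z\<^sub>i - 1\<close>; a real shift does not affect stability.\<close>

lemma gen_poly_config_marginal:
  assumes "finite E"
  shows "gen_poly E (config_marginal E \<mu>) z = multiaffine E (\<lambda>A. of_real (occupation \<mu> A)) (\<lambda>i. z i - 1)"
proof -
  let ?w = "mass (config_marginal E \<mu>)"
  have "multiaffine E (\<lambda>A. of_real (occupation \<mu> A)) (\<lambda>i. z i - 1) =
    (\<Sum>A\<in>Pow E. \<Sum>B\<in>Pow E. if A \<subseteq> B then ?w B * (\<Prod>i\<in>A. z i - 1) else 0)"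
    unfolding multiaffine_def
  proof (intro sum.cong HOL.refl)
    fix A assume "A \<in> Pow E"
    then have "of_real (occupation \<mu> A) * (\<Prod>i\<in>A. z i - 1) =
      (\<Sum>B\<in>{B\<in>Pow E. A \<subseteq> B}. ?w B * (\<Prod>i\<in>A. z i - 1))"
      using occupation_eq_sum[OF assms, of A] by (simp add: sum_distrib_right)
    also have "\<dots> = (\<Sum>B\<in>Pow E. if A \<subseteq> B then ?w B * (\<Prod>i\<in>A. z i - 1) else 0)"
      using assms by (intro sum.inter_filter) auto
    finally show "of_real (occupation \<mu> A) * (\<Prod>i\<in>A. z i - 1) = \<dots>" .
  qed
  also have "\<dots> = (\<Sum>B\<in>Pow E. \<Sum>A\<in>Pow E. if A \<subseteq> B then ?w B * (\<Prod>i\<in>A. z i - 1) else 0)"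
    by (rule sum.swap)
  also have "\<dots> = (\<Sum>B\<in>Pow E. ?w B * (\<Prod>i\<in>B. z i))"
  proof (intro sum.cong HOL.refl)
    fix B assume B: "B \<in> Pow E"
    have "(\<Sum>A\<in>Pow E. if A \<subseteq> B then ?w B * (\<Prod>i\<in>A. z i - 1) else 0) =
      (\<Sum>A\<in>{A\<in>Pow E. A \<subseteq> B}. ?w B * (\<Prod>i\<in>A. z i - 1))"
      using assms by (intro sum.inter_filter[symmetric]) auto
    also have "{A\<in>Pow E. A \<subseteq> B} = Pow B" using B by auto
    also have "(\<Sum>A\<in>Pow B. ?w B * (\<Prod>i\<in>A. z i - 1)) = ?w B * (\<Prod>i\<in>B. (z i - 1) + 1)"
      using B assms by (subst prod_add) (auto simp: sum_distrib_left intro: finite_subset)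
    finally show "(\<Sum>A\<in>Pow E. if A \<subseteq> B then ?w B * (\<Prod>i\<in>A. z i - 1) else 0) = ?w B * (\<Prod>i\<in>B. z i)"
      by simp
  qed
  finally show ?thesis by (simp add: gen_poly_eq_multiaffine multiaffine_def)
qed

lemma strongly_Rayleigh_on_config_marginal:
  assumes "finite E"
  shows "strongly_Rayleigh_on E (config_marginal E \<mu>) \<longleftrightarrow> stable_or_zero E (\<lambda>A. of_real (occupation \<mu> A))"
proof -
  let ?u = "multiaffine E (\<lambda>A. of_real (occupation \<mu> A))"
  have eq: "strongly_Rayleigh_on E (config_marginal E \<mu>) \<longleftrightarrow> stable_on E ?u"
  proof
    assume L: "strongly_Rayleigh_on E (config_marginal E \<mu>)"
    show "stable_on E ?u"
      unfolding stable_on_def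
    proof (intro allI impI)
      fix z :: "'s \<Rightarrow> complex" assume z: "\<forall>i\<in>E. Im (z i) > 0"
      have "gen_poly E (config_marginal E \<mu>) (\<lambda>i. z i + 1) \<noteq> 0"
        using z by (intro stable_onD[OF L[unfolded strongly_Rayleigh_on_def]]) auto
      then show "?u z \<noteq> 0" unfolding gen_poly_config_marginal[OF assms] by simp
    qed
  next
    assume R: "stable_on E ?u"
    show "strongly_Rayleigh_on E (config_marginal E \<mu>)"
      unfolding strongly_Rayleigh_on_def stable_on_def gen_poly_config_marginal[OF assms]
    proof (intro allI impI)
      fix z :: "'s \<Rightarrow> complex" assume z: "\<forall>i\<in>E. Im (z i) > 0"
      then show "?u (\<lambda>i. z i - 1) \<noteq> 0" by (intro stable_onD[OF R]) auto
    qed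
  qed
  have "space \<mu> = UNIV" using sets_eq_imp_space_eq[OF sets_eq] by simp
  \<comment> \<open>The constant coefficient is 1, which excludes the zero alternative.\<close>
  then have "occupation \<mu> {} = 1"
    using prob_space.prob_space[OF prob] by (simp add: occupation_def)
  then have "\<not> (\<forall>A\<subseteq>E. complex_of_real (occupation \<mu> A) = 0)"
    by (intro notI) (drule spec[of _ "{}"], simp)
  then show ?thesis unfolding eq stable_or_zero_def by argo
qed

end

text \<open>In occupation coordinates a projection only forgets coefficients: \<open>z i = 1\<close>
  means that the shifted variable \<open>z i - 1\<close> is 0.\<close>

lemma stable_or_zero_subset:
  assumes "finite D" "E \<subseteq> D" "stable_or_zero D c"
  shows "stable_or_zero E c"
proof -
  have DE: "E \<union> (D - E) = D" using assms by auto
  have fin: "finite E" "finite (D - E)" using assms finite_subset by auto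
  have "stable_or_zero E (\<lambda>A. multiaffine (D - E) (\<lambda>B. c (A \<union> B)) (\<lambda>i. complex_of_real 0))"
    using assms fin DE by (intro stable_or_zero_specialize) auto
  moreover have "multiaffine (D - E) (\<lambda>B. c (A \<union> B)) (\<lambda>i. complex_of_real 0) = c A" for A
  proof -
    have "multiaffine (D - E) (\<lambda>B. c (A \<union> B)) (\<lambda>i. complex_of_real 0) =
      (\<Sum>B\<in>{{}}. c (A \<union> B) * (\<Prod>i\<in>B. complex_of_real 0))"
      unfolding multiaffine_def
    proof (rule sum.mono_neutral_right)
      show "\<forall>B\<in>Pow (D - E) - {{}}. c (A \<union> B) * (\<Prod>i\<in>B. complex_of_real 0) = 0"
      proof
        fix B assume B: "B \<in> Pow (D - E) - {{}}"
        then have "finite B" "B \<noteq> {}" using fin by (auto intro: finite_subset)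
        then show "c (A \<union> B) * (\<Prod>i\<in>B. complex_of_real 0) = 0" by (auto simp: card_gt_0_iff)
      qed
    qed (use fin in auto)
    then show ?thesis by simp
  qed
  ultimately show ?thesis by simp
qed

section \<open>Dominated convergence for infinite sums\<close>

lemma infsum_eq_integral_count_space:
  fixes f :: "'a \<Rightarrow> real"
  assumes "(\<lambda>x. norm (f x)) summable_on UNIV"
  shows "infsum f UNIV = integral\<^sup>L (count_space UNIV) f" "integrable (count_space UNIV) f"
proof -
  have *: "Infinite_Set_Sum.abs_summable_on f UNIV" using assms abs_summable_equivalent by blast
  show "infsum f UNIV = integral\<^sup>L (count_space UNIV) f"
    using infsetsum_infsum[OF *] by (simp add: infsetsum_def)
  show "integrable (count_space UNIV) f" using * by (simp add: Infinite_Set_Sum.abs_summable_on_def)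
qed

lemma infsum_dominated_convergence:
  fixes f :: "nat \<Rightarrow> 'a \<Rightarrow> real"
  assumes W: "W summable_on UNIV" and bound: "\<And>n x. norm (f n x) \<le> W x"
    and lim: "\<And>x. (\<lambda>n. f n x) \<longlonglongrightarrow> g x"
  shows "(\<lambda>n. infsum (f n) UNIV) \<longlonglongrightarrow> infsum g UNIV"
proof -
  have gW: "norm (g x) \<le> W x" for x
    using tendsto_norm[OF lim[of x]] bound by (intro LIMSEQ_le_const2[of "\<lambda>n. norm (f n x)"]) auto
  have "norm (W x) \<le> W x" for x using norm_ge_zero order.trans bound[of 0 x] by auto
  then have sW: "(\<lambda>x. norm (W x)) summable_on UNIV"
    by (intro Infinite_Sum.abs_summable_on_comparison_test'[OF W])
  have sf: "(\<lambda>x. norm (f n x)) summable_on UNIV" for n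
    using bound by (intro Infinite_Sum.abs_summable_on_comparison_test'[OF W])
  have sg: "(\<lambda>x. norm (g x)) summable_on UNIV"
    using gW by (intro Infinite_Sum.abs_summable_on_comparison_test'[OF W])
  show ?thesis
    unfolding infsum_eq_integral_count_space(1)[OF sf] infsum_eq_integral_count_space(1)[OF sg]
    by (rule integral_dominated_convergence[where w = W])
      (auto intro: infsum_eq_integral_count_space(2)[OF sW] lim bound simp: bound[simplified])
qed

section \<open>The dual equation\<close>

abbreviation swap :: "'a \<Rightarrow> 'a \<Rightarrow> 'a set \<Rightarrow> 'a set" where
  "swap i j A \<equiv> Transposition.transpose i j ` A"

definition small_sets :: "nat \<Rightarrow> 'a set set" where
  "small_sets k = {A. finite A \<and> card A \<le> k}"

lemma swap_small_sets: "A \<in> small_sets k \<Longrightarrow> swap i j A \<in> small_sets k"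
  by (auto simp: small_sets_def card_image)

text \<open>By duality the occupation probabilities of the exclusion process solve a linear equation whose
  generator is \<open>dual_gen\<close>; it is bounded on functions of sets with at most \<open>k\<close> elements.\<close>

definition dual_gen :: "('a \<Rightarrow> 'a \<Rightarrow> real) \<Rightarrow> ('a set \<Rightarrow> real) \<Rightarrow> 'a set \<Rightarrow> real" where
  "dual_gen R u A = 1/2 * (\<Sum>\<^sub>\<infinity>(i,j)\<in>UNIV. R i j * (u (swap i j A) - u A))"

definition euler :: "('a \<Rightarrow> 'a \<Rightarrow> real) \<Rightarrow> real \<Rightarrow> ('a set \<Rightarrow> real) \<Rightarrow> 'a set \<Rightarrow> real" where
  "euler R h u A = u A + h * dual_gen R u A"

definition bounded_by :: "nat \<Rightarrow> real \<Rightarrow> ('a set \<Rightarrow> real) \<Rightarrow> bool" where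
  "bounded_by k M u \<longleftrightarrow> (\<forall>A\<in>small_sets k. \<bar>u A\<bar> \<le> M)"

lemma bounded_byD: "bounded_by k M u \<Longrightarrow> A \<in> small_sets k \<Longrightarrow> \<bar>u A\<bar> \<le> M"
  by (simp add: bounded_by_def)

lemma bounded_by_nonneg: "bounded_by k M u \<Longrightarrow> 0 \<le> M"
  using bounded_byD[of k M u "{}"] by (auto simp: small_sets_def)

lemma bounded_by_mono: "bounded_by k M u \<Longrightarrow> M \<le> N \<Longrightarrow> bounded_by k N u"
  unfolding bounded_by_def by fastforce

locale exclusion_rates =
  fixes Q :: "'s::countable \<Rightarrow> 's \<Rightarrow> real" and C :: real
  assumes Q_nonneg: "Q i j \<ge> 0" and Q_sym: "Q i j = Q j i"
    and Q_summable: "Q i summable_on UNIV" and Q_rowsum: "infsum (Q i) UNIV \<le> C"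
begin

text \<open>A majorant, up to a constant, for the terms of the dual generator, since
  \<open>swap i j A = A\<close> when neither \<open>i\<close> nor \<open>j\<close> lies in
  \<open>A\<close>. Two separate indicators reduce its total to row sums, one directly and one by
  the symmetry of \<open>Q\<close>.\<close>

definition weight :: "'s set \<Rightarrow> 's \<times> 's \<Rightarrow> real" where
  "weight A = (\<lambda>(i,j). Q i j * of_bool (i \<in> A) + Q i j * of_bool (j \<in> A))"

lemma has_sum_rows:
  assumes "finite A"
  shows "((\<lambda>(i,j). Q i j * of_bool (i \<in> A)) has_sum (\<Sum>i\<in>A. infsum (Q i) UNIV)) UNIV"
  using assms
proof (induction A rule: finite_induct)
  case empty
  then show ?case by (simp add: case_prod_unfold)
next
  case (insert a A)
  have "inj_on (Pair a) UNIV" by (simp add: inj_on_def)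
  moreover have "((\<lambda>(i,j). Q i j) \<circ> Pair a has_sum infsum (Q a) UNIV) UNIV"
    using has_sum_infsum[OF Q_summable[of a]] by (simp add: o_def)
  ultimately have "((\<lambda>(i,j). Q i j) has_sum infsum (Q a) UNIV) (range (Pair a))"
    by (subst has_sum_reindex)
  then have "((\<lambda>(i,j). Q i j * of_bool (i = a)) has_sum infsum (Q a) UNIV) UNIV"
    by (rule iffD1[OF has_sum_cong_neutral, rotated -1]) auto
  from has_sum_add[OF this insert.IH] show ?case
    using insert.hyps by (auto simp: case_prod_unfold algebra_simps of_bool_def elim!: has_sum_cong[THEN iffD1, rotated] split: if_splits)
qed

lemma weight_summable: "finite A \<Longrightarrow> weight A summable_on UNIV"
  and weight_infsum_le: "finite A \<Longrightarrow> infsum (weight A) UNIV \<le> 2 * real (card A) * C"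
proof -
  assume fin: "finite A"
  define r where "r = (\<Sum>i\<in>A. infsum (Q i) UNIV)"
  have 1: "((\<lambda>(i,j). Q i j * of_bool (i \<in> A)) has_sum r) UNIV"
    using has_sum_rows[OF fin] by (simp add: r_def)
  have "((\<lambda>(i,j). Q i j * of_bool (i \<in> A)) has_sum r) (prod.swap ` UNIV)"
    using 1 by simp
  then have "(((\<lambda>(i,j). Q i j * of_bool (i \<in> A)) \<circ> prod.swap) has_sum r) UNIV"
    by (subst (asm) has_sum_reindex) auto
  moreover have "(\<lambda>(i,j). Q i j * of_bool (i \<in> A)) \<circ> prod.swap = (\<lambda>(i,j). Q i j * of_bool (j \<in> A))"
    using Q_sym by (auto simp: fun_eq_iff)
  ultimately have 2: "((\<lambda>(i,j). Q i j * of_bool (j \<in> A)) has_sum r) UNIV" by simp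
  have 3: "(weight A has_sum (r + r)) UNIV"
    using has_sum_add[OF 1 2] by (simp add: weight_def case_prod_unfold)
  then show "weight A summable_on UNIV" by (rule has_sum_imp_summable)
  have "r \<le> (\<Sum>i\<in>A. C)" unfolding r_def by (intro sum_mono Q_rowsum)
  then show "infsum (weight A) UNIV \<le> 2 * real (card A) * C"
    using infsumI[OF 3] by simp
qed

lemma weight_nonneg: "weight A p \<ge> 0"
  using Q_nonneg by (auto simp: weight_def split: prod.split)

lemma C_nonneg: "C \<ge> 0"
  using Q_rowsum[of undefined] infsum_nonneg[of UNIV "Q undefined"] Q_nonneg by (meson order_trans)

lemma Q_le_C: "Q i j \<le> C"
proof -
  have "infsum (Q i) {j} \<le> infsum (Q i) UNIV"
    using Q_nonneg by (intro infsum_mono2 Q_summable) auto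
  then show ?thesis using Q_rowsum[of i] by simp
qed

text \<open>Covers \<open>Q\<close> together with its truncations, so that the estimates are uniform
  in the truncation.\<close>

definition subkernel :: "('s \<Rightarrow> 's \<Rightarrow> real) \<Rightarrow> bool" where
  "subkernel R \<longleftrightarrow> (\<forall>i j. 0 \<le> R i j \<and> R i j \<le> Q i j)"

lemma term_bound:
  assumes R: "subkernel R" and u: "bounded_by k M u" and A: "A \<in> small_sets k"
  shows "norm (R i j * (u (swap i j A) - u A)) \<le> 2 * M * weight A (i,j)"
proof (cases "i \<in> A \<or> j \<in> A")
  case True
  have "\<bar>u (swap i j A) - u A\<bar> \<le> 2 * M"
    using bounded_byD[OF u A] bounded_byD[OF u swap_small_sets[OF A, of i j]] by linarith
  moreover have "0 \<le> R i j" "R i j \<le> Q i j" using R by (auto simp: subkernel_def)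
  moreover have "Q i j \<le> weight A (i,j)" using True Q_nonneg[of i j] by (auto simp: weight_def)
  ultimately have "R i j * \<bar>u (swap i j A) - u A\<bar> \<le> weight A (i,j) * (2 * M)"
    by (intro mult_mono) (auto simp: weight_nonneg)
  then show ?thesis using \<open>0 \<le> R i j\<close> by (simp add: abs_mult mult.commute)
next
  case False
  then have "swap i j A = A" by (intro transpose_image_eq) auto
  then show ?thesis using weight_nonneg bounded_by_nonneg[OF u] by simp
qed

lemma term_bound':
  assumes "subkernel R" "bounded_by k M u" "A \<in> small_sets k"
  shows "norm ((\<lambda>(i,j). R i j * (u (swap i j A) - u A)) p) \<le> 2 * M * weight A p"
  using term_bound[OF assms] by (cases p) simp

lemma dual_gen_abs_summable:
  assumes "subkernel R" "bounded_by k M u" "A \<in> small_sets k"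
  shows "(\<lambda>p. norm ((\<lambda>(i,j). R i j * (u (swap i j A) - u A)) p)) summable_on UNIV"
proof (rule Infinite_Sum.abs_summable_on_comparison_test')
  show "(\<lambda>p. 2 * M * weight A p) summable_on UNIV"
    using assms(3) by (intro summable_on_cmult_right weight_summable) (auto simp: small_sets_def)
qed (rule term_bound'[OF assms])

lemma dual_gen_summable:
  assumes "subkernel R" "bounded_by k M u" "A \<in> small_sets k"
  shows "(\<lambda>(i,j). R i j * (u (swap i j A) - u A)) summable_on UNIV"
  by (rule abs_summable_summable[OF dual_gen_abs_summable[OF assms]])

text \<open>The constant combines the factor 1/2 for ordered pairs, the oscillation
  \<open>2 * M\<close> of \<open>u\<close>, and the total weight, at most
  \<open>2 * k * C\<close>.\<close>

lemma dual_gen_bounded: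
  assumes R: "subkernel R" and u: "bounded_by k M u"
  shows "bounded_by k (2 * real k * C * M) (dual_gen R u)"
  unfolding bounded_by_def
proof
  fix A :: "'s set" assume A: "A \<in> small_sets k"
  then have fin: "finite A" "card A \<le> k" by (auto simp: small_sets_def)
  let ?t = "\<lambda>(i,j). R i j * (u (swap i j A) - u A)"
  have M: "M \<ge> 0" by (rule bounded_by_nonneg[OF u])
  have "norm (infsum ?t UNIV) \<le> infsum (\<lambda>p. norm (?t p)) UNIV"
    by (rule norm_infsum_bound[OF dual_gen_abs_summable[OF R u A]])
  also have "\<dots> \<le> infsum (\<lambda>p. 2 * M * weight A p) UNIV"
    by (intro infsum_mono dual_gen_abs_summable[OF R u A] summable_on_cmult_right weight_summable fin term_bound'[OF R u A])
  also have "\<dots> = 2 * M * infsum (weight A) UNIV" by (rule infsum_cmult_right')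
  also have "\<dots> \<le> 2 * M * (2 * real (card A) * C)"
    using M by (intro mult_left_mono weight_infsum_le fin) auto
  also have "\<dots> \<le> 2 * M * (2 * real k * C)"
    using M fin C_nonneg by (intro mult_left_mono mult_right_mono) auto
  finally show "\<bar>dual_gen R u A\<bar> \<le> 2 * real k * C * M"
    by (simp add: dual_gen_def algebra_simps)
qed

lemma dual_gen_diff:
  assumes R: "subkernel R" and u: "bounded_by k M u" and v: "bounded_by k N v" and A: "A \<in> small_sets k"
  shows "dual_gen R (\<lambda>A. u A - v A) A = dual_gen R u A - dual_gen R v A"
proof -
  have "(\<lambda>(i,j). R i j * ((u (swap i j A) - v (swap i j A)) - (u A - v A))) =
    (\<lambda>p. (\<lambda>(i,j). R i j * (u (swap i j A) - u A)) p + - (\<lambda>(i,j). R i j * (v (swap i j A) - v A)) p)"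
    by (auto simp: fun_eq_iff algebra_simps)
  then show ?thesis
    unfolding dual_gen_def
    using infsum_add[OF dual_gen_summable[OF R u A] summable_on_uminus[THEN iffD2, OF dual_gen_summable[OF R v A]]]
    by (simp add: infsum_uminus algebra_simps)
qed

lemma euler_lipschitz:
  assumes R: "subkernel R" and h: "h \<ge> 0" and "bounded_by k M u" "bounded_by k N v"
    and d: "bounded_by k e (\<lambda>A. u A - v A)"
  shows "bounded_by k ((1 + 2 * real k * C * h) * e) (\<lambda>A. euler R h u A - euler R h v A)"
  unfolding bounded_by_def
proof
  fix A :: "'s set" assume A: "A \<in> small_sets k"
  have "euler R h u A - euler R h v A = (u A - v A) + h * dual_gen R (\<lambda>A. u A - v A) A"
    unfolding dual_gen_diff[OF assms(1,3,4) A] by (simp add: euler_def algebra_simps)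
  moreover have "\<bar>h * dual_gen R (\<lambda>A. u A - v A) A\<bar> \<le> h * (2 * real k * C * e)"
    using bounded_byD[OF dual_gen_bounded[OF R d] A] h by (simp add: abs_mult mult_left_mono)
  ultimately show "\<bar>euler R h u A - euler R h v A\<bar> \<le> (1 + 2 * real k * C * h) * e"
    using bounded_byD[OF d A] by (simp add: algebra_simps)
qed

lemma euler_bounded:
  assumes R: "subkernel R" and h: "h \<ge> 0" and u: "bounded_by k M u"
  shows "bounded_by k ((1 + 2 * real k * C * h) * M) (euler R h u)"
  unfolding bounded_by_def
proof
  fix A :: "'s set" assume A: "A \<in> small_sets k"
  have "\<bar>h * dual_gen R u A\<bar> \<le> h * (2 * real k * C * M)"
    using bounded_byD[OF dual_gen_bounded[OF R u] A] h by (simp add: abs_mult mult_left_mono)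
  then show "\<bar>euler R h u A\<bar> \<le> (1 + 2 * real k * C * h) * M"
    using bounded_byD[OF u A] unfolding euler_def by (simp add: algebra_simps)
qed

lemma euler_iterate_bounded:
  assumes R: "subkernel R" and h: "h \<ge> 0" and u: "bounded_by k M u"
  shows "bounded_by k ((1 + 2 * real k * C * h) ^ m * M) ((euler R h ^^ m) u)"
proof (induction m)
  case (Suc m)
  then show ?case using euler_bounded[OF R h Suc.IH] by (simp add: mult.assoc)
qed (simp add: u)

text \<open>A discrete Gronwall estimate: each of the \<open>m\<close> steps adds a local error
  \<open>\<delta>\<close>, amplified by at most \<open>(1 + 2 * k * C * h)^m\<close>. It is used
  both for the exact flow and for the sweeps.\<close>

lemma euler_approximation:
  assumes R: "subkernel R" and h: "h \<ge> 0" and \<delta>: "\<delta> \<ge> 0" and v: "\<And>j. j \<le> m \<Longrightarrow> bounded_by k M (v j)"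
    and step: "\<And>j. j < m \<Longrightarrow> bounded_by k \<delta> (\<lambda>A. v (Suc j) A - euler R h (v j) A)"
  shows "bounded_by k (real m * \<delta> * (1 + 2 * real k * C * h) ^ m) (\<lambda>A. v m A - (euler R h ^^ m) (v 0) A)"
  using v step
proof (induction m)
  case 0
  then show ?case by (simp add: bounded_by_def)
next
  case (Suc m)
  define b where "b = 1 + 2 * real k * C * h"
  have b: "b \<ge> 1" using h C_nonneg by (simp add: b_def)
  let ?w = "(euler R h ^^ m) (v 0)"
  have vm: "bounded_by k M (v m)" and v0: "bounded_by k M (v 0)" using Suc.prems(1) by auto
  have ih: "bounded_by k (real m * \<delta> * b ^ m) (\<lambda>A. v m A - ?w A)"
    unfolding b_def using Suc.IH Suc.prems by auto
  have "bounded_by k (b * (real m * \<delta> * b ^ m)) (\<lambda>A. euler R h (v m) A - euler R h ?w A)"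
    unfolding b_def
    by (rule euler_lipschitz[OF R h vm euler_iterate_bounded[OF R h v0, of m] ih[unfolded b_def]])
  then have 1: "\<bar>euler R h (v m) A - euler R h ?w A\<bar> \<le> b * (real m * \<delta> * b ^ m)" if "A \<in> small_sets k" for A
    using bounded_byD that by blast
  have 2: "\<bar>v (Suc m) A - euler R h (v m) A\<bar> \<le> \<delta>" if "A \<in> small_sets k" for A
    using bounded_byD[OF Suc.prems(2)[of m]] that by auto
  have "\<delta> \<le> \<delta> * b ^ Suc m" using mult_left_mono[OF one_le_power[OF b, of "Suc m"] \<delta>] by simp
  then have 3: "\<delta> + b * (real m * \<delta> * b ^ m) \<le> real (Suc m) * \<delta> * b ^ Suc m" by (simp add: algebra_simps)
  show ?case
    unfolding bounded_by_def b_def[symmetric]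
  proof
    fix A :: "'s set" assume A: "A \<in> small_sets k"
    show "\<bar>v (Suc m) A - (euler R h ^^ Suc m) (v 0) A\<bar> \<le> real (Suc m) * \<delta> * b ^ Suc m"
      using 1[OF A] 2[OF A] 3 by simp
  qed
qed

section \<open>Exhaustion by finite windows\<close>

definition window :: "nat \<Rightarrow> 's set" where "window n = {i. to_nat i < n}"

definition trunc :: "nat \<Rightarrow> 's \<Rightarrow> 's \<Rightarrow> real" where
  "trunc n i j = (if i \<in> window n \<and> j \<in> window n then Q i j else 0)"

lemma finite_window: "finite (window n)"
  unfolding window_def by (rule finite_imageD[of to_nat]) (auto intro: finite_subset[of _ "{..<n}"] inj_on_subset[OF inj_to_nat])

lemma finite_subset_window: "finite E \<Longrightarrow> \<exists>N. \<forall>n\<ge>N. E \<subseteq> window n"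
proof (induction E rule: finite_induct)
  case (insert x E)
  then obtain N where "\<forall>n\<ge>N. E \<subseteq> window n" by auto
  then show ?case by (intro exI[of _ "max N (Suc (to_nat x))"]) (auto simp: window_def)
qed simp

lemma subkernel_Q: "subkernel Q" and subkernel_trunc: "subkernel (trunc n)"
  using Q_nonneg by (auto simp: subkernel_def trunc_def)

lemma trunc_tendsto: "(\<lambda>n. trunc n i j) \<longlonglongrightarrow> Q i j"
proof -
  obtain N where "\<forall>n\<ge>N. {i,j} \<subseteq> window n" using finite_subset_window[of "{i,j}"] by auto
  then have "\<forall>n\<ge>N. trunc n i j = Q i j" by (auto simp: trunc_def)
  then show ?thesis by (intro tendsto_eventually) (auto simp: eventually_sequentially)
qed

text \<open>Dominated convergence; the majorant \<open>2 * M * weight A\<close> does not depend on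
  \<open>n\<close>.\<close>

lemma dual_gen_tendsto:
  assumes v: "\<And>n. bounded_by k M (v n)" and lim: "\<And>A. A \<in> small_sets k \<Longrightarrow> (\<lambda>n. v n A) \<longlonglongrightarrow> w A"
    and A: "A \<in> small_sets k"
  shows "(\<lambda>n. dual_gen (trunc n) (v n) A) \<longlonglongrightarrow> dual_gen Q w A"
  unfolding dual_gen_def
proof (intro tendsto_mult tendsto_const infsum_dominated_convergence)
  show "(\<lambda>p. 2 * M * weight A p) summable_on UNIV"
    using A by (intro summable_on_cmult_right weight_summable) (auto simp: small_sets_def)
  show "norm (case p of (i,j) \<Rightarrow> trunc n i j * (v n (swap i j A) - v n A)) \<le> 2 * M * weight A p" for n p
    using term_bound'[OF subkernel_trunc v A] by simp
  show "(\<lambda>n. case p of (i,j) \<Rightarrow> trunc n i j * (v n (swap i j A) - v n A)) \<longlonglongrightarrow>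
      (case p of (i,j) \<Rightarrow> Q i j * (w (swap i j A) - w A))" for p
    by (cases p) (auto intro!: tendsto_mult tendsto_diff trunc_tendsto lim A swap_small_sets)
qed

lemma euler_iterate_tendsto:
  assumes h: "h \<ge> 0" and u: "bounded_by k M u" and A: "A \<in> small_sets k"
  shows "(\<lambda>n. (euler (trunc n) h ^^ m) u A) \<longlonglongrightarrow> (euler Q h ^^ m) u A"
  using A
proof (induction m arbitrary: A)
  case (Suc m)
  have "(\<lambda>n. dual_gen (trunc n) ((euler (trunc n) h ^^ m) u) A) \<longlonglongrightarrow> dual_gen Q ((euler Q h ^^ m) u) A"
    by (rule dual_gen_tendsto[OF euler_iterate_bounded[OF subkernel_trunc h u] Suc.IH Suc.prems])
  then show ?case
    unfolding funpow.simps o_def euler_def[of _ _ "(euler _ h ^^ m) u"]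
    by (intro tendsto_add Suc.IH Suc.prems tendsto_mult tendsto_const)
qed simp

text \<open>Each unordered pair occurs twice in the lists used below, hence the rate \<open>Q i j / 2\<close>.\<close>

primrec sweep :: "real \<Rightarrow> ('s \<times> 's) list \<Rightarrow> ('s set \<Rightarrow> real) \<Rightarrow> 's set \<Rightarrow> real" where
  "sweep g [] u = u"
| "sweep g (p # ps) u = (\<lambda>A. case p of (i, j) \<Rightarrow>
     (1 - g * (Q i j / 2)) * sweep g ps u A + g * (Q i j / 2) * sweep g ps u (swap i j A))"

definition list_gen :: "('s \<times> 's) list \<Rightarrow> ('s set \<Rightarrow> real) \<Rightarrow> 's set \<Rightarrow> real" where
  "list_gen ps u A = (\<Sum>(i,j)\<leftarrow>ps. Q i j / 2 * (u (swap i j A) - u A))"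

section \<open>Sweeps: bounds, stability and first-order expansion\<close>

lemma sweep_rate:
  assumes "0 \<le> g" "g * C \<le> 2"
  shows "0 \<le> g * (Q i j / 2)" "g * (Q i j / 2) \<le> 1"
proof -
  have "g * Q i j \<le> g * C" using assms(1) by (intro mult_left_mono Q_le_C)
  then show "g * (Q i j / 2) \<le> 1" using assms(2) by simp
  show "0 \<le> g * (Q i j / 2)" using assms(1) Q_nonneg by simp
qed

text \<open>Sweeps average, so \<open>M\<close> survives any number of them, while the bound for
  Euler steps grows by a factor at each step.\<close>

lemma sweep_bounded:
  assumes g: "0 \<le> g" "g * C \<le> 2" and u: "bounded_by k M u"
  shows "bounded_by k M (sweep g ps u)"
proof (induction ps)
  case (Cons p ps)
  obtain i j where p: "p = (i, j)" by force
  define \<theta> where "\<theta> = g * (Q i j / 2)"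
  have \<theta>: "0 \<le> \<theta>" "\<theta> \<le> 1" using sweep_rate[OF g] by (auto simp: \<theta>_def)
  show ?case
    unfolding bounded_by_def
  proof
    fix A :: "'s set" assume A: "A \<in> small_sets k"
    have "\<bar>(1 - \<theta>) * sweep g ps u A + \<theta> * sweep g ps u (swap i j A)\<bar>
      \<le> (1 - \<theta>) * \<bar>sweep g ps u A\<bar> + \<theta> * \<bar>sweep g ps u (swap i j A)\<bar>"
      using \<theta> by (intro order.trans[OF abs_triangle_ineq]) (simp add: abs_mult)
    also have "\<dots> \<le> (1 - \<theta>) * M + \<theta> * M"
      using \<theta> bounded_byD[OF Cons.IH A] bounded_byD[OF Cons.IH swap_small_sets[OF A, of i j]]
      by (intro add_mono mult_left_mono) auto
    finally show "\<bar>sweep g (p # ps) u A\<bar> \<le> M" by (simp add: p \<theta>_def algebra_simps)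
  qed
qed (simp add: u)

lemma sweep_stable:
  assumes g: "0 \<le> g" "g * C \<le> 2" and D: "finite D" "set ps \<subseteq> D \<times> D"
    and u: "stable_or_zero D (\<lambda>A. complex_of_real (u A))"
  shows "stable_or_zero D (\<lambda>A. complex_of_real (sweep g ps u A))"
  using D(2)
proof (induction ps)
  case (Cons p ps)
  obtain i j where p: "p = (i, j)" "i \<in> D" "j \<in> D" using Cons.prems by (cases p) auto
  define \<theta> where "\<theta> = g * (Q i j / 2)"
  have \<theta>: "0 \<le> \<theta>" "\<theta> \<le> 1" using sweep_rate[OF g] by (auto simp: \<theta>_def)
  have "stable_or_zero D (\<lambda>A. (1 - of_real \<theta>) * complex_of_real (sweep g ps u A) +
      of_real \<theta> * complex_of_real (sweep g ps u (swap i j A)))"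
    using Cons by (intro stable_or_zero_symmetrization[OF D(1) p(2,3) \<theta>]) auto
  then show ?case by (simp add: p(1) \<theta>_def)
qed (simp add: u)

lemma list_gen_bound:
  assumes u: "bounded_by k M u" and A: "A \<in> small_sets k"
  shows "\<bar>list_gen ps u A\<bar> \<le> (\<Sum>(i,j)\<leftarrow>ps. Q i j) * M"
proof (induction ps)
  case (Cons p ps)
  obtain i j where p: "p = (i, j)" by force
  have "\<bar>u (swap i j A) - u A\<bar> \<le> 2 * M"
    using bounded_byD[OF u A] bounded_byD[OF u swap_small_sets[OF A, of i j]] by linarith
  then have "\<bar>Q i j / 2 * (u (swap i j A) - u A)\<bar> \<le> Q i j / 2 * (2 * M)"
    unfolding abs_mult using Q_nonneg[of i j] by (intro mult_mono) auto
  then show ?case using Cons by (simp add: list_gen_def p algebra_simps)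
qed (simp add: list_gen_def)

text \<open>A sweep is a product of factors \<open>1 + g * L\<close>, one operator \<open>L\<close>
  for each pair; to first order only the sum of all \<open>L\<close> remains. The constant is chosen
  before \<open>g\<close>, \<open>u\<close> and \<open>M\<close>, so that \<open>g\<close> can be
  refined later.\<close>

lemma sweep_expansion:
  "\<exists>c\<ge>0. \<forall>g u M A. 0 \<le> g \<longrightarrow> g \<le> 1 \<longrightarrow> g * C \<le> 2 \<longrightarrow> bounded_by k M u \<longrightarrow> A \<in> small_sets k \<longrightarrow>
     \<bar>sweep g ps u A - u A - g * list_gen ps u A\<bar> \<le> c * g\<^sup>2 * M"
proof (induction ps)
  case Nil
  show ?case by (intro exI[of _ 0]) (simp add: list_gen_def)
next
  case (Cons p ps)
  then obtain c where c: "c \<ge> 0" and IH: "\<And>g u M A. 0 \<le> g \<Longrightarrow> g \<le> 1 \<Longrightarrow> g * C \<le> 2 \<Longrightarrow> bounded_by k M u \<Longrightarrow>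
     A \<in> small_sets k \<Longrightarrow> \<bar>sweep g ps u A - u A - g * list_gen ps u A\<bar> \<le> c * g\<^sup>2 * M" by blast
  obtain i j where p: "p = (i, j)" by force
  define q s where "q = Q i j / 2" and "s = (\<Sum>(i,j)\<leftarrow>ps. Q i j)"
  have q: "q \<ge> 0" using Q_nonneg[of i j] by (simp add: q_def)
  have s: "s \<ge> 0" unfolding s_def by (intro sum_list_nonneg) (auto simp: Q_nonneg)
  show ?case
  \<comment> \<open>The sweep over \<open>ps\<close> moves \<open>u\<close> by at most
    \<open>g * (s + c) * M\<close>; the additional swap, of rate \<open>g * q\<close>, sees this
    change at two sets.\<close>
  proof (intro exI[of _ "c + 2 * q * (s + c)"] conjI allI impI)
    show "0 \<le> c + 2 * q * (s + c)" using c q s by simp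
    fix g M :: real and u :: "'s set \<Rightarrow> real" and A :: "'s set"
    assume g: "0 \<le> g" "g \<le> 1" "g * C \<le> 2" and u: "bounded_by k M u" and A: "A \<in> small_sets k"
    have M: "M \<ge> 0" by (rule bounded_by_nonneg[OF u])
    let ?w = "sweep g ps u"
    have diff: "\<bar>?w B - u B\<bar> \<le> g * (s + c) * M" if B: "B \<in> small_sets k" for B
    proof -
      have "\<bar>g * list_gen ps u B\<bar> \<le> g * (s * M)"
        unfolding abs_mult s_def using list_gen_bound[OF u B, of ps] g by (intro mult_mono) auto
      moreover have "c * g\<^sup>2 * M \<le> c * g * M"
        using g c M by (intro mult_right_mono mult_left_mono) (auto simp: power2_eq_square mult_left_le_one_le)
      ultimately show ?thesis using IH[OF g u B] by (simp add: algebra_simps abs_le_iff)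
    qed
    have "\<bar>(?w (swap i j A) - u (swap i j A)) - (?w A - u A)\<bar> \<le> 2 * (g * (s + c) * M)"
      using diff[OF A] diff[OF swap_small_sets[OF A, of i j]] by linarith
    then have "\<bar>g * q * ((?w (swap i j A) - u (swap i j A)) - (?w A - u A))\<bar> \<le> g * q * (2 * (g * (s + c) * M))"
      unfolding abs_mult using g q by (intro mult_mono) auto
    moreover have "sweep g (p # ps) u A - u A - g * list_gen (p # ps) u A =
      (?w A - u A - g * list_gen ps u A) + g * q * ((?w (swap i j A) - u (swap i j A)) - (?w A - u A))"
      by (simp add: p list_gen_def q_def algebra_simps)
    moreover have "(c + 2 * q * (s + c)) * g\<^sup>2 * M = c * g\<^sup>2 * M + g * q * (2 * (g * (s + c) * M))"
      by (simp add: power2_eq_square algebra_simps)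
    ultimately show "\<bar>sweep g (p # ps) u A - u A - g * list_gen (p # ps) u A\<bar> \<le> (c + 2 * q * (s + c)) * g\<^sup>2 * M"
      using IH[OF g u A] by linarith
  qed
qed

lemma list_gen_window:
  assumes "distinct ps" "set ps = window n \<times> window n"
  shows "list_gen ps u A = dual_gen (trunc n) u A"
proof -
  have "(\<Sum>\<^sub>\<infinity>(i,j)\<in>UNIV. trunc n i j * (u (swap i j A) - u A)) =
    (\<Sum>\<^sub>\<infinity>(i,j)\<in>window n \<times> window n. Q i j * (u (swap i j A) - u A))"
    by (rule infsum_cong_neutral) (auto simp: trunc_def split: if_splits)
  also have "\<dots> = (\<Sum>(i,j)\<in>window n \<times> window n. Q i j * (u (swap i j A) - u A))"
    by (rule infsum_finite) (simp add: finite_window)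
  finally show ?thesis
    unfolding list_gen_def dual_gen_def using assms
    by (simp add: sum_list_distinct_conv_sum_set sum_distrib_left case_prod_unfold)
qed

text \<open>Compares \<open>l\<close> sweeps with one Euler step of length \<open>l * g\<close>.
  Each sweep adds its own error \<open>c * g^2 * M\<close>, and the generator acts on a function
  that has drifted from \<open>u\<close>; the drifts add up to the term with \<open>l^2\<close>. For
  fixed \<open>l * g = h\<close> the bound tends to \<open>K^2 * h^2 * M\<close>, the order of the
  local error of an Euler step.\<close>

lemma sweep_iterate_expansion:
  assumes c: "c \<ge> 0" and g: "0 \<le> g" "g \<le> 1" "g * C \<le> 2"
    and one: "\<And>u A. bounded_by k M u \<Longrightarrow> A \<in> small_sets k \<Longrightarrow>
      \<bar>sweep g ps u A - u A - g * dual_gen (trunc n) u A\<bar> \<le> c * g\<^sup>2 * M"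
    and u: "bounded_by k M u"
  defines "K \<equiv> 2 * real k * C"
  shows "bounded_by k (real l * (c * g\<^sup>2) * M + (real l)\<^sup>2 * (g * K * (g * K + c * g\<^sup>2)) * M)
    (\<lambda>A. (sweep g ps ^^ l) u A - euler (trunc n) (real l * g) u A)"
proof -
  let ?V = "sweep g ps"
  have M: "M \<ge> 0" by (rule bounded_by_nonneg[OF u])
  have K: "K \<ge> 0" using C_nonneg by (simp add: K_def)
  have bd: "bounded_by k M ((?V ^^ j) u)" for j
    by (induction j) (simp_all add: u sweep_bounded[OF g(1,3)])
  have step: "\<bar>?V w A - w A\<bar> \<le> (g * K + c * g\<^sup>2) * M" if w: "bounded_by k M w" and A: "A \<in> small_sets k" for w A
  proof -
    have "\<bar>g * dual_gen (trunc n) w A\<bar> \<le> g * (K * M)"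
      unfolding abs_mult using g bounded_byD[OF dual_gen_bounded[OF subkernel_trunc w] A]
      by (intro mult_mono) (auto simp: K_def)
    then show ?thesis using one[OF w A] by (simp add: algebra_simps abs_le_iff)
  qed
  have drift: "bounded_by k (real j * (g * K + c * g\<^sup>2) * M) (\<lambda>A. (?V ^^ j) u A - u A)" for j
  proof (induction j)
    case (Suc j)
    show ?case
      unfolding bounded_by_def
    proof
      fix A :: "'s set" assume A: "A \<in> small_sets k"
      show "\<bar>(?V ^^ Suc j) u A - u A\<bar> \<le> real (Suc j) * (g * K + c * g\<^sup>2) * M"
        using step[OF bd[of j] A] bounded_byD[OF Suc A] by (simp add: algebra_simps abs_le_iff)
    qed
  qed (simp add: bounded_by_def)
  show ?thesis
  proof (induction l)
    case 0
    then show ?case by (simp add: bounded_by_def euler_def)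
  next
    case (Suc l)
    let ?w = "(?V ^^ l) u" and ?L = "dual_gen (trunc n)"
    define b where "b = g * K * (g * K + c * g\<^sup>2) * M"
    have b: "b \<ge> 0" using g K c M by (simp add: b_def)
    show ?case
      unfolding bounded_by_def
    proof
      fix A :: "'s set" assume A: "A \<in> small_sets k"
      have "\<bar>g * ?L (\<lambda>A. ?w A - u A) A\<bar> \<le> g * (K * (real l * (g * K + c * g\<^sup>2) * M))"
        unfolding abs_mult using g bounded_byD[OF dual_gen_bounded[OF subkernel_trunc drift[of l]] A]
        by (intro mult_mono) (auto simp: K_def)
      then have 1: "\<bar>g * ?L ?w A - g * ?L u A\<bar> \<le> real l * b"
        unfolding dual_gen_diff[OF subkernel_trunc bd[of l] u A] by (simp add: b_def algebra_simps)
      have 2: "\<bar>?V ?w A - ?w A - g * ?L ?w A\<bar> \<le> c * g\<^sup>2 * M" by (rule one[OF bd A])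
      have 3: "\<bar>?w A - euler (trunc n) (real l * g) u A\<bar> \<le> real l * (c * g\<^sup>2) * M + (real l)\<^sup>2 * b"
        using bounded_byD[OF Suc A] by (simp add: b_def mult.assoc)
      have 4: "(?V ^^ Suc l) u A - euler (trunc n) (real (Suc l) * g) u A =
        (?V ?w A - ?w A - g * ?L ?w A) + (g * ?L ?w A - g * ?L u A) + (?w A - euler (trunc n) (real l * g) u A)"
        by (simp add: euler_def algebra_simps)
      have "(real (Suc l))\<^sup>2 * b = (real l)\<^sup>2 * b + 2 * (real l * b) + b"
        by (simp add: power2_eq_square algebra_simps)
      then have 5: "(real l)\<^sup>2 * b + real l * b \<le> (real (Suc l))\<^sup>2 * b" using b by simp
      have 6: "real (Suc l) * (c * g\<^sup>2) * M = real l * (c * g\<^sup>2) * M + c * g\<^sup>2 * M"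
        by (simp add: algebra_simps)
      have "\<bar>(?V ^^ Suc l) u A - euler (trunc n) (real (Suc l) * g) u A\<bar>
        \<le> real (Suc l) * (c * g\<^sup>2) * M + (real (Suc l))\<^sup>2 * b"
        unfolding 4 using 1 2 3 5 6 by linarith
      then show "\<bar>(?V ^^ Suc l) u A - euler (trunc n) (real (Suc l) * g) u A\<bar>
        \<le> real (Suc l) * (c * g\<^sup>2) * M + (real (Suc l))\<^sup>2 * (g * K * (g * K + c * g\<^sup>2)) * M"
        by (simp add: b_def mult.assoc)
    qed
  qed
qed

text \<open>The solution \<open>u t\<close> is approximated by Euler steps, these by Euler steps for a truncated kernel, and
  one Euler step for the truncated kernel by many short sweeps, which preserve stability.\<close>

lemma stable_dual_flow:
  fixes u :: "real \<Rightarrow> 's set \<Rightarrow> real"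
  assumes bound: "\<And>s A. 0 \<le> s \<Longrightarrow> finite A \<Longrightarrow> \<bar>u s A\<bar> \<le> 1"
    and deriv: "\<And>s A. 0 < s \<Longrightarrow> finite A \<Longrightarrow> ((\<lambda>s. u s A) has_real_derivative dual_gen Q (u s) A) (at s)"
    and cont: "\<And>A. finite A \<Longrightarrow> continuous_on {0..} (\<lambda>s. u s A)"
    and st: "\<And>E. finite E \<Longrightarrow> stable_or_zero E (\<lambda>A. complex_of_real (u 0 A))"
    and t: "0 \<le> t" and E: "finite E"
  shows "stable_or_zero E (\<lambda>A. complex_of_real (u t A))"
proof -
  define k K where "k = card E" and "K = 2 * real k * C"
  have K: "K \<ge> 0" using C_nonneg by (simp add: K_def)
  have small: "A \<in> small_sets k" if "A \<subseteq> E" for A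
    using that E by (auto simp: small_sets_def k_def intro: finite_subset card_mono)
  have bd: "bounded_by k 1 (u s)" if "0 \<le> s" for s using bound[OF that] by (simp add: bounded_by_def small_sets_def)
  have mvt: "\<exists>\<xi>. s < \<xi> \<and> \<xi> < s + h \<and> u (s + h) A - u s A = h * dual_gen Q (u \<xi>) A"
    if sh: "0 \<le> s" "0 < h" "A \<in> small_sets k" for s h A
  proof -
    have finA: "finite A" using sh by (simp add: small_sets_def)
    obtain \<xi> where "s < \<xi>" "\<xi> < s + h" "u (s + h) A - u s A = dual_gen Q (u \<xi>) A * (s + h - s)"
    proof (rule Deriv.mvt[of s "s + h" "\<lambda>s. u s A" "\<lambda>\<xi>. times (dual_gen Q (u \<xi>) A)"])
      show "continuous_on {s..s + h} (\<lambda>s. u s A)"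
        using sh by (intro continuous_on_subset[OF cont[OF finA]]) auto
      show "((\<lambda>s. u s A) has_derivative times (dual_gen Q (u x) A)) (at x)" if "s < x" "x < s + h" for x
        using deriv[of x A] finA that sh(1) by (simp add: has_field_derivative_def)
    qed (use sh in auto)
    then show ?thesis by (auto simp: mult.commute)
  qed
  have lipschitz: "bounded_by k (K * h) (\<lambda>A. u (s + h) A - u s A)" if sh: "0 \<le> s" "0 < h" for s h
    unfolding bounded_by_def
  proof
    fix A :: "'s set" assume A: "A \<in> small_sets k"
    obtain \<xi> where \<xi>: "s < \<xi>" "u (s + h) A - u s A = h * dual_gen Q (u \<xi>) A"
      using mvt[OF sh A] by auto
    have "\<bar>dual_gen Q (u \<xi>) A\<bar> \<le> K * 1"
      using bounded_byD[OF dual_gen_bounded[OF subkernel_Q bd, of \<xi>] A] \<xi> sh by (simp add: K_def)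
    then show "\<bar>u (s + h) A - u s A\<bar> \<le> K * h"
      unfolding \<xi>(2) abs_mult using sh by (simp add: mult.commute mult_left_mono)
  qed
  have flow_step: "bounded_by k (K\<^sup>2 * h\<^sup>2) (\<lambda>A. u (s + h) A - euler Q h (u s) A)" if sh: "0 \<le> s" "0 < h" for s h
    unfolding bounded_by_def
  proof
    fix A :: "'s set" assume A: "A \<in> small_sets k"
    obtain \<xi> where \<xi>: "s < \<xi>" "\<xi> < s + h" "u (s + h) A - u s A = h * dual_gen Q (u \<xi>) A"
      using mvt[OF sh A] by auto
    have "bounded_by k (K * (\<xi> - s)) (\<lambda>A. u \<xi> A - u s A)"
      using lipschitz[of s "\<xi> - s"] \<xi> sh by simp
    then have d: "bounded_by k (K * h) (\<lambda>A. u \<xi> A - u s A)"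
      using \<xi> K by (elim bounded_by_mono) (auto intro: mult_left_mono)
    have "u (s + h) A - euler Q h (u s) A = h * (dual_gen Q (u \<xi>) A - dual_gen Q (u s) A)"
      using \<xi>(3) by (simp add: euler_def algebra_simps)
    also have "\<dots> = h * dual_gen Q (\<lambda>A. u \<xi> A - u s A) A"
      using dual_gen_diff[OF subkernel_Q bd bd A, of \<xi> s] \<xi> sh by simp
    finally have "\<bar>u (s + h) A - euler Q h (u s) A\<bar> = h * \<bar>dual_gen Q (\<lambda>A. u \<xi> A - u s A) A\<bar>"
      using sh by (simp add: abs_mult)
    also have "\<dots> \<le> h * (K * (K * h))"
      using bounded_byD[OF dual_gen_bounded[OF subkernel_Q d] A] sh by (intro mult_left_mono) (auto simp: K_def)
    finally show "\<bar>u (s + h) A - euler Q h (u s) A\<bar> \<le> K\<^sup>2 * h\<^sup>2"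
      by (simp add: power2_eq_square algebra_simps)
  qed
  have approx: "\<exists>v. stable_or_zero E (\<lambda>A. complex_of_real (v A)) \<and> (\<forall>A\<subseteq>E. \<bar>v A - u t A\<bar> < \<epsilon>)" if \<epsilon>: "\<epsilon> > 0" for \<epsilon>
  proof (cases "t = 0")
    case True
    then show ?thesis using st[OF E] \<epsilon> by (intro exI[of _ "u 0"]) simp
  next
    case False
    then have t: "t > 0" using \<open>0 \<le> t\<close> by simp
    define e where "e = exp (K * t)"
    have e: "e > 0" by (simp add: e_def)
    \<comment> \<open>\<open>m\<close> steps of length \<open>h = t / m\<close> accumulate an error
      of at most \<open>m * K^2 * h^2 * e = K^2 * t^2 * e / m\<close>, because
      \<open>(1 + K * h)^m\<close> is at most \<open>exp (K * t)\<close>.\<close>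
    obtain m0 :: nat where m0: "real m0 > 4 * (K\<^sup>2 * t\<^sup>2 * e) / \<epsilon>" using reals_Archimedean2 by blast
    define m where "m = Suc m0"
    have m: "m > 0" "4 * (K\<^sup>2 * t\<^sup>2 * e) / real m < \<epsilon>"
      using m0 \<epsilon> by (auto simp: m_def field_simps)
    define h where "h = t / real m"
    have h: "h > 0" "real m * h = t" using t m by (auto simp: h_def)
    have "0 \<le> K * t" using K t by simp
    then have "- real m \<le> K * t" by linarith
    then have b: "(1 + K * h) ^ m \<le> e"
      using exp_ge_one_plus_x_over_n_power_n[of m "K * t"] m by (simp add: h_def e_def)
    have b1: "1 + K * h \<ge> 1" using K h by simp
    have small_error: "real m * (K\<^sup>2 * h\<^sup>2) * (1 + K * h) ^ m < \<epsilon> / 4"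
    proof -
      have "real m * (K\<^sup>2 * h\<^sup>2) * (1 + K * h) ^ m \<le> real m * (K\<^sup>2 * h\<^sup>2) * e"
        using b by (intro mult_left_mono) auto
      also have "\<dots> = K\<^sup>2 * t\<^sup>2 * e / real m"
        using m by (simp add: h_def power2_eq_square field_simps)
      finally show ?thesis using m by simp
    qed
    have "bounded_by k (real m * (K\<^sup>2 * h\<^sup>2) * (1 + K * h) ^ m)
        (\<lambda>A. u (real m * h) A - (euler Q h ^^ m) (u (real 0 * h)) A)"
      unfolding K_def
    proof (rule euler_approximation[OF subkernel_Q, where v = "\<lambda>j. u (real j * h)" and M = 1])
      show "bounded_by k ((2 * real k * C)\<^sup>2 * h\<^sup>2) (\<lambda>A. u (real (Suc j) * h) A - euler Q h (u (real j * h)) A)" for j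
        using flow_step[of "real j * h" h] h by (simp add: K_def algebra_simps)
    qed (use h bd in auto)
    then have err1: "\<bar>u t A - (euler Q h ^^ m) (u 0) A\<bar> < \<epsilon> / 4" if "A \<subseteq> E" for A
      using bounded_byD[OF _ small[OF that]] small_error h by fastforce
    have "\<forall>\<^sub>F n in sequentially. \<forall>A\<in>Pow E. dist ((euler (trunc n) h ^^ m) (u 0) A) ((euler Q h ^^ m) (u 0) A) < \<epsilon> / 4"
    proof (rule eventually_ball_finite)
      show "\<forall>A\<in>Pow E. \<forall>\<^sub>F n in sequentially. dist ((euler (trunc n) h ^^ m) (u 0) A) ((euler Q h ^^ m) (u 0) A) < \<epsilon> / 4"
      proof
        fix A assume "A \<in> Pow E"
        then show "\<forall>\<^sub>F n in sequentially. dist ((euler (trunc n) h ^^ m) (u 0) A) ((euler Q h ^^ m) (u 0) A) < \<epsilon> / 4"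
          using h \<epsilon> by (intro tendstoD euler_iterate_tendsto[OF _ bd[of 0] small]) auto
      qed
    qed (use E in auto)
    moreover have "\<forall>\<^sub>F n in sequentially. E \<subseteq> window n"
      using finite_subset_window[OF E] by (auto simp: eventually_sequentially)
    ultimately have "\<forall>\<^sub>F n in sequentially. E \<subseteq> window n \<and>
      (\<forall>A\<in>Pow E. dist ((euler (trunc n) h ^^ m) (u 0) A) ((euler Q h ^^ m) (u 0) A) < \<epsilon> / 4)"
      by eventually_elim auto
    then obtain n where n: "E \<subseteq> window n"
      and err2: "\<And>A. A \<subseteq> E \<Longrightarrow> \<bar>(euler (trunc n) h ^^ m) (u 0) A - (euler Q h ^^ m) (u 0) A\<bar> < \<epsilon> / 4"
      by (auto simp: eventually_sequentially dist_real_def)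
    obtain ps where ps: "set ps = window n \<times> window n" "distinct ps"
      using finite_distinct_list[of "window n \<times> window n"] finite_window by auto
    obtain c where c: "c \<ge> 0" and one: "\<And>g u M A. 0 \<le> g \<Longrightarrow> g \<le> 1 \<Longrightarrow> g * C \<le> 2 \<Longrightarrow> bounded_by k M u \<Longrightarrow>
        A \<in> small_sets k \<Longrightarrow> \<bar>sweep g ps u A - u A - g * dual_gen (trunc n) u A\<bar> \<le> c * g\<^sup>2 * M"
      using sweep_expansion[of k ps] unfolding list_gen_window[OF ps(2,1)] by blast
    \<comment> \<open>One part of the error of the sweeps repeats the Euler error; the rest,
      accumulated over \<open>m\<close> steps, is at most \<open>d / l\<close>. The choice of
      \<open>l\<close> below makes this less than \<open>\<epsilon> / 4\<close> and keeps
      \<open>g = h / l\<close> in the range of \<open>sweep_expansion\<close>.\<close>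
    define d where "d = real m * (c * h\<^sup>2 + h * K * (c * h\<^sup>2)) * e"
    have d: "d \<ge> 0" using c h K e by (simp add: d_def)
    obtain l0 :: nat where l0: "real l0 > h + h * C + 4 * d / \<epsilon>" using reals_Archimedean2 by blast
    define l where "l = Suc l0"
    have nn: "h * C \<ge> 0" "4 * d / \<epsilon> \<ge> 0" using h C_nonneg d \<epsilon> by auto
    have l: "l > 0" "h \<le> real l" "h * C \<le> real l" "4 * d / \<epsilon> < real l"
      using l0 nn h by (auto simp: l_def)
    define g where "g = h / real l"
    have g: "0 \<le> g" "g \<le> 1" "g * C \<le> 2" "real l * g = h"
      using l h by (auto simp: g_def field_simps)
    define \<delta> where "\<delta> = real l * (c * g\<^sup>2) * 1 + (real l)\<^sup>2 * (g * K * (g * K + c * g\<^sup>2)) * 1"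
    have \<delta>: "\<delta> \<ge> 0" using c g K by (simp add: \<delta>_def)
    have \<delta>_eq: "\<delta> = K\<^sup>2 * h\<^sup>2 + (c * h\<^sup>2 + h * K * (c * h\<^sup>2)) / real l"
      using l by (simp add: \<delta>_def g_def power2_eq_square field_simps)
    define W where "W = (sweep g ps ^^ l)"
    have W_step: "bounded_by k \<delta> (\<lambda>A. W w A - euler (trunc n) h w A)" if "bounded_by k 1 w" for w
      using sweep_iterate_expansion[OF c g(1-3) one[OF g(1-3)] that, where l = l]
      unfolding \<delta>_def W_def K_def g(4) by simp
    have sw_bd: "bounded_by k 1 ((sweep g ps ^^ j) w)" if "bounded_by k 1 w" for j w
      using that by (induction j) (simp_all add: sweep_bounded[OF g(1,3)])
    have W_bd: "bounded_by k 1 ((W ^^ j) (u 0))" for j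
      by (induction j) (simp_all add: bd W_def sw_bd)
    have "bounded_by k (real m * \<delta> * (1 + K * h) ^ m) (\<lambda>A. (W ^^ m) (u 0) A - (euler (trunc n) h ^^ m) ((W ^^ 0) (u 0)) A)"
      unfolding K_def
      by (rule euler_approximation[OF subkernel_trunc, where v = "\<lambda>j. (W ^^ j) (u 0)" and M = 1])
        (use h \<delta> W_bd W_step in auto)
    moreover have "real m * \<delta> * (1 + K * h) ^ m < \<epsilon> / 2"
    proof -
      have "real m * ((c * h\<^sup>2 + h * K * (c * h\<^sup>2)) / real l) * (1 + K * h) ^ m
        \<le> real m * ((c * h\<^sup>2 + h * K * (c * h\<^sup>2)) / real l) * e"
        using b c h K by (intro mult_left_mono) auto
      also have "\<dots> = d / real l" by (simp add: d_def)
      also have "\<dots> < \<epsilon> / 4" using l \<epsilon> by (simp add: field_simps)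
      finally have "real m * ((c * h\<^sup>2 + h * K * (c * h\<^sup>2)) / real l) * (1 + K * h) ^ m < \<epsilon> / 4" .
      moreover have "real m * \<delta> * (1 + K * h) ^ m = real m * (K\<^sup>2 * h\<^sup>2) * (1 + K * h) ^ m +
          real m * ((c * h\<^sup>2 + h * K * (c * h\<^sup>2)) / real l) * (1 + K * h) ^ m"
        unfolding \<delta>_eq by (simp only: distrib_left distrib_right)
      ultimately show ?thesis using small_error by linarith
    qed
    ultimately have err3: "\<bar>(W ^^ m) (u 0) A - (euler (trunc n) h ^^ m) (u 0) A\<bar> < \<epsilon> / 2" if "A \<subseteq> E" for A
      using bounded_byD[OF _ small[OF that]] by fastforce
    \<comment> \<open>Stability is propagated on the whole window because the sweeps exchange sites
      of \<open>E\<close> with sites outside; the restriction to \<open>E\<close> comes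
      last.\<close>
    have sw_st: "stable_or_zero (window n) (\<lambda>A. complex_of_real ((sweep g ps ^^ j) w A))"
      if "stable_or_zero (window n) (\<lambda>A. complex_of_real (w A))" for j w
      using that ps by (induction j) (simp_all add: sweep_stable[OF g(1,3) finite_window])
    have "stable_or_zero (window n) (\<lambda>A. complex_of_real ((W ^^ j) (u 0) A))" for j
      by (induction j) (simp_all add: st finite_window W_def sw_st)
    then have "stable_or_zero E (\<lambda>A. complex_of_real ((W ^^ m) (u 0) A))"
      by (rule stable_or_zero_subset[OF finite_window n])
    moreover have "\<bar>(W ^^ m) (u 0) A - u t A\<bar> < \<epsilon>" if "A \<subseteq> E" for A
      using err1[OF that] err2[OF that] err3[OF that] by linarith
    ultimately show ?thesis by blast
  qed
  have "\<forall>n. \<exists>v. stable_or_zero E (\<lambda>A. complex_of_real (v A)) \<and> (\<forall>A\<subseteq>E. \<bar>v A - u t A\<bar> < 1 / real (Suc n))"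
    using approx by simp
  then obtain v where v: "\<And>n. stable_or_zero E (\<lambda>A. complex_of_real (v n A))"
    "\<And>n A. A \<subseteq> E \<Longrightarrow> \<bar>v n A - u t A\<bar> < 1 / real (Suc n)" by metis
  show ?thesis
  proof (rule stable_or_zero_limit[OF E v(1)])
    fix A assume A: "A \<subseteq> E"
    have "(\<lambda>n. v n A - u t A) \<longlonglongrightarrow> 0"
      by (rule Lim_null_comparison[OF _ LIMSEQ_Suc[OF lim_1_over_n]])
        (use v(2)[OF A] in \<open>auto intro!: always_eventually less_imp_le\<close>)
    then have "(\<lambda>n. v n A) \<longlonglongrightarrow> u t A" by (simp add: LIM_zero_iff)
    then show "(\<lambda>n. complex_of_real (v n A)) \<longlonglongrightarrow> complex_of_real (u t A)"
      by (rule tendsto_of_real)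
  qed
qed

end

section \<open>The exclusion semigroup\<close>

text \<open>\<open>Bcontfun\<close> is meaningful only on continuous functions, and for infinite
  \<open>A\<close> this indicator need not be continuous in the product topology; hence the
  finiteness assumptions below.\<close>

definition occ :: "'s set \<Rightarrow> ('s \<Rightarrow> bool) \<Rightarrow>\<^sub>C real" where
  "occ A = Bcontfun (\<lambda>\<eta>. of_bool (\<forall>i\<in>A. \<eta> i))"

lemma apply_occ:
  assumes "finite A"
  shows "apply_bcontfun (occ A) = (\<lambda>\<eta>. of_bool (\<forall>i\<in>A. \<eta> i))"
proof -
  have "continuous_on UNIV (\<lambda>\<eta> :: 'a \<Rightarrow> bool. of_bool (\<eta> i) :: real)" for i
    by (rule continuous_on_compose2[of UNIV "of_bool :: bool \<Rightarrow> real" UNIV "\<lambda>\<eta> :: 'a \<Rightarrow> bool. \<eta> i"])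
      auto
  then have "continuous_on UNIV (\<lambda>\<eta> :: 'a \<Rightarrow> bool. \<Prod>i\<in>A. of_bool (\<eta> i) :: real)"
    by (intro continuous_on_prod)
  moreover have "(\<Prod>i\<in>A. of_bool (\<eta> i) :: real) = of_bool (\<forall>i\<in>A. \<eta> i)" for \<eta>
    using assms by (induction A rule: finite_induct) auto
  ultimately have "(\<lambda>\<eta> :: 'a \<Rightarrow> bool. of_bool (\<forall>i\<in>A. \<eta> i) :: real) \<in> bcontfun"
    by (intro bcontfun_normI[where b = 1]) auto
  then show ?thesis unfolding occ_def by (rule Bcontfun_inverse)
qed

lemma norm_occ: "finite A \<Longrightarrow> norm (occ A) \<le> 1"
  by (rule norm_bound) (simp add: apply_occ)

lemma interchange_eq_transpose: "interchange i j \<eta> = \<eta> \<circ> Transposition.transpose i j"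
  by (auto simp: interchange_def fun_eq_iff Transposition.transpose_def)

text \<open>Self-duality: moving the particles or moving the set of tested sites has the same
  effect. A transposition is its own inverse, so the same \<open>swap\<close> appears.\<close>

lemma occ_interchange:
  "finite A \<Longrightarrow> apply_bcontfun (occ A) (interchange i j \<eta>) = apply_bcontfun (occ (swap i j A)) \<eta>"
  by (simp add: apply_occ interchange_eq_transpose)

lemma cylinder_occ: "finite A \<Longrightarrow> cylinder_function (apply_bcontfun (occ A))"
  unfolding cylinder_function_def by (rule exI[of _ A]) (simp add: apply_occ)

context exclusion_rates
begin

text \<open>Pulls a bounded functional through the infinite sum that defines the generator. In the
  application \<open>\<Phi> f\<close> is the expectation of \<open>T s f\<close> at the initial
  configuration, and the evolution equation of the semigroup becomes the dual equation.\<close>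

lemma generator_dual:
  fixes \<Phi> :: "(('s \<Rightarrow> bool) \<Rightarrow>\<^sub>C real) \<Rightarrow> real"
  assumes lin: "linear \<Phi>" and bound: "\<And>f. \<bar>\<Phi> f\<bar> \<le> norm f" and A: "finite A"
    and g: "\<And>\<eta>. apply_bcontfun g \<eta> = exclusion_generator Q (apply_bcontfun (occ A)) \<eta>"
  shows "\<Phi> g = dual_gen Q (\<lambda>B. \<Phi> (occ B)) A"
proof -
  define d where "d = (\<lambda>(i,j). Q i j *\<^sub>R (occ (swap i j A) - occ A))"
  have Ak: "A \<in> small_sets (card A)" using A by (simp add: small_sets_def)
  have apply_sum: "apply_bcontfun (sum d F) \<eta> = (\<Sum>p\<in>F. apply_bcontfun (d p) \<eta>)" for F \<eta>
    by (induction F rule: infinite_finite_induct) auto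
  \<comment> \<open>The partial sums converge uniformly in the configuration. Their limit is
    \<open>2 g\<close> because of the factor 1/2 in the generator.\<close>
  have tail: "norm (2 *\<^sub>R g - sum d F) \<le> 2 * (infsum (weight A) UNIV - sum (weight A) F)" if F: "finite F" for F
  proof (rule norm_bound)
    fix \<eta>
    define x where "x = (\<lambda>(i,j). Q i j * (apply_bcontfun (occ (swap i j A)) \<eta> - apply_bcontfun (occ A) \<eta>))"
    have bd: "bounded_by (card A) 1 (\<lambda>B. apply_bcontfun (occ B) \<eta>)"
      by (auto simp: bounded_by_def small_sets_def apply_occ)
    have sx: "x summable_on UNIV"
      unfolding x_def by (rule dual_gen_summable[OF subkernel_Q bd Ak])
    have ax: "(\<lambda>p. norm (x p)) summable_on UNIV"
      unfolding x_def by (rule dual_gen_abs_summable[OF subkernel_Q bd Ak])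
    have nx: "norm (x p) \<le> 2 * weight A p" for p
      using term_bound'[OF subkernel_Q bd Ak, of p] by (simp add: x_def)
    have "apply_bcontfun g \<eta> = 1/2 * infsum x UNIV"
      unfolding g exclusion_generator_def x_def occ_interchange[OF A] ..
    moreover have "apply_bcontfun (sum d F) \<eta> = sum x F"
      unfolding apply_sum by (intro sum.cong) (auto simp: d_def x_def)
    moreover have rest: "(x has_sum (infsum x UNIV - sum x F)) (UNIV - F)"
      using F by (intro has_sum_Diff has_sum_infsum sx has_sum_finite) auto
    moreover have wF: "((\<lambda>p. 2 * weight A p) has_sum (2 * (infsum (weight A) UNIV - sum (weight A) F))) (UNIV - F)"
      using F by (intro has_sum_cmult_right has_sum_Diff has_sum_infsum weight_summable A has_sum_finite) auto
    moreover have "norm (infsum x (UNIV - F)) \<le> infsum (\<lambda>p. 2 * weight A p) (UNIV - F)"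
    proof -
      have ax': "(\<lambda>p. norm (x p)) summable_on (UNIV - F)"
        by (rule summable_on_subset_banach[OF ax]) auto
      have "norm (infsum x (UNIV - F)) \<le> infsum (\<lambda>p. norm (x p)) (UNIV - F)"
        by (rule norm_infsum_bound[OF ax'])
      also have "\<dots> \<le> infsum (\<lambda>p. 2 * weight A p) (UNIV - F)"
        using wF by (intro infsum_mono ax' nx) (auto intro: has_sum_imp_summable)
      finally show ?thesis .
    qed
    ultimately show "norm (apply_bcontfun (2 *\<^sub>R g - sum d F) \<eta>) \<le> 2 * (infsum (weight A) UNIV - sum (weight A) F)"
      by (simp add: infsumI)
  qed
  have \<Phi>d: "\<Phi> (d p) = (\<lambda>(i,j). Q i j * (\<Phi> (occ (swap i j A)) - \<Phi> (occ A))) p" for p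
    by (cases p) (simp add: d_def linear_cmul[OF lin] linear_diff[OF lin])
  have "((\<lambda>F. sum (\<lambda>p. \<Phi> (d p)) F - 2 * \<Phi> g) \<longlongrightarrow> 0) (finite_subsets_at_top UNIV)"
  proof (rule Lim_null_comparison)
    show "\<forall>\<^sub>F F in finite_subsets_at_top UNIV. norm (sum (\<lambda>p. \<Phi> (d p)) F - 2 * \<Phi> g)
       \<le> 2 * (infsum (weight A) UNIV - sum (weight A) F)"
    proof (rule eventually_finite_subsets_at_top_weakI)
      fix F :: "('s \<times> 's) set" assume F: "finite F"
      have "sum (\<lambda>p. \<Phi> (d p)) F - 2 * \<Phi> g = - \<Phi> (2 *\<^sub>R g - sum d F)"
        by (simp add: linear_diff[OF lin] linear_sum[OF lin] linear_cmul[OF lin])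
      then show "norm (sum (\<lambda>p. \<Phi> (d p)) F - 2 * \<Phi> g) \<le> 2 * (infsum (weight A) UNIV - sum (weight A) F)"
        using bound[of "2 *\<^sub>R g - sum d F"] tail[OF F] by simp
    qed
    have "(sum (weight A) \<longlongrightarrow> infsum (weight A) UNIV) (finite_subsets_at_top UNIV)"
      using has_sum_infsum[OF weight_summable[OF A]] by (simp add: has_sum_def)
    then have "((\<lambda>F. 2 * (infsum (weight A) UNIV - sum (weight A) F)) \<longlongrightarrow>
        2 * (infsum (weight A) UNIV - infsum (weight A) UNIV)) (finite_subsets_at_top UNIV)"
      by (intro tendsto_intros)
    then show "((\<lambda>F. 2 * (infsum (weight A) UNIV - sum (weight A) F)) \<longlongrightarrow> 0) (finite_subsets_at_top UNIV)"
      by simp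
  qed
  then have "((\<lambda>p. \<Phi> (d p)) has_sum (2 * \<Phi> g)) UNIV"
    unfolding has_sum_def by (simp add: LIM_zero_iff)
  then have "2 * \<Phi> g = infsum (\<lambda>p. \<Phi> (d p)) UNIV" by (simp add: infsumI)
  then show ?thesis unfolding dual_gen_def \<Phi>d[abs_def] by simp
qed

end

section \<open>Functionals along a Markov semigroup\<close>

lemma Markov_semigroup_contraction:
  assumes T: "Markov_semigroup T" and t: "0 \<le> t"
  shows "norm (T t f) \<le> norm f"
proof (rule norm_bound)
  fix \<eta>
  have lin: "linear (T t)" and one: "T t (const_bcontfun 1) = const_bcontfun 1"
    and pos: "\<And>f. (\<And>\<eta>. 0 \<le> apply_bcontfun f \<eta>) \<Longrightarrow> (\<And>\<eta>. 0 \<le> apply_bcontfun (T t f) \<eta>)"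
    using T t by (auto simp: Markov_semigroup_def)
  have fb: "\<bar>apply_bcontfun f \<zeta>\<bar> \<le> norm f" for \<zeta> using norm_bounded[of f \<zeta>] by simp
  \<comment> \<open>Positivity applied to \<open>norm f - f\<close> and \<open>norm f + f\<close>,
    together with preservation of constants, gives the two bounds.\<close>
  have "0 \<le> apply_bcontfun (T t (norm f *\<^sub>R const_bcontfun 1 - f)) \<eta>"
    using fb by (intro pos) (simp add: abs_le_iff const_bcontfun.rep_eq)
  moreover have "0 \<le> apply_bcontfun (T t (norm f *\<^sub>R const_bcontfun 1 + f)) \<eta>"
  proof (intro pos)
    fix \<zeta> show "0 \<le> apply_bcontfun (norm f *\<^sub>R const_bcontfun 1 + f) \<zeta>"
      using fb[of \<zeta>] by (simp add: abs_le_iff const_bcontfun.rep_eq)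
  qed
  ultimately show "norm (apply_bcontfun (T t f) \<eta>) \<le> norm f"
    by (simp add: linear_diff[OF lin] linear_add[OF lin] linear_cmul[OF lin] one const_bcontfun.rep_eq abs_le_iff)
qed

text \<open>Reduces approach to \<open>t\<close> from either side to the limit at 0 from the right,
  the only one that the semigroup assumptions provide.\<close>

lemma filterlim_abs_diff_at_right: "filterlim (\<lambda>y :: real. \<bar>y - t\<bar>) (at_right 0) (at t within S)"
  unfolding filterlim_at
proof
  show "((\<lambda>y. \<bar>y - t\<bar>) \<longlongrightarrow> 0) (at t within S)"
    by (rule tendsto_eq_intros | simp)+
  show "\<forall>\<^sub>F x in at t within S. \<bar>x - t\<bar> \<in> {0<..} \<and> \<bar>x - t\<bar> \<noteq> 0"
    by (auto simp: eventually_at_filter)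
qed

context
  fixes T :: "real \<Rightarrow> (('s \<Rightarrow> bool) \<Rightarrow>\<^sub>C real) \<Rightarrow> (('s \<Rightarrow> bool) \<Rightarrow>\<^sub>C real)" and \<Lambda> :: "(('s \<Rightarrow> bool) \<Rightarrow>\<^sub>C real) \<Rightarrow> real"
  assumes T: "Markov_semigroup T" and lin\<Lambda>: "linear \<Lambda>" and bound\<Lambda>: "\<And>f. \<bar>\<Lambda> f\<bar> \<le> norm f"
begin

text \<open>The increment between two times is \<open>T\<close> at the earlier time applied to
  \<open>T h f - f\<close>, and \<open>T\<close> is a contraction.\<close>

lemma semigroup_functional_continuous: "continuous_on {0..} (\<lambda>s. \<Lambda> (T s f))"
  unfolding continuous_on_def
proof
  fix t :: real assume t: "t \<in> {0..}"
  have lin: "linear (T s)" if "0 \<le> s" for s using T that by (simp add: Markov_semigroup_def)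
  have add: "T (s + r) f = T s (T r f)" if "0 \<le> s" "0 \<le> r" for s r
    using T that by (simp add: Markov_semigroup_def)
  have "((\<lambda>h. T h f) \<longlongrightarrow> f) (at_right 0)" using T by (simp add: Markov_semigroup_def)
  then have "((\<lambda>h. norm (T h f - f)) \<longlongrightarrow> 0) (at_right 0)" by (simp add: LIM_zero tendsto_norm_zero)
  then have lim: "((\<lambda>y. norm (T \<bar>y - t\<bar> f - f)) \<longlongrightarrow> 0) (at t within {0..})"
    by (rule filterlim_compose[OF _ filterlim_abs_diff_at_right])
  have est: "\<bar>\<Lambda> (T (s + h) f) - \<Lambda> (T s f)\<bar> \<le> norm (T h f - f)" if "0 \<le> s" "0 \<le> h" for s h
  proof -
    have "\<Lambda> (T (s + h) f) - \<Lambda> (T s f) = \<Lambda> (T s (T h f - f))"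
      by (simp add: add[OF that] linear_diff[OF lin\<Lambda>] linear_diff[OF lin[OF that(1)]])
    then show ?thesis
      using bound\<Lambda>[of "T s (T h f - f)"] Markov_semigroup_contraction[OF T that(1), of "T h f - f"] by simp
  qed
  have "((\<lambda>y. \<Lambda> (T y f) - \<Lambda> (T t f)) \<longlongrightarrow> 0) (at t within {0..})"
  proof (rule Lim_null_comparison[OF _ lim])
    show "\<forall>\<^sub>F y in at t within {0..}. norm (\<Lambda> (T y f) - \<Lambda> (T t f)) \<le> norm (T \<bar>y - t\<bar> f - f)"
      unfolding eventually_at_filter
    proof (intro always_eventually allI impI)
      fix y :: real assume "y \<noteq> t" "y \<in> {0..}"
      then show "norm (\<Lambda> (T y f) - \<Lambda> (T t f)) \<le> norm (T \<bar>y - t\<bar> f - f)"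
        using est[of t "y - t"] est[of y "t - y"] t by (cases "y > t") (auto simp: abs_minus_commute)
    qed
  qed
  then show "((\<lambda>s. \<Lambda> (T s f)) \<longlongrightarrow> \<Lambda> (T t f)) (at t within {0..})"
    by (simp add: LIM_zero_iff)
qed

text \<open>The generator gives only a right derivative at time 0, which the semigroup law carries
  to \<open>t\<close>. The left quotient starts from \<open>T (t - h)\<close>, and writing
  \<open>T t g = T (t - h) (T h g)\<close> costs the extra term \<open>T h g - g\<close>, small by
  strong continuity; hence the two summands of \<open>B\<close>.\<close>

lemma semigroup_functional_derivative:
  assumes gen: "in_generator T f g" and t: "0 < t"
  shows "((\<lambda>s. \<Lambda> (T s f)) has_real_derivative \<Lambda> (T t g)) (at t)"
proof -
  have lin: "linear (T s)" if "0 \<le> s" for s using T that by (simp add: Markov_semigroup_def)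
  have add: "T (s + r) f = T s (T r f)" if "0 \<le> s" "0 \<le> r" for s r f
    using T that by (simp add: Markov_semigroup_def)
  define B where "B = (\<lambda>h. norm ((T h f - f) /\<^sub>R h - g) + norm (T h g - g))"
  have "((\<lambda>h. T h g) \<longlongrightarrow> g) (at_right 0)" using T by (simp add: Markov_semigroup_def)
  then have "(B \<longlongrightarrow> norm (g - g) + norm (g - g)) (at_right 0)"
    unfolding B_def using gen[unfolded in_generator_def] by (intro tendsto_intros)
  then have "(B \<longlongrightarrow> 0) (at_right 0)" by simp
  then have lim: "((\<lambda>y. B \<bar>y - t\<bar>) \<longlongrightarrow> 0) (at t)"
    by (rule filterlim_compose[OF _ filterlim_abs_diff_at_right])
  define \<phi> where "\<phi> = (\<lambda>s. \<Lambda> (T s f))"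
  have quot: "(\<phi> (s + h) - \<phi> s) / h = \<Lambda> (T s ((T h f - f) /\<^sub>R h))" if "0 \<le> s" "0 < h" for s h
    using that by (simp add: \<phi>_def add linear_diff[OF lin\<Lambda>] linear_diff[OF lin[OF that(1)]]
        linear_cmul[OF lin\<Lambda>] linear_cmul[OF lin[OF that(1)]] divide_inverse_commute)
  have est: "\<bar>\<Lambda> (T s w)\<bar> \<le> norm w" if "0 \<le> s" for s w
    using bound\<Lambda>[of "T s w"] Markov_semigroup_contraction[OF T that, of w] by simp
  have right: "\<bar>(\<phi> (t + h) - \<phi> t) / h - \<Lambda> (T t g)\<bar> \<le> B h" if h: "0 < h" for h
  proof -
    have "(\<phi> (t + h) - \<phi> t) / h - \<Lambda> (T t g) = \<Lambda> (T t ((T h f - f) /\<^sub>R h - g))"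
      using quot[of t h] t h by (simp add: linear_diff[OF lin\<Lambda>] linear_diff[OF lin])
    then show ?thesis
      using est[of t "(T h f - f) /\<^sub>R h - g"] norm_ge_zero[of "T h g - g"] t unfolding B_def by linarith
  qed
  have left: "\<bar>(\<phi> t - \<phi> (t - h)) / h - \<Lambda> (T t g)\<bar> \<le> B h" if h: "0 < h" "h < t" for h
  proof -
    have "(\<phi> t - \<phi> (t - h)) / h - \<Lambda> (T t g) = \<Lambda> (T (t - h) (((T h f - f) /\<^sub>R h - g) - (T h g - g)))"
      using quot[of "t - h" h] add[of "t - h" h g] t h by (simp add: linear_diff[OF lin\<Lambda>] linear_diff[OF lin])
    then have "\<bar>(\<phi> t - \<phi> (t - h)) / h - \<Lambda> (T t g)\<bar> \<le> norm (((T h f - f) /\<^sub>R h - g) - (T h g - g))"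
      using est[of "t - h"] h by simp
    also have "\<dots> \<le> B h" unfolding B_def by (rule norm_triangle_ineq4)
    finally show ?thesis .
  qed
  have "((\<lambda>y. (\<phi> y - \<phi> t) / (y - t) - \<Lambda> (T t g)) \<longlongrightarrow> 0) (at t)"
  proof (rule Lim_null_comparison[OF _ lim])
    have "\<forall>\<^sub>F y in at t. y > 0" using t by (intro order_tendstoD(1)[OF tendsto_ident_at])
    then have "\<forall>\<^sub>F y in at t. y > 0 \<and> y \<noteq> t" by (auto simp: eventually_at_filter elim: eventually_mono)
    then show "\<forall>\<^sub>F y in at t. norm ((\<phi> y - \<phi> t) / (y - t) - \<Lambda> (T t g)) \<le> B \<bar>y - t\<bar>"
    proof eventually_elim
      case (elim y)
      show ?case
      proof (cases "y > t")
        case True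
        then show ?thesis using right[of "y - t"] by simp
      next
        case False
        then have "(\<phi> t - \<phi> y) / (t - y) = (\<phi> y - \<phi> t) / (y - t)"
          using elim by (simp add: divide_simps) (simp add: algebra_simps)
        then show ?thesis using left[of "t - y"] elim False by simp
      qed
    qed
  qed
  then show ?thesis
    unfolding has_field_derivative_iff \<phi>_def by (simp add: LIM_zero_iff)
qed

end

text \<open>In occupation coordinates finite and infinite \<open>S\<close> are treated alike:
  stability over a finite \<open>UNIV\<close> passes to every subset by setting the other variables
  to 0.\<close>

lemma strongly_Rayleigh_iff:
  fixes \<mu> :: "('s::countable \<Rightarrow> bool) measure"
  assumes "prob_space \<mu>" "sets \<mu> = sets borel"
  shows "strongly_Rayleigh \<mu> \<longleftrightarrow> (\<forall>E. finite E \<longrightarrow> stable_or_zero E (\<lambda>A. of_real (occupation \<mu> A)))"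
proof (cases "finite (UNIV :: 's set)")
  case True
  then have "strongly_Rayleigh \<mu> \<longleftrightarrow> stable_or_zero UNIV (\<lambda>A. of_real (occupation \<mu> A))"
    by (simp add: strongly_Rayleigh_def strongly_Rayleigh_on_config_marginal[OF assms])
  then show ?thesis using stable_or_zero_subset[OF True subset_UNIV] True by auto
next
  case False
  then show ?thesis by (simp add: strongly_Rayleigh_def strongly_Rayleigh_on_config_marginal[OF assms])
qed

lemma strongly_Rayleigh_CNA_plus:
  fixes \<mu> :: "('s::countable \<Rightarrow> bool) measure"
  assumes "prob_space \<mu>" "sets \<mu> = sets borel" "strongly_Rayleigh \<mu>"
  shows "CNA_plus \<mu>"
  using assms(3) strongly_Rayleigh_on_CNA_plus[OF prob_on_config_marginal[OF assms(1,2)]]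
  unfolding strongly_Rayleigh_def CNA_plus_def by (auto split: if_splits)

text \<open>Take expectations in the Markov property between times 0 and \<open>t\<close>, for the
  continuous function \<open>occ A\<close>.\<close>

lemma Markov_process_occupation:
  fixes \<eta> :: "real \<Rightarrow> 'w \<Rightarrow> 's::countable \<Rightarrow> bool"
  assumes P: "Markov_process M T \<eta>" and t: "0 \<le> t" and A: "finite A"
  shows "occupation (distr M borel (\<eta> t)) A = (\<integral>\<omega>. apply_bcontfun (T t (occ A)) (\<eta> 0 \<omega>) \<partial>M)"
proof -
  interpret prob_space M using P by (simp add: Markov_process_def)
  have meas: "\<eta> s \<in> M \<rightarrow>\<^sub>M borel" if "0 \<le> s" for s using P that by (simp add: Markov_process_def)
  have "subalgebra M (natural_filtration M \<eta> 0)"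
  proof -
    have sub: "{\<eta> u -` B \<inter> space M | u B. u \<in> {0..0} \<and> B \<in> sets borel} \<subseteq> sets M"
      using measurable_sets[OF meas[of 0]] by auto
    then have "sigma_sets (space M) {\<eta> u -` B \<inter> space M | u B. u \<in> {0..0} \<and> B \<in> sets borel} \<subseteq> sets M"
      by (rule sets.sigma_sets_subset)
    moreover have "{\<eta> u -` B \<inter> space M | u B. u \<in> {0..0} \<and> B \<in> sets borel} \<subseteq> Pow (space M)" by auto
    ultimately show ?thesis by (simp add: subalgebra_def natural_filtration_def)
  qed
  then interpret finite_measure_subalgebra M "natural_filtration M \<eta> 0"
    by unfold_locales
  define X where "X = (\<lambda>\<omega>. apply_bcontfun (occ A) (\<eta> t \<omega>))"
  have S: "{\<zeta>. \<forall>i\<in>A. \<zeta> i} \<in> sets borel" by (rule sets_occupied[OF A])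
  have X: "X \<omega> = indicator (\<eta> t -` {\<zeta>. \<forall>i\<in>A. \<zeta> i} \<inter> space M) \<omega>" if "\<omega> \<in> space M" for \<omega>
    using that by (auto simp: X_def apply_occ[OF A] indicator_def)
  have mS: "\<eta> t -` {\<zeta>. \<forall>i\<in>A. \<zeta> i} \<inter> space M \<in> sets M" by (rule measurable_sets[OF meas[OF t] S])
  have intX: "integrable M X"
  proof (rule iffD2[OF Bochner_Integration.integrable_cong[OF HOL.refl X]])
    show "integrable M (indicat_real (\<eta> t -` {\<zeta>. \<forall>i\<in>A. \<zeta> i} \<inter> space M))"
      by (intro integrable_real_indicator mS) (simp add: emeasure_eq_measure)
  qed
  have "occupation (distr M borel (\<eta> t)) A = measure M (\<eta> t -` {\<zeta>. \<forall>i\<in>A. \<zeta> i} \<inter> space M)"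
    unfolding occupation_def by (rule measure_distr[OF meas[OF t] S])
  also have "\<dots> = (\<integral>\<omega>. X \<omega> \<partial>M)"
    by (subst Bochner_Integration.integral_cong[OF HOL.refl X]) (auto simp: Int_absorb2 mS sets.sets_into_space)
  also have "\<dots> = (\<integral>\<omega>. real_cond_exp M (natural_filtration M \<eta> 0) X \<omega> \<partial>M)"
    by (rule real_cond_exp_int(2)[OF intX, symmetric])
  also have "\<dots> = (\<integral>\<omega>. apply_bcontfun (T t (occ A)) (\<eta> 0 \<omega>) \<partial>M)"
  proof (rule integral_cong_AE)
    show "real_cond_exp M (natural_filtration M \<eta> 0) X \<in> borel_measurable M" by simp
    show "(\<lambda>\<omega>. apply_bcontfun (T t (occ A)) (\<eta> 0 \<omega>)) \<in> borel_measurable M"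
      by (rule measurable_compose[OF meas borel_measurable_continuous_onI]) auto
    have "AE \<omega> in M. real_cond_exp M (natural_filtration M \<eta> 0) (\<lambda>\<omega>. apply_bcontfun (occ A) (\<eta> (0 + t) \<omega>)) \<omega> =
      apply_bcontfun (T t (occ A)) (\<eta> 0 \<omega>)"
      using P t unfolding Markov_process_def by blast
    then show "AE \<omega> in M. real_cond_exp M (natural_filtration M \<eta> 0) X \<omega> = apply_bcontfun (T t (occ A)) (\<eta> 0 \<omega>)"
      by (simp add: X_def)
  qed
  finally show ?thesis .
qed

theorem theorem5p2:
  fixes M :: "'w measure"
    and Q :: "'s::countable \<Rightarrow> 's \<Rightarrow> real"
    and \<eta> :: "real \<Rightarrow> 'w \<Rightarrow> 's \<Rightarrow> bool"
  assumes "symmetric_exclusion_process M Q \<eta>"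
    and "strongly_Rayleigh (distr M borel (\<eta> 0))"
  shows "\<forall>t>0. strongly_Rayleigh (distr M borel (\<eta> t)) \<and> CNA_plus (distr M borel (\<eta> t))"
proof (intro allI impI)
  fix t :: real assume t: "t > 0"
  obtain T where kernel: "exclusion_kernel Q" and sg: "exclusion_semigroup Q T" and P: "Markov_process M T \<eta>"
    using assms(1) unfolding symmetric_exclusion_process_def by blast
  have T: "Markov_semigroup T" using sg by (simp add: exclusion_semigroup_def)
  obtain C where C: "\<And>i. (\<Sum>\<^sub>\<infinity>j. Q i j) \<le> C"
    using kernel unfolding exclusion_kernel_def bdd_above_def by auto
  interpret exclusion_rates Q C
    using kernel C by unfold_locales (auto simp: exclusion_kernel_def)
  interpret prob_space M using P by (simp add: Markov_process_def)
  have meas: "\<eta> s \<in> M \<rightarrow>\<^sub>M borel" if "0 \<le> s" for s using P that by (simp add: Markov_process_def)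
  have law: "prob_space (distr M borel (\<eta> s))" "sets (distr M borel (\<eta> s)) = sets borel" if "0 \<le> s" for s
    using prob_space_distr[OF meas[OF that]] by auto
  \<comment> \<open>Integration against the initial law; \<open>\<Lambda> (T s (occ A))\<close> is
    then the occupation probability of \<open>A\<close> at time \<open>s\<close>.\<close>
  define \<Lambda> where "\<Lambda> = (\<lambda>f :: ('s \<Rightarrow> bool) \<Rightarrow>\<^sub>C real. \<integral>\<omega>. apply_bcontfun f (\<eta> 0 \<omega>) \<partial>M)"
  have mf: "(\<lambda>\<omega>. apply_bcontfun f (\<eta> 0 \<omega>)) \<in> borel_measurable M" for f :: "('s \<Rightarrow> bool) \<Rightarrow>\<^sub>C real"
    by (rule measurable_compose[OF meas borel_measurable_continuous_onI]) auto
  have int: "integrable M (\<lambda>\<omega>. apply_bcontfun f (\<eta> 0 \<omega>))" for f :: "('s \<Rightarrow> bool) \<Rightarrow>\<^sub>C real"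
    using norm_bounded[of f] by (intro integrable_const_bound[of _ "norm f"] mf) auto
  have lin: "linear \<Lambda>"
    by (rule linearI) (simp_all add: \<Lambda>_def int)
  have bound: "\<bar>\<Lambda> f\<bar> \<le> norm f" for f
  proof -
    have "\<bar>\<Lambda> f\<bar> \<le> (\<integral>\<omega>. \<bar>apply_bcontfun f (\<eta> 0 \<omega>)\<bar> \<partial>M)"
      unfolding \<Lambda>_def by (rule integral_abs_bound)
    also have "\<dots> \<le> (\<integral>\<omega>. norm f \<partial>M)"
      using norm_bounded[of f] int by (intro integral_mono) auto
    finally show ?thesis by (simp add: prob_space)
  qed
  define u where "u = (\<lambda>s A. \<Lambda> (T s (occ A)))"
  have occ_u: "occupation (distr M borel (\<eta> s)) A = u s A" if "0 \<le> s" "finite A" for s A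
    unfolding u_def \<Lambda>_def by (rule Markov_process_occupation[OF P that])
  have st_u: "stable_or_zero E (\<lambda>A. complex_of_real (occupation (distr M borel (\<eta> s)) A)) \<longleftrightarrow>
      stable_or_zero E (\<lambda>A. complex_of_real (u s A))" if "0 \<le> s" "finite E" for s E
    by (intro stable_or_zero_cong) (simp add: occ_u that finite_subset[OF _ that(2)])
  have "stable_or_zero E (\<lambda>A. complex_of_real (u t A))" if E: "finite E" for E
  proof (rule stable_dual_flow[OF _ _ _ _ _ E])
    show "\<bar>u s A\<bar> \<le> 1" if "0 \<le> s" "finite A" for s A
      using bound[of "T s (occ A)"] Markov_semigroup_contraction[OF T that(1), of "occ A"] norm_occ[OF that(2)]
      by (simp add: u_def)
    show "continuous_on {0..} (\<lambda>s. u s A)" for A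
      unfolding u_def by (rule semigroup_functional_continuous[OF T lin bound])
    show "((\<lambda>s. u s A) has_real_derivative dual_gen Q (u s) A) (at s)" if s: "0 < s" and A: "finite A" for s A
    proof -
      obtain g where g: "in_generator T (occ A) g"
        "\<And>\<eta>. apply_bcontfun g \<eta> = exclusion_generator Q (apply_bcontfun (occ A)) \<eta>"
        using sg cylinder_occ[OF A] unfolding exclusion_semigroup_def by blast
      have "linear (T s)" using T s by (simp add: Markov_semigroup_def)
      then have "linear (\<lambda>f. \<Lambda> (T s f))" using linear_compose[OF _ lin, of "T s"] by (simp add: o_def)
      moreover have "\<bar>\<Lambda> (T s f)\<bar> \<le> norm f" for f
        using bound[of "T s f"] Markov_semigroup_contraction[OF T, of s f] s by simp
      \<comment> \<open>The composite of \<open>\<Lambda>\<close> and \<open>T s\<close> is again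
        linear and bounded by the norm, so it serves as the functional in
        \<open>generator_dual\<close>.\<close>
      ultimately have "\<Lambda> (T s g) = dual_gen Q (u s) A"
        unfolding u_def by (rule generator_dual[OF _ _ A g(2)])
      then show ?thesis
        using semigroup_functional_derivative[OF T lin bound g(1) s] by (simp add: u_def)
    qed
    show "stable_or_zero E (\<lambda>A. complex_of_real (u 0 A))" if "finite E" for E
      using assms(2) st_u[OF _ that, of 0] that unfolding strongly_Rayleigh_iff[OF law[OF order.refl]] by auto
  qed (use t in auto)
  then have "strongly_Rayleigh (distr M borel (\<eta> t))"
    using strongly_Rayleigh_iff[OF law, of t] st_u[of t] t by auto
  then show "strongly_Rayleigh (distr M borel (\<eta> t)) \<and> CNA_plus (distr M borel (\<eta> t))"
    using strongly_Rayleigh_CNA_plus[OF law] t by auto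
qed

end
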